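(* Let $F$ be a field of characteristic not $2$. Let $R$ be a simple finitely generated associative $F$-algebra with an involution $*:R\to R$, let $K=\{a\in R\mid a^*=-a\}$, and let $Z$ be the center of $R$. Suppose that $R$ contains a nonzero idempotent $e$ such that $ee^*=e^*e=0$. Then the Lie algebra $[K,K]/([K,K]\cap Z)$ is finitely generated.
   Context: An involution is an $F$-linear map $*$ with $(ab)^*=b^*a^*$ and $(a^* )^*=a$. $K$ is a Lie algebra over $F$ under $[a,b]=ab-ba$, and $[K,K]$ is the $F$-span of all $[a,b]$, $a,b\in K$. Simple means $R^2\neq 0$ and $R$ has no two-sided ideals other than $0$ and $R$; $R$ is not assumed unital. Finitely generated means finitely generated as an $F$-algebra of the respective type (associative or Lie). *)

theory Defs
  imports Complex_Main
begin

section \<open>Associative algebras without unit\<close>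

text \<open>
  The class \<^class>\<open>ring\<close> consists of associative rings that need not have a unit.  The
  type \<open>'a\<close> is the algebra and \<open>'f\<close> is the ground field.
\<close>

locale assoc_algebra = vector_space scale
  for scale :: "'f::field \<Rightarrow> 'a::ring \<Rightarrow> 'a" +
  assumes scale_mult_left: "scale c (x * y) = scale c x * y"
    and scale_mult_right: "scale c (x * y) = x * scale c y"
begin

definition subalgebra :: "'a set \<Rightarrow> bool" where
  "subalgebra S \<longleftrightarrow> subspace S \<and> (\<forall>x\<in>S. \<forall>y\<in>S. x * y \<in> S)"

definition finitely_generated :: bool where
  "finitely_generated \<longleftrightarrow> (\<exists>X. finite X \<and> subalgebra hull X = UNIV)"

text \<open>
  Ideals are ideals of the algebra, hence subspaces.  If some product is nonzero, the
  resulting notion of simplicity agrees with the one that allows ring ideals that are not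
  subspaces: for such an ideal \<open>I\<close>, the span of \<open>R I R\<close> is contained in \<open>I\<close>.
\<close>

definition two_sided_ideal :: "'a set \<Rightarrow> bool" where
  "two_sided_ideal I \<longleftrightarrow> subspace I \<and> (\<forall>r. \<forall>x\<in>I. r * x \<in> I \<and> x * r \<in> I)"

definition simple :: bool where
  "simple \<longleftrightarrow> (\<exists>x y :: 'a. x * y \<noteq> 0) \<and> (\<forall>I. two_sided_ideal I \<longrightarrow> I = {0} \<or> I = UNIV)"

definition involution :: "('a \<Rightarrow> 'a) \<Rightarrow> bool" where
  "involution star \<longleftrightarrow> Vector_Spaces.linear scale scale star \<and>
     (\<forall>a b. star (a * b) = star b * star a) \<and> (\<forall>a. star (star a) = a)"

end

definition commutator :: "'a::ring \<Rightarrow> 'a \<Rightarrow> 'a" where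
  "commutator a b = a * b - b * a"

definition skew_elements :: "('a::ring \<Rightarrow> 'a) \<Rightarrow> 'a set" where
  "skew_elements star = {a. star a = - a}"

definition ring_center :: "'a::ring set" where
  "ring_center = {z. \<forall>x. z * x = x * z}"

definition (in assoc_algebra) commutator_span :: "'a set \<Rightarrow> 'a set \<Rightarrow> 'a set" where
  "commutator_span A B = span {commutator a b | a b. a \<in> A \<and> b \<in> B}"


section \<open>Lie algebras on carrier sets\<close>

record ('f, 'a) lie_structure =
  lie_carrier :: "'a set"
  lie_zero :: 'a
  lie_add :: "'a \<Rightarrow> 'a \<Rightarrow> 'a"
  lie_scale :: "'f \<Rightarrow> 'a \<Rightarrow> 'a"
  lie_bracket :: "'a \<Rightarrow> 'a \<Rightarrow> 'a"

definition lie_subalgebra :: "('f, 'a) lie_structure \<Rightarrow> 'a set \<Rightarrow> bool" where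
  "lie_subalgebra L S \<longleftrightarrow> S \<subseteq> lie_carrier L \<and> lie_zero L \<in> S \<and>
     (\<forall>x\<in>S. \<forall>y\<in>S. lie_add L x y \<in> S) \<and>
     (\<forall>c. \<forall>x\<in>S. lie_scale L c x \<in> S) \<and>
     (\<forall>x\<in>S. \<forall>y\<in>S. lie_bracket L x y \<in> S)"

definition lie_ideal :: "('f, 'a) lie_structure \<Rightarrow> 'a set \<Rightarrow> bool" where
  "lie_ideal L I \<longleftrightarrow> lie_subalgebra L I \<and>
     (\<forall>x\<in>lie_carrier L. \<forall>y\<in>I. lie_bracket L x y \<in> I)"

definition lie_finitely_generated :: "('f, 'a) lie_structure \<Rightarrow> bool" where
  "lie_finitely_generated L \<longleftrightarrow>
     (\<exists>X. finite X \<and> X \<subseteq> lie_carrier L \<and> lie_subalgebra L hull X = lie_carrier L)"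

definition lie_coset :: "('f, 'a) lie_structure \<Rightarrow> 'a set \<Rightarrow> 'a \<Rightarrow> 'a set" where
  "lie_coset L I x = lie_add L x ` I"

text \<open>
  The operations of the quotient do not choose representatives: the union of the cosets of
  all results of representatives is a single coset when \<open>I\<close> is an ideal (lemmas
  \<open>quotient_add\<close>, \<open>quotient_scale\<close> and \<open>quotient_bracket\<close> below).
\<close>

definition lie_quotient :: "('f, 'a) lie_structure \<Rightarrow> 'a set \<Rightarrow> ('f, 'a set) lie_structure" where
  "lie_quotient L I =
     \<lparr>lie_carrier = lie_coset L I ` lie_carrier L,
      lie_zero = lie_coset L I (lie_zero L),
      lie_add = (\<lambda>A B. \<Union>a\<in>A. \<Union>b\<in>B. lie_coset L I (lie_add L a b)),
      lie_scale = (\<lambda>c A. \<Union>a\<in>A. lie_coset L I (lie_scale L c a)),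
      lie_bracket = (\<lambda>A B. \<Union>a\<in>A. \<Union>b\<in>B. lie_coset L I (lie_bracket L a b))\<rparr>"

locale lie_algebra =
  fixes L :: "('f::field, 'a) lie_structure"
  assumes zero_closed: "lie_zero L \<in> lie_carrier L"
    and add_closed: "\<lbrakk>x \<in> lie_carrier L; y \<in> lie_carrier L\<rbrakk> \<Longrightarrow> lie_add L x y \<in> lie_carrier L"
    and scale_closed: "x \<in> lie_carrier L \<Longrightarrow> lie_scale L c x \<in> lie_carrier L"
    and bracket_closed:
      "\<lbrakk>x \<in> lie_carrier L; y \<in> lie_carrier L\<rbrakk> \<Longrightarrow> lie_bracket L x y \<in> lie_carrier L"
    and add_assoc: "\<lbrakk>x \<in> lie_carrier L; y \<in> lie_carrier L; z \<in> lie_carrier L\<rbrakk>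
      \<Longrightarrow> lie_add L (lie_add L x y) z = lie_add L x (lie_add L y z)"
    and add_commute: "\<lbrakk>x \<in> lie_carrier L; y \<in> lie_carrier L\<rbrakk> \<Longrightarrow> lie_add L x y = lie_add L y x"
    and add_zero: "x \<in> lie_carrier L \<Longrightarrow> lie_add L x (lie_zero L) = x"
    and add_inverse: "x \<in> lie_carrier L \<Longrightarrow> lie_add L x (lie_scale L (-1) x) = lie_zero L"
    and scale_add: "\<lbrakk>x \<in> lie_carrier L; y \<in> lie_carrier L\<rbrakk>
      \<Longrightarrow> lie_scale L c (lie_add L x y) = lie_add L (lie_scale L c x) (lie_scale L c y)"
    and add_scale: "x \<in> lie_carrier L
      \<Longrightarrow> lie_scale L (c + d) x = lie_add L (lie_scale L c x) (lie_scale L d x)"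
    and scale_scale: "x \<in> lie_carrier L \<Longrightarrow> lie_scale L c (lie_scale L d x) = lie_scale L (c * d) x"
    and scale_one: "x \<in> lie_carrier L \<Longrightarrow> lie_scale L 1 x = x"
    and bracket_add_left: "\<lbrakk>x \<in> lie_carrier L; y \<in> lie_carrier L; z \<in> lie_carrier L\<rbrakk>
      \<Longrightarrow> lie_bracket L (lie_add L x y) z = lie_add L (lie_bracket L x z) (lie_bracket L y z)"
    and bracket_add_right: "\<lbrakk>x \<in> lie_carrier L; y \<in> lie_carrier L; z \<in> lie_carrier L\<rbrakk>
      \<Longrightarrow> lie_bracket L x (lie_add L y z) = lie_add L (lie_bracket L x y) (lie_bracket L x z)"
    and bracket_scale_left: "\<lbrakk>x \<in> lie_carrier L; y \<in> lie_carrier L\<rbrakk>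
      \<Longrightarrow> lie_bracket L (lie_scale L c x) y = lie_scale L c (lie_bracket L x y)"
    and bracket_scale_right: "\<lbrakk>x \<in> lie_carrier L; y \<in> lie_carrier L\<rbrakk>
      \<Longrightarrow> lie_bracket L x (lie_scale L c y) = lie_scale L c (lie_bracket L x y)"
    and bracket_self: "x \<in> lie_carrier L \<Longrightarrow> lie_bracket L x x = lie_zero L"
    and jacobi: "\<lbrakk>x \<in> lie_carrier L; y \<in> lie_carrier L; z \<in> lie_carrier L\<rbrakk>
      \<Longrightarrow> lie_add L (lie_bracket L x (lie_bracket L y z))
            (lie_add L (lie_bracket L y (lie_bracket L z x)) (lie_bracket L z (lie_bracket L x y)))
          = lie_zero L"
begin

lemma ideal_carrier: "lie_ideal L I \<Longrightarrow> i \<in> I \<Longrightarrow> i \<in> lie_carrier L"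
  by (auto simp: lie_ideal_def lie_subalgebra_def)

lemma coset_absorb:
  assumes I: "lie_ideal L I" and x: "x \<in> lie_carrier L" and i: "i \<in> I"
  shows "lie_coset L I (lie_add L x i) = lie_coset L I x"
proof -
  have iL: "i \<in> lie_carrier L" using I i by (rule ideal_carrier)
  have neg: "lie_scale L (-1) i \<in> I" and clo: "\<And>j k. j \<in> I \<Longrightarrow> k \<in> I \<Longrightarrow> lie_add L j k \<in> I"
    using I i by (auto simp: lie_ideal_def lie_subalgebra_def)
  have 1: "lie_add L (lie_add L x i) j = lie_add L x (lie_add L i j)" if "j \<in> I" for j
    using add_assoc[OF x iL ideal_carrier[OF I that]] .
  have 2: "lie_add L i (lie_add L (lie_scale L (-1) i) j) = j" if j: "j \<in> I" for j
  proof -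
    have jL: "j \<in> lie_carrier L" using I j by (rule ideal_carrier)
    have "lie_add L i (lie_add L (lie_scale L (-1) i) j) = lie_add L (lie_zero L) j"
      using add_assoc[OF iL scale_closed[OF iL] jL] add_inverse[OF iL] by metis
    also have "\<dots> = j" using add_zero[OF jL] add_commute[OF zero_closed jL] by simp
    finally show ?thesis .
  qed
  show ?thesis unfolding lie_coset_def
  proof (intro equalityI subsetI)
    fix u assume "u \<in> lie_add L (lie_add L x i) ` I"
    then show "u \<in> lie_add L x ` I" using 1 clo i by auto
  next
    fix u assume "u \<in> lie_add L x ` I"
    then obtain j where j: "j \<in> I" and u: "u = lie_add L x j" by auto
    have "u = lie_add L (lie_add L x i) (lie_add L (lie_scale L (-1) i) j)"
      using u 1[OF clo[OF neg j]] 2[OF j] by simp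
    then show "u \<in> lie_add L (lie_add L x i) ` I" using clo[OF neg j] by blast
  qed
qed

lemma coset_nonempty: "lie_ideal L I \<Longrightarrow> lie_coset L I x \<noteq> {}"
  by (auto simp: lie_coset_def lie_ideal_def lie_subalgebra_def)

lemma quotient_add:
  assumes I: "lie_ideal L I" and x: "x \<in> lie_carrier L" and y: "y \<in> lie_carrier L"
  shows "lie_add (lie_quotient L I) (lie_coset L I x) (lie_coset L I y)
           = lie_coset L I (lie_add L x y)"
proof -
  have "lie_coset L I (lie_add L a b) = lie_coset L I (lie_add L x y)"
    if ab: "a \<in> lie_coset L I x" "b \<in> lie_coset L I y" for a b
  proof -
    obtain i j where ij: "i \<in> I" "j \<in> I" "a = lie_add L x i" "b = lie_add L y j"
      using ab by (auto simp: lie_coset_def)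
    have L: "i \<in> lie_carrier L" "j \<in> lie_carrier L" using ij I ideal_carrier by auto
    have "lie_add L a b = lie_add L (lie_add L (lie_add L x y) j) i"
      unfolding ij(3,4) using x y L by (metis add_assoc add_commute add_closed)
    then show ?thesis
      using coset_absorb[OF I] ij x y L by (simp add: add_closed)
  qed
  then have "(\<Union>a\<in>lie_coset L I x. \<Union>b\<in>lie_coset L I y. lie_coset L I (lie_add L a b))
      = lie_coset L I (lie_add L x y)"
    using coset_nonempty[OF I] by fastforce
  then show ?thesis by (simp add: lie_quotient_def)
qed

lemma quotient_scale:
  assumes I: "lie_ideal L I" and x: "x \<in> lie_carrier L"
  shows "lie_scale (lie_quotient L I) c (lie_coset L I x) = lie_coset L I (lie_scale L c x)"
proof -
  have "lie_coset L I (lie_scale L c a) = lie_coset L I (lie_scale L c x)"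
    if a: "a \<in> lie_coset L I x" for a
  proof -
    obtain i where i: "i \<in> I" "a = lie_add L x i" using a by (auto simp: lie_coset_def)
    have "lie_scale L c i \<in> I" using I i by (auto simp: lie_ideal_def lie_subalgebra_def)
    then show ?thesis
      using i coset_absorb[OF I scale_closed[OF x]] scale_add[OF x ideal_carrier[OF I i(1)]] by simp
  qed
  then have "(\<Union>a\<in>lie_coset L I x. lie_coset L I (lie_scale L c a))
      = lie_coset L I (lie_scale L c x)"
    using coset_nonempty[OF I] by fastforce
  then show ?thesis by (simp add: lie_quotient_def)
qed

lemma bracket_anticomm:
  assumes x: "x \<in> lie_carrier L" and y: "y \<in> lie_carrier L"
  shows "lie_bracket L y x = lie_scale L (-1) (lie_bracket L x y)"
proof -
  let ?p = "lie_bracket L x y" and ?q = "lie_bracket L y x"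
  have pq: "?p \<in> lie_carrier L" "?q \<in> lie_carrier L" using x y by (auto intro: bracket_closed)
  have "lie_zero L = lie_bracket L (lie_add L x y) (lie_add L x y)"
    using x y by (simp add: bracket_self add_closed)
  also have "\<dots> = lie_add L (lie_add L (lie_bracket L x x) ?q) (lie_add L ?p (lie_bracket L y y))"
    using x y by (simp add: bracket_add_left bracket_add_right add_closed)
  also have "\<dots> = lie_add L ?q ?p"
    using x y pq by (metis bracket_self add_zero add_commute zero_closed)
  finally have z: "lie_add L ?q ?p = lie_zero L" by simp
  have "?q = lie_add L ?q (lie_add L ?p (lie_scale L (-1) ?p))"
    using pq by (simp add: add_inverse add_zero)
  also have "\<dots> = lie_add L (lie_zero L) (lie_scale L (-1) ?p)"
    using pq z by (simp add: add_assoc[symmetric] scale_closed)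
  also have "\<dots> = lie_scale L (-1) ?p"
    using pq by (metis add_zero add_commute zero_closed scale_closed)
  finally show ?thesis .
qed

lemma quotient_bracket:
  assumes I: "lie_ideal L I" and x: "x \<in> lie_carrier L" and y: "y \<in> lie_carrier L"
  shows "lie_bracket (lie_quotient L I) (lie_coset L I x) (lie_coset L I y)
           = lie_coset L I (lie_bracket L x y)"
proof -
  have right: "lie_bracket L u i \<in> I" if "u \<in> lie_carrier L" "i \<in> I" for u i
    using I that by (auto simp: lie_ideal_def)
  have left: "lie_bracket L i u \<in> I" if "u \<in> lie_carrier L" "i \<in> I" for u i
    using I that right[OF that] bracket_anticomm[OF that(1) ideal_carrier[OF I that(2)]]
    by (auto simp: lie_ideal_def lie_subalgebra_def)
  have "lie_coset L I (lie_bracket L a b) = lie_coset L I (lie_bracket L x y)"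
    if ab: "a \<in> lie_coset L I x" "b \<in> lie_coset L I y" for a b
  proof -
    obtain i j where ij: "i \<in> I" "j \<in> I" "a = lie_add L x i" "b = lie_add L y j"
      using ab by (auto simp: lie_coset_def)
    have L: "i \<in> lie_carrier L" "j \<in> lie_carrier L" "b \<in> lie_carrier L"
      using ij I y ideal_carrier by (auto intro: add_closed)
    have "lie_bracket L a b = lie_add L (lie_bracket L x b) (lie_bracket L i b)"
      unfolding ij(3) using x L by (simp add: bracket_add_left)
    moreover have "lie_bracket L x b = lie_add L (lie_bracket L x y) (lie_bracket L x j)"
      unfolding ij(4) using x y L by (simp add: bracket_add_right)
    ultimately show ?thesis
      using coset_absorb[OF I] left[OF L(3) ij(1)] right[OF x ij(2)] x y L
      by (simp add: bracket_closed add_closed)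
  qed
  then have "(\<Union>a\<in>lie_coset L I x. \<Union>b\<in>lie_coset L I y. lie_coset L I (lie_bracket L a b))
      = lie_coset L I (lie_bracket L x y)"
    using coset_nonempty[OF I] by fastforce
  then show ?thesis by (simp add: lie_quotient_def)
qed

lemma lie_algebra_quotient:
  assumes I: "lie_ideal L I"
  shows "lie_algebra (lie_quotient L I)"
proof -
  have carrier: "lie_carrier (lie_quotient L I) = lie_coset L I ` lie_carrier L"
    and zero: "lie_zero (lie_quotient L I) = lie_coset L I (lie_zero L)"
    by (simp_all add: lie_quotient_def)
  note q = carrier zero quotient_add[OF I] quotient_scale[OF I] quotient_bracket[OF I]
  show ?thesis
  proof
    fix x y assume "x \<in> lie_carrier (lie_quotient L I)" "y \<in> lie_carrier (lie_quotient L I)"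
    then obtain u v where "u \<in> lie_carrier L" "x = lie_coset L I u"
      "v \<in> lie_carrier L" "y = lie_coset L I v" by (auto simp: carrier)
    then show "lie_add (lie_quotient L I) x y = lie_add (lie_quotient L I) y x"
      using add_commute[of u v] by (simp add: q)
  qed (auto simp: q zero_closed add_closed scale_closed bracket_closed add_assoc add_zero
         add_inverse scale_add add_scale scale_scale scale_one bracket_add_left bracket_add_right
         bracket_scale_left bracket_scale_right bracket_self jacobi)
qed

end


section \<open>Lie algebras inside an associative algebra\<close>

context assoc_algebra
begin

definition commutator_lie_algebra :: "'a set \<Rightarrow> ('f, 'a) lie_structure" where
  "commutator_lie_algebra S =
     \<lparr>lie_carrier = S, lie_zero = 0, lie_add = (+), lie_scale = scale, lie_bracket = commutator\<rparr>"

lemma lie_algebra_commutator_lie_algebra: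
  assumes S: "subspace S" and closed: "\<And>x y. x \<in> S \<Longrightarrow> y \<in> S \<Longrightarrow> commutator x y \<in> S"
  shows "lie_algebra (commutator_lie_algebra S)"
proof
  fix x y
  assume "x \<in> lie_carrier (commutator_lie_algebra S)" "y \<in> lie_carrier (commutator_lie_algebra S)"
  then show "lie_bracket (commutator_lie_algebra S) x y \<in> lie_carrier (commutator_lie_algebra S)"
    using closed by (simp add: commutator_lie_algebra_def)
qed (use S in \<open>simp_all add: commutator_lie_algebra_def subspace_0 subspace_add subspace_scale
       scale_right_distrib scale_left_distrib scale_right_diff_distrib commutator_def algebra_simps
       scale_mult_left[symmetric] scale_mult_right[symmetric]\<close>)

lemma subspace_skew:
  assumes "involution star"
  shows "subspace (skew_elements star)"
proof -
  interpret star: Vector_Spaces.linear scale scale star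
    using assms by (simp add: involution_def)
  show ?thesis
    by (rule subspaceI) (auto simp: skew_elements_def star.zero star.add star.scale)
qed

lemma commutator_skew:
  assumes star: "involution star" and a: "a \<in> skew_elements star" and b: "b \<in> skew_elements star"
  shows "commutator a b \<in> skew_elements star"
proof -
  interpret star: Vector_Spaces.linear scale scale star
    using star by (simp add: involution_def)
  have "star (a * b) = star b * star a" "star (b * a) = star a * star b"
    using star by (auto simp: involution_def)
  then show ?thesis using a b by (simp add: skew_elements_def commutator_def star.diff)
qed

lemma commutator_span_skew_subset:
  assumes "involution star"
  shows "commutator_span (skew_elements star) (skew_elements star) \<subseteq> skew_elements star"
  unfolding commutator_span_def
  by (rule span_minimal) (use assms in \<open>auto intro: commutator_skew subspace_skew\<close>)

lemma lie_algebra_derived_skew: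
  assumes star: "involution star"
  defines "D \<equiv> commutator_span (skew_elements star) (skew_elements star)"
  shows "lie_algebra (commutator_lie_algebra D)"
proof (rule lie_algebra_commutator_lie_algebra)
  show "subspace D" by (simp add: D_def commutator_span_def)
  fix x y assume "x \<in> D" "y \<in> D"
  then have "x \<in> skew_elements star" "y \<in> skew_elements star"
    using commutator_span_skew_subset[OF star] by (auto simp: D_def)
  then show "commutator x y \<in> D"
    by (auto simp: D_def commutator_span_def intro!: span_base)
qed

lemma lie_ideal_center:
  assumes S: "subspace S"
  shows "lie_ideal (commutator_lie_algebra S) (S \<inter> ring_center)"
proof -
  have sub: "subspace (S \<inter> ring_center)"
  proof (rule subspace_inter[OF S])
    show "subspace ring_center"
      by (rule subspaceI) (simp_all add: ring_center_def distrib_left distrib_right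
          scale_mult_left[symmetric] scale_mult_right[symmetric])
  qed
  have comm: "z \<in> ring_center \<Longrightarrow> commutator x z = 0" for x z
    by (simp add: ring_center_def commutator_def)
  show ?thesis
    using sub comm unfolding lie_ideal_def lie_subalgebra_def commutator_lie_algebra_def subspace_def
    by (auto simp: comm)
qed

lemma lie_algebra_derived_skew_mod_center:
  assumes star: "involution star"
  defines "D \<equiv> commutator_span (skew_elements star) (skew_elements star)"
  shows "lie_algebra (lie_quotient (commutator_lie_algebra D) (D \<inter> ring_center))"
  using lie_algebra.lie_algebra_quotient[OF lie_algebra_derived_skew[OF star] lie_ideal_center]
  by (simp add: D_def commutator_span_def)

end

end

theory Submission
  imports Defs
begin

text \<open>
  Write \<open>f = e\<^sup>*\<close>, \<open>u = e + f\<close>, \<open>A = eRe\<close>, and let \<open>K\<^sub>+\<close>, \<open>K\<^sub>-\<close> be the skew elements of \<open>eRf\<close>, \<open>fRe\<close>.  The products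
  \<open>kl\<close> with \<open>k \<in> K\<^sub>+\<close>, \<open>l \<in> K\<^sub>-\<close> generate a subalgebra of the simple algebra \<open>A\<close> that is also a Lie ideal; by
  Herstein it is all of \<open>A\<close> or central.

  In the first case \<open>uRu\<close> is generated by finitely many elements of \<open>K\<^sub>+ \<union> K\<^sub>-\<close>, and \<open>K\<^sub>\<plusminus>\<close> is spanned by the sums
  \<open>w + w'\<close> of an alternating word of odd length in these generators and its reversal.  The triple products
  \<open>[[a, b], c] = abc + cba\<close> show that, modulo shorter words, \<open>w + w'\<close> is alternating in the letters of \<open>w\<close> in odd
  positions, so the long words are redundant.  The elements \<open>p - p\<^sup>*\<close> with \<open>p \<in> uR(1 - u)\<close> come from finitely many
  by the action of \<open>K\<^sub>\<plusminus>\<close>, and all these elements together generate \<open>[K, K]\<close>.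

  In the second case \<open>A\<close> is commutative, or carries an involution whose symmetric elements are central; either way
  it is a finite module over a finitely generated central subalgebra.  As the center of \<open>A\<close> is a field, a variant of
  Zariski's lemma makes \<open>A\<close>, and then \<open>R\<close>, finite-dimensional.  In both cases \<open>[K, K]\<close> itself is finitely generated.
\<close>

section \<open>Subalgebras and Lie subalgebras\<close>

text \<open>The obstacle in the first case is the elements \<open>a - star a\<close> with a in A.
  Every skew element is the sum of one of them and an element of the Lie algebra generated by K+, K-
  and the \<open>p - star p\<close>, but nothing puts them into that Lie algebra. Two facts get
  around this. They normalize it, which settles the mixed brackets. And the bracket of two of them
  is \<open>c - star c\<close> with c = [a, b]; for a = kl this c is a difference of products k'l',
  whose skew parts are the brackets [k', l']. Passing from products kl to all of A requires that
  they generate A, and this forces the case distinction. In the second case the subalgebra over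
  which A is a finite module is only a domain inside the center of A. Its generators are removed one
  at a time while A stays finite up to inverting one nonzero element; this weak finiteness already
  makes the removed generator algebraic over the others. Over the ground field inverting an element
  costs nothing. As R may lack a unit, expressions with 1 - u are written out, and e or u takes the
  place of 1 in powers and empty words.\<close>

context assoc_algebra
begin

lemma halve:
  assumes "(2::'f) \<noteq> 0" "subspace S" "x + x \<in> S"
  shows "x \<in> S"
proof -
  have "x + x = scale 2 x" using scale_left_distrib[of 1 1 x] by simp
  then have "scale (inverse 2) (x + x) = x" using assms(1) by simp
  then show ?thesis using subspace_scale[OF assms(2,3), of "inverse 2"] by simp
qed

lemma subspace_mult_left_vimage: "subspace S \<Longrightarrow> subspace {x. a * x \<in> S}"
  unfolding subspace_def by (auto simp: distrib_left scale_mult_right[symmetric])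

lemma subspace_mult_right_vimage: "subspace S \<Longrightarrow> subspace {x. x * a \<in> S}"
  unfolding subspace_def by (auto simp: distrib_right scale_mult_left[symmetric])

lemma commutator_add_left: "commutator (x + y) z = commutator x z + commutator y (z::'a)"
  and commutator_add_right: "commutator z (x + y) = commutator z x + commutator z (y::'a)"
  and commutator_scale_left: "commutator (scale c x) z = scale c (commutator x z)"
  and commutator_scale_right: "commutator z (scale c x) = scale c (commutator z x)"
  by (simp_all add: commutator_def algebra_simps scale_right_diff_distrib
      scale_mult_left[symmetric] scale_mult_right[symmetric])

lemma commutator_zero_left [simp]: "commutator 0 (x::'a) = 0"
  and commutator_zero_right [simp]: "commutator (x::'a) 0 = 0"
  by (simp_all add: commutator_def)

lemma subspace_commutator_vimage: "subspace S \<Longrightarrow> subspace {x. commutator a x \<in> S}"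
  unfolding subspace_def by (auto simp: commutator_add_right commutator_scale_right)

lemma subalgebra_hull: "subalgebra (subalgebra hull S)"
proof (rule hull_in)
  fix T assume T: "\<forall>t\<in>T. subalgebra t"
  then have "subspace (\<Inter>T)" by (intro subspace_Inter) (simp add: subalgebra_def)
  then show "subalgebra (\<Inter>T)" using T by (auto simp: subalgebra_def)
qed

lemma subalgebra_hull_minimal: "subalgebra T \<Longrightarrow> S \<subseteq> T \<Longrightarrow> subalgebra hull S \<subseteq> T"
  by (rule hull_minimal)

text \<open>The finite subsets of \<open>S\<close> are directed, so the union of their hulls is
  already a subalgebra.\<close>

lemma subalgebra_hull_finite_support:
  assumes "x \<in> subalgebra hull S"
  shows "\<exists>T. finite T \<and> T \<subseteq> S \<and> x \<in> subalgebra hull T"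
proof -
  define U where "U = {x. \<exists>T. finite T \<and> T \<subseteq> S \<and> x \<in> subalgebra hull T}"
  have sub: "subspace (subalgebra hull T)" for T
    using subalgebra_hull by (simp add: subalgebra_def)
  have UI: "x \<in> U" if "finite T" "T \<subseteq> S" "x \<in> subalgebra hull T" for x T
    using that unfolding U_def by blast
  have "x + y \<in> U \<and> x * y \<in> U" if xy: "x \<in> U" "y \<in> U" for x y
  proof -
    obtain T T' where T: "finite T" "T \<subseteq> S" "x \<in> subalgebra hull T"
      and T': "finite T'" "T' \<subseteq> S" "y \<in> subalgebra hull T'" using xy unfolding U_def by blast
    have "x \<in> subalgebra hull (T \<union> T')" "y \<in> subalgebra hull (T \<union> T')"
      using subsetD[OF hull_mono T(3)] subsetD[OF hull_mono T'(3)] by simp_all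
    then have "x + y \<in> subalgebra hull (T \<union> T')" "x * y \<in> subalgebra hull (T \<union> T')"
      using subalgebra_hull[of "T \<union> T'"] by (auto simp: subalgebra_def subspace_add)
    then show ?thesis using T(1,2) T'(1,2) UI[of "T \<union> T'"] by simp
  qed
  moreover have "0 \<in> U" using subspace_0[OF sub] by (intro UI[of "{}"]) simp_all
  moreover have "scale c x \<in> U" if x: "x \<in> U" for c x
  proof -
    obtain T where T: "finite T" "T \<subseteq> S" "x \<in> subalgebra hull T" using x unfolding U_def by blast
    show ?thesis by (rule UI[OF T(1,2) subspace_scale[OF sub T(3)]])
  qed
  ultimately have "subalgebra U"
    unfolding subalgebra_def by (intro conjI subspaceI ballI) simp_all
  moreover have "S \<subseteq> U"
  proof
    fix x assume "x \<in> S"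
    then show "x \<in> U" using hull_inc[of x "{x}"] by (intro UI[of "{x}"]) simp_all
  qed
  ultimately have "subalgebra hull S \<subseteq> U" by (rule hull_minimal[rotated])
  then have "x \<in> U" using assms by (rule subsetD)
  then show ?thesis unfolding U_def by simp
qed

lemma subalgebra_hull_finite_supports:
  assumes "finite G" "G \<subseteq> subalgebra hull S"
  shows "\<exists>T. finite T \<and> T \<subseteq> S \<and> G \<subseteq> subalgebra hull T"
  using assms
proof (induction G)
  case empty
  then show ?case by (intro exI[of _ "{}"]) simp
next
  case (insert x G)
  then obtain T where T: "finite T" "T \<subseteq> S" "G \<subseteq> subalgebra hull T" by auto
  have "x \<in> subalgebra hull S" using insert.prems by simp
  then obtain T' where T': "finite T'" "T' \<subseteq> S" "x \<in> subalgebra hull T'"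
    using subalgebra_hull_finite_support[of x S] by auto
  have "x \<in> subalgebra hull (T \<union> T')" "G \<subseteq> subalgebra hull (T \<union> T')"
    using subsetD[OF hull_mono T'(3)] order_trans[OF T(3) hull_mono] by simp_all
  then show ?case using T(1,2) T'(1,2) by (intro exI[of _ "T \<union> T'"]) simp
qed

text \<open>For a subalgebra \<open>D\<close> this is the left module \<open>DB\<close>. As
  \<open>D\<close> need not have a unit, \<open>B\<close> itself need not lie in it.\<close>

definition mspan :: "'a set \<Rightarrow> 'a set \<Rightarrow> 'a set" where
  "mspan D B = span {d * b | d b. d \<in> D \<and> b \<in> B}"

lemma subspace_mspan [simp]: "subspace (mspan D B)"
  by (simp add: mspan_def)

lemma mspan_base: "d \<in> D \<Longrightarrow> b \<in> B \<Longrightarrow> d * b \<in> mspan D B"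
  unfolding mspan_def by (rule span_base) blast

lemma mspan_minimal: "(\<And>d b. d \<in> D \<Longrightarrow> b \<in> B \<Longrightarrow> d * b \<in> S) \<Longrightarrow> subspace S \<Longrightarrow> mspan D B \<subseteq> S"
  unfolding mspan_def by (rule span_minimal) auto

lemma mspan_mono: "D \<subseteq> D' \<Longrightarrow> B \<subseteq> B' \<Longrightarrow> mspan D B \<subseteq> mspan D' B'"
  by (rule mspan_minimal) (auto intro: mspan_base)

lemma mspan_empty [simp]: "mspan D {} = {0}"
  by (simp add: mspan_def)

lemma mspan_mult_left:
  assumes "subalgebra D" "d \<in> D" "x \<in> mspan D B"
  shows "d * x \<in> mspan D B"
proof -
  have "mspan D B \<subseteq> {x. d * x \<in> mspan D B}"
    by (rule mspan_minimal)
      (use assms in \<open>auto intro!: subspace_mult_left_vimage mspan_base simp: subalgebra_def mult.assoc[symmetric]\<close>)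
  then show ?thesis using assms(3) by blast
qed

text \<open>\<open>D\<close> is a subspace, so all multiples of \<open>b\<close> collect into one
  coefficient. This serves both to split off a top power of x and to compare coefficients at one
  module generator.\<close>

lemma mspan_insert:
  assumes "subspace D" "x \<in> mspan D (insert b B)"
  shows "\<exists>d\<in>D. \<exists>y\<in>mspan D B. x = d * b + y"
proof -
  let ?U = "{x. \<exists>d\<in>D. \<exists>y\<in>mspan D B. x = d * b + y}"
  have "mspan D (insert b B) \<subseteq> ?U"
  proof (rule mspan_minimal)
    fix d c assume *: "d \<in> D" "c \<in> insert b B"
    show "d * c \<in> ?U"
    proof (cases "c = b")
      case True
      then show ?thesis using * subspace_0[OF subspace_mspan] by force
    next
      case False
      then have "d * c \<in> mspan D B" using * by (auto intro: mspan_base)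
      then show ?thesis using subspace_0[OF assms(1)] by force
    qed
  next
    show "subspace ?U"
    proof (rule subspaceI)
      show "0 \<in> ?U" using subspace_0[OF assms(1)] subspace_0[OF subspace_mspan] by force
    next
      fix x y assume "x \<in> ?U" "y \<in> ?U"
      then obtain d y1 d' y2 where "d \<in> D" "y1 \<in> mspan D B" "d' \<in> D" "y2 \<in> mspan D B"
        "x = d * b + y1" "y = d' * b + y2" by blast
      moreover from this have "x + y = (d + d') * b + (y1 + y2)" by (simp add: algebra_simps)
      ultimately show "x + y \<in> ?U" using assms(1) by (blast intro: subspace_add subspace_mspan)
    next
      fix c x assume "x \<in> ?U"
      then obtain d y1 where "d \<in> D" "y1 \<in> mspan D B" "x = d * b + y1" by blast
      moreover from this have "scale c x = scale c d * b + scale c y1"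
        by (simp add: scale_right_distrib scale_mult_left)
      ultimately show "scale c x \<in> ?U" using assms(1) by (blast intro: subspace_scale subspace_mspan)
    qed
  qed
  then show ?thesis using assms(2) by blast
qed

text \<open>Lie subalgebras of the ambient algebra, without the record of operations. Generation is
  studied in this form and transferred to the record only for the quotient.\<close>

definition lie_closed :: "'a set \<Rightarrow> bool" where
  "lie_closed S \<longleftrightarrow> subspace S \<and> (\<forall>x\<in>S. \<forall>y\<in>S. commutator x y \<in> S)"

lemma lie_closed_hull: "lie_closed (lie_closed hull S)"
proof (rule hull_in)
  fix T assume T: "\<forall>t\<in>T. lie_closed t"
  then have "subspace (\<Inter>T)" by (intro subspace_Inter) (simp add: lie_closed_def)
  then show "lie_closed (\<Inter>T)" using T by (auto simp: lie_closed_def)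
qed

lemma subspace_lie_hull [simp]: "subspace (lie_closed hull S)"
  using lie_closed_hull by (simp add: lie_closed_def)

lemma commutator_lie_hull:
  "x \<in> lie_closed hull S \<Longrightarrow> y \<in> lie_closed hull S \<Longrightarrow> commutator x y \<in> lie_closed hull S"
  using lie_closed_hull by (simp add: lie_closed_def)

lemma span_support_finite:
  assumes "x \<in> span S"
  shows "\<exists>T. finite T \<and> T \<subseteq> S \<and> x \<in> span T"
proof -
  obtain T r where T: "finite T" "T \<subseteq> S" "x = (\<Sum>a\<in>T. scale (r a) a)"
    using assms by (auto simp: span_explicit)
  then have "x \<in> span T" by (auto intro: span_sum span_scale span_base)
  then show ?thesis using T by blast
qed

lemma commutator_mult_right: "commutator d (x * y) = commutator d x * y + x * commutator d (y::'a)"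
  by (simp add: commutator_def algebra_simps)

lemma commutator_jacobi:
  "commutator d (commutator x y) = commutator (commutator d x) y + commutator x (commutator d (y::'a))"
  by (simp add: commutator_def algebra_simps)

lemma commutator_minus_swap: "commutator x (y::'a) = - commutator y x"
  by (simp add: commutator_def)

text \<open>\<open>commutator d\<close> is a derivation, so the elements of the hull that it keeps
  in the hull form a subalgebra.\<close>

lemma commutator_subalgebra_hull:
  assumes "\<And>x. x \<in> S \<Longrightarrow> commutator d x \<in> subalgebra hull S" and "x \<in> subalgebra hull S"
  shows "commutator d x \<in> subalgebra hull S"
proof -
  have H: "subalgebra (subalgebra hull S)" by (rule subalgebra_hull)
  let ?U = "{x. commutator d x \<in> subalgebra hull S} \<inter> subalgebra hull S"
  have "subalgebra ?U"
    using H subspace_commutator_vimage[of "subalgebra hull S" d]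
    by (auto simp: subalgebra_def commutator_mult_right intro!: subspace_inter subspace_add)
  then have "subalgebra hull S \<subseteq> ?U"
    by (rule hull_minimal[rotated]) (use assms(1) in \<open>auto intro: hull_inc\<close>)
  then show ?thesis using assms(2) by blast
qed

text \<open>The same argument with the Jacobi identity as Leibniz rule. The point is that
  \<open>d\<close> need not belong to the hull.\<close>

lemma commutator_lie_hull_derivation:
  assumes "\<And>x. x \<in> S \<Longrightarrow> commutator d x \<in> lie_closed hull S" and "x \<in> lie_closed hull S"
  shows "commutator d x \<in> lie_closed hull S"
proof -
  let ?U = "{x. commutator d x \<in> lie_closed hull S} \<inter> lie_closed hull S"
  have "subspace ?U" by (intro subspace_inter subspace_commutator_vimage subspace_lie_hull)
  moreover have "commutator x y \<in> ?U" if "x \<in> ?U" "y \<in> ?U" for x y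
    using that commutator_jacobi[of d x y]
    by (simp add: commutator_lie_hull subspace_add[OF subspace_lie_hull])
  ultimately have "lie_closed ?U" unfolding lie_closed_def by blast
  then have "lie_closed hull S \<subseteq> ?U"
    by (rule hull_minimal[rotated]) (use assms(1) in \<open>auto intro: hull_inc\<close>)
  then show ?thesis using assms(2) by blast
qed

text \<open>The preimage in \<open>D\<close> of a Lie subalgebra of the quotient is
  \<open>lie_closed\<close>, so it is all of \<open>D\<close> once it contains
  \<open>X\<close>.\<close>

lemma lie_finitely_generated_quotient:
  assumes L: "lie_algebra (commutator_lie_algebra D)" and I: "lie_ideal (commutator_lie_algebra D) I"
    and X: "finite X" "X \<subseteq> D" "D \<subseteq> lie_closed hull X"
  shows "lie_finitely_generated (lie_quotient (commutator_lie_algebra D) I)"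
proof -
  let ?L = "commutator_lie_algebra D"
  let ?Q = "lie_quotient ?L I"
  let ?q = "lie_coset ?L I"
  interpret L: lie_algebra ?L by (rule L)
  interpret Q: lie_algebra ?Q by (rule L.lie_algebra_quotient[OF I])
  have [simp]: "lie_carrier ?L = D" "lie_zero ?L = 0" "lie_add ?L = (+)" "lie_scale ?L = scale"
    "lie_bracket ?L = commutator"
    by (simp_all add: commutator_lie_algebra_def)
  have car: "lie_carrier ?Q = ?q ` D" and zero: "lie_zero ?Q = ?q 0"
    by (simp_all add: lie_quotient_def)
  have D: "0 \<in> D" "\<And>x y. x \<in> D \<Longrightarrow> y \<in> D \<Longrightarrow> x + y \<in> D" "\<And>c x. x \<in> D \<Longrightarrow> scale c x \<in> D"
    "\<And>x y. x \<in> D \<Longrightarrow> y \<in> D \<Longrightarrow> commutator x y \<in> D"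
    using L.zero_closed L.add_closed L.scale_closed L.bracket_closed by simp_all
  have q_add: "lie_add ?Q (?q x) (?q y) = ?q (x + y)" if "x \<in> D" "y \<in> D" for x y
    using L.quotient_add[OF I, of x y] that by simp
  have q_scale: "lie_scale ?Q c (?q x) = ?q (scale c x)" if "x \<in> D" for c x
    using L.quotient_scale[OF I, of x c] that by simp
  have q_bracket: "lie_bracket ?Q (?q x) (?q y) = ?q (commutator x y)" if "x \<in> D" "y \<in> D" for x y
    using L.quotient_bracket[OF I, of x y] that by simp
  have "lie_subalgebra ?Q hull (?q ` X) = lie_carrier ?Q"
  proof
    have "lie_subalgebra ?Q (lie_carrier ?Q)"
      by (auto simp: lie_subalgebra_def Q.zero_closed Q.add_closed Q.scale_closed Q.bracket_closed)
    then show "lie_subalgebra ?Q hull (?q ` X) \<subseteq> lie_carrier ?Q"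
      by (rule hull_minimal[rotated]) (use X car in auto)
    show "lie_carrier ?Q \<subseteq> lie_subalgebra ?Q hull (?q ` X)"
    proof
      fix A assume A: "A \<in> lie_carrier ?Q"
      have "A \<in> S" if S: "lie_subalgebra ?Q S" "?q ` X \<subseteq> S" for S
      proof -
        let ?P = "{x\<in>D. ?q x \<in> S}"
        have S': "?q 0 \<in> S" "\<And>x y. x \<in> S \<Longrightarrow> y \<in> S \<Longrightarrow> lie_add ?Q x y \<in> S"
          "\<And>c x. x \<in> S \<Longrightarrow> lie_scale ?Q c x \<in> S"
          "\<And>x y. x \<in> S \<Longrightarrow> y \<in> S \<Longrightarrow> lie_bracket ?Q x y \<in> S"
          using S(1) zero by (auto simp: lie_subalgebra_def)
        have P: "lie_closed ?P"
          unfolding lie_closed_def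
        proof (intro conjI subspaceI ballI)
          show "0 \<in> ?P" using S' D by simp
          fix x assume x: "x \<in> ?P"
          show "scale c x \<in> ?P" for c
            using x S'(3)[of "?q x" c] q_scale[of x c] D by simp
          fix y assume y: "y \<in> ?P"
          show "x + y \<in> ?P" using x y S'(2)[of "?q x" "?q y"] q_add[of x y] D by simp
          show "commutator x y \<in> ?P"
            using x y S'(4)[of "?q x" "?q y"] q_bracket[of x y] D by simp
        qed
        have "X \<subseteq> ?P" using S(2) X(2) by auto
        then have "lie_closed hull X \<subseteq> ?P" using P by (rule hull_minimal)
        then have "D \<subseteq> ?P" using X(3) by blast
        then show ?thesis using A unfolding car by auto
      qed
      then show "A \<in> lie_subalgebra ?Q hull (?q ` X)" unfolding hull_def by auto
    qed
  qed
  then show ?thesis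
    unfolding lie_finitely_generated_def
    by (intro exI[of _ "?q ` X"]) (use X car in auto)
qed

end

section \<open>Finite modules over finitely generated commutative algebras\<close>

text \<open>A field \<open>Z\<close> with unit \<open>e\<close> and a nonzero vector space
  \<open>V\<close> over it, both inside one algebra without unit. In the application
  \<open>V\<close> is \<open>A = eRe\<close> and \<open>Z\<close> is the center of
  \<open>A\<close>.\<close>

locale field_module = assoc_algebra scale
  for scale :: "'f::field \<Rightarrow> 'a::ring \<Rightarrow> 'a" +
  fixes Z V :: "'a set" and e :: 'a
  assumes Z_sub: "subalgebra Z" and e_Z: "e \<in> Z" and e_nz: "e \<noteq> 0"
    and Z_comm: "\<lbrakk>z \<in> Z; w \<in> Z\<rbrakk> \<Longrightarrow> z * w = w * z"
    and Z_unit: "z \<in> Z \<Longrightarrow> e * z = z"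
    and Z_inv: "\<lbrakk>z \<in> Z; z \<noteq> 0\<rbrakk> \<Longrightarrow> \<exists>w\<in>Z. z * w = e"
    and V_sub: "subspace V" and V_closed: "\<lbrakk>z \<in> Z; v \<in> V\<rbrakk> \<Longrightarrow> z * v \<in> V"
    and V_unit: "v \<in> V \<Longrightarrow> e * v = v" and V_nz: "\<exists>v\<in>V. v \<noteq> 0"
begin

lemma Z_closed: "z \<in> Z \<Longrightarrow> w \<in> Z \<Longrightarrow> z * w \<in> Z" "z \<in> Z \<Longrightarrow> w \<in> Z \<Longrightarrow> z + w \<in> Z"
    "z \<in> Z \<Longrightarrow> w \<in> Z \<Longrightarrow> z - w \<in> Z" "0 \<in> Z"
  using Z_sub by (auto simp: subalgebra_def intro: subspace_add subspace_diff subspace_0)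

lemma V_cancel: 
  assumes "z \<in> Z" "z \<noteq> 0" "v \<in> V" "z * v = 0"
  shows "v = 0"
proof -
  obtain w where "w \<in> Z" "z * w = e" using Z_inv assms by blast
  then have "v = w * (z * v)" using V_unit assms Z_comm by (metis mult.assoc)
  then show ?thesis using assms by simp
qed

lemma Z_cancel: 
  assumes "z \<in> Z" "z \<noteq> 0" "v \<in> Z" "z * v = 0"
  shows "v = 0"
proof -
  obtain w where "w \<in> Z" "z * w = e" using Z_inv assms by blast
  then have "v = w * (z * v)" using Z_unit assms Z_comm by (metis mult.assoc)
  then show ?thesis using assms by simp
qed

lemma Z_left_comm: "a \<in> Z \<Longrightarrow> b \<in> Z \<Longrightarrow> a * (b * c) = b * (a * c)"
  using Z_comm by (metis mult.assoc)

text \<open>The zeroth power is \<open>e\<close>, because the type class provides no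
  \<open>1\<close>.\<close>

definition pw :: "'a \<Rightarrow> nat \<Rightarrow> 'a" where
  "pw x n = ((*) x ^^ n) e"

lemma pw_0 [simp]: "pw x 0 = e" and pw_Suc: "pw x (Suc n) = x * pw x n"
  by (simp_all add: pw_def)

definition subring :: "'a set \<Rightarrow> bool" where
  "subring D \<longleftrightarrow> D \<subseteq> Z \<and> e \<in> D \<and> subalgebra D"

lemma subringD:
  assumes "subring D"
  shows "subspace D" "subalgebra D" "D \<subseteq> Z" "e \<in> D" "\<And>a. a \<in> D \<Longrightarrow> a \<in> Z"
    "\<And>a b. a \<in> D \<Longrightarrow> b \<in> D \<Longrightarrow> a * b \<in> D" "\<And>a b. a \<in> D \<Longrightarrow> b \<in> D \<Longrightarrow> a - b \<in> D"
    "\<And>a b. a \<in> D \<Longrightarrow> b \<in> D \<Longrightarrow> a + b \<in> D" "\<And>a. a \<in> D \<Longrightarrow> - a \<in> D" "0 \<in> D"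
  using assms by (auto simp: subring_def subalgebra_def subspace_0
      intro: subspace_add subspace_diff subspace_neg)

lemma subring_Z: "subring Z"
  by (simp add: subring_def Z_sub e_Z)

lemma pw_closed: "subring D \<Longrightarrow> x \<in> D \<Longrightarrow> pw x n \<in> D"
  by (induction n) (auto simp: subringD pw_Suc)

lemma pw_Z: "x \<in> Z \<Longrightarrow> pw x n \<in> Z"
  by (rule pw_closed[OF subring_Z])

lemma pw_add: "x \<in> Z \<Longrightarrow> pw x (m + n) = pw x m * pw x n"
  by (induction m) (auto simp: pw_Suc pw_Z Z_unit mult.assoc)

lemma pw_mult: "x \<in> Z \<Longrightarrow> y \<in> Z \<Longrightarrow> pw (x * y) n = pw x n * pw y n"
  by (induction n) (auto simp: pw_Suc pw_Z Z_unit e_Z mult.assoc Z_left_comm)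

lemma pw_nz: "x \<in> Z \<Longrightarrow> x \<noteq> 0 \<Longrightarrow> pw x n \<noteq> 0"
  by (induction n) (auto simp: e_nz pw_Suc dest: Z_cancel[of x, rotated 3] simp: pw_Z)

section \<open>The extension D[x] and its filtration by degree\<close>

definition adjoin :: "'a set \<Rightarrow> 'a \<Rightarrow> 'a set" where
  "adjoin D x = mspan D (range (pw x))"

text \<open>The values at \<open>x\<close> of polynomials over \<open>D\<close> of degree less than
  \<open>n\<close>. This filtration of D[x] replaces polynomials and their degrees.\<close>

definition below :: "'a set \<Rightarrow> 'a \<Rightarrow> nat \<Rightarrow> 'a set" where
  "below D x n = mspan D (pw x ` {..<n})"

lemma subspace_below [simp]: "subspace (below D x n)"
  by (simp add: below_def)

lemma below_0 [simp]: "below D x 0 = {0}"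
  by (simp add: below_def)

lemma below_base: "c \<in> D \<Longrightarrow> i < n \<Longrightarrow> c * pw x i \<in> below D x n"
  by (simp add: below_def mspan_base)

lemma below_mono: "m \<le> n \<Longrightarrow> below D x m \<subseteq> below D x n"
  unfolding below_def by (rule mspan_mono) auto

lemma below_Suc:
  assumes "subring D" "y \<in> below D x (Suc n)"
  shows "\<exists>c\<in>D. y - c * pw x n \<in> below D x n"
proof -
  have "y \<in> mspan D (insert (pw x n) (pw x ` {..<n}))"
    using assms(2) by (simp add: below_def lessThan_Suc)
  then obtain c t where "c \<in> D" "t \<in> mspan D (pw x ` {..<n})" "y = c * pw x n + t"
    using mspan_insert[OF subringD(1)[OF assms(1)]] by blast
  moreover from this have "y - c * pw x n \<in> below D x n" by (simp add: below_def)
  ultimately show ?thesis by blast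
qed

lemma below_mult_left: "subring D \<Longrightarrow> d \<in> D \<Longrightarrow> y \<in> below D x n \<Longrightarrow> d * y \<in> below D x n"
  unfolding below_def by (rule mspan_mult_left) (auto simp: subringD)

lemma below_pw:
  assumes "subring D" "x \<in> Z" "y \<in> below D x n"
  shows "pw x m * y \<in> below D x (m + n)"
proof -
  have "below D x n \<subseteq> {y. pw x m * y \<in> below D x (m + n)}"
    unfolding below_def
  proof (rule mspan_minimal)
    fix d b assume *: "d \<in> D" "b \<in> pw x ` {..<n}"
    then obtain i where i: "i < n" "b = pw x i" by auto
    have "pw x m * (d * b) = d * pw x (m + i)"
      using * i assms by (simp add: pw_add Z_left_comm pw_Z subringD)
    then show "d * b \<in> {y. pw x m * y \<in> mspan D (pw x ` {..<m + n})}"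
      using * i by (auto intro: mspan_base)
  qed (auto intro: subspace_mult_left_vimage)
  then show ?thesis using assms by blast
qed

lemma adjoin_subset_Z:
  assumes "subring D" "x \<in> Z"
  shows "adjoin D x \<subseteq> Z"
  unfolding adjoin_def
  by (rule mspan_minimal) (use assms in \<open>auto simp: subringD pw_Z Z_closed subringD(1)[OF subring_Z]\<close>)

lemma below_subset_adjoin: "below D x n \<subseteq> adjoin D x"
  unfolding adjoin_def below_def by (rule mspan_mono) auto

lemma adjoin_below:
  assumes "y \<in> adjoin D x"
  shows "\<exists>n. y \<in> below D x n"
proof -
  let ?U = "{y. \<exists>n. y \<in> below D x n}"
  have "adjoin D x \<subseteq> ?U"
    unfolding adjoin_def
  proof (rule mspan_minimal)
    fix d b assume "d \<in> D" "b \<in> range (pw x)"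
    then show "d * b \<in> ?U" using below_base[OF _ lessI] by blast
  next
    show "subspace ?U"
    proof (rule subspaceI)
      show "0 \<in> ?U" using subspace_0[OF subspace_below] by blast
    next
      fix y z assume "y \<in> ?U" "z \<in> ?U"
      then obtain m n where "y \<in> below D x m" "z \<in> below D x n" by blast
      then have "y \<in> below D x (max m n)" "z \<in> below D x (max m n)"
        using below_mono[of m "max m n" D x] below_mono[of n "max m n" D x] by auto
      then show "y + z \<in> ?U" using subspace_add[OF subspace_below] by blast
    next
      fix c y assume "y \<in> ?U"
      then show "scale c y \<in> ?U" using subspace_scale[OF subspace_below] by blast
    qed
  qed
  then show ?thesis using assms by blast
qed

lemma below_adjoin_mult:
  assumes "subring D" "x \<in> Z" "y \<in> below D x m" "z \<in> below D x n"
  shows "y * z \<in> below D x (m + n)"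
proof -
  have "below D x m \<subseteq> {y. y * z \<in> below D x (m + n)}"
    unfolding below_def[of D x m]
  proof (rule mspan_minimal)
    fix d b assume *: "d \<in> D" "b \<in> pw x ` {..<m}"
    then obtain i where i: "i < m" "b = pw x i" by auto
    have "pw x i * z \<in> below D x (m + n)"
      using below_pw[OF assms(1,2,4), of i] below_mono[of "i + n" "m + n"] i by auto
    then show "d * b \<in> {y. y * z \<in> below D x (m + n)}"
      using * i assms by (simp add: mult.assoc below_mult_left)
  qed (auto intro: subspace_mult_right_vimage)
  then show ?thesis using assms by blast
qed

lemma subset_adjoin:
  assumes "subring D" "x \<in> Z"
  shows "D \<subseteq> adjoin D x" "x \<in> adjoin D x"
proof -
  have *: "d * pw x i \<in> adjoin D x" if "d \<in> D" for d i
    unfolding adjoin_def using that by (rule mspan_base) simp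
  show "D \<subseteq> adjoin D x"
  proof
    fix d assume "d \<in> D"
    then show "d \<in> adjoin D x" using *[of d 0] Z_comm[of d e] Z_unit assms e_Z by (simp add: subringD)
  qed
  show "x \<in> adjoin D x"
    using *[of e 1] assms Z_comm[of x e] by (simp add: subringD pw_Suc Z_unit e_Z)
qed

lemma subring_adjoin:
  assumes "subring D" "x \<in> Z"
  shows "subring (adjoin D x)"
proof -
  have "y * z \<in> adjoin D x" if "y \<in> adjoin D x" "z \<in> adjoin D x" for y z
    using adjoin_below[OF that(1)] adjoin_below[OF that(2)] below_adjoin_mult[OF assms]
      below_subset_adjoin by blast
  moreover have "subspace (adjoin D x)" by (simp add: adjoin_def)
  moreover have "e \<in> adjoin D x" using subset_adjoin(1)[OF assms] subringD(4)[OF assms(1)] by blast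
  ultimately show ?thesis
    using adjoin_subset_Z[OF assms] by (simp add: subring_def subalgebra_def)
qed

text \<open>\<open>lead D x n c y\<close> says that \<open>y\<close> is the value at \<open>x\<close> of some polynomial over \<open>D\<close> of formal degree \<open>n\<close>
  with top coefficient \<open>c\<close>; neither is determined by \<open>y\<close> when \<open>x\<close> is algebraic over \<open>D\<close>.\<close>

definition lead :: "'a set \<Rightarrow> 'a \<Rightarrow> nat \<Rightarrow> 'a \<Rightarrow> 'a \<Rightarrow> bool" where
  "lead D x n c y \<longleftrightarrow> c \<in> D \<and> y - c * pw x n \<in> below D x n"

text \<open>\<open>x\<close> is a root of a polynomial over \<open>D\<close> of degree
  \<open>n\<close> with leading coefficient \<open>c\<close>. As \<open>D\<close> need not be a
  field, \<open>c\<close> cannot be normalized to \<open>e\<close>; it becomes a denominator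
  later.\<close>

definition algebraic_over :: "'a set \<Rightarrow> 'a \<Rightarrow> nat \<Rightarrow> bool" where
  "algebraic_over D x n \<longleftrightarrow> (\<exists>c\<in>D. c \<noteq> 0 \<and> c * pw x n \<in> below D x n)"

section \<open>Leading coefficients and algebraic relations\<close>

lemma lead_below: "lead D x n c y \<Longrightarrow> y \<in> below D x (Suc n)"
proof -
  assume *: "lead D x n c y"
  then have "c * pw x n \<in> below D x (Suc n)" "y - c * pw x n \<in> below D x (Suc n)"
    using below_mono[of n "Suc n" D x] by (auto simp: lead_def intro: below_base)
  from subspace_add[OF subspace_below this] show ?thesis by simp
qed

lemma lead_mult:
  assumes D: "subring D" "x \<in> Z" and "lead D x m a y" "lead D x n b z"
  shows "lead D x (m + n) (a * b) (y * z)"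
proof -
  define s where "s = y - a * pw x m"
  define t where "t = z - b * pw x n"
  have st: "s \<in> below D x m" "t \<in> below D x n" "a \<in> D" "b \<in> D"
    using assms by (auto simp: lead_def s_def t_def)
  have Z: "a \<in> Z" "b \<in> Z" "s \<in> Z" "t \<in> Z" "pw x m \<in> Z" "pw x n \<in> Z"
    using st D subsetD[OF adjoin_subset_Z[OF D] subsetD[OF below_subset_adjoin]]
    by (auto simp: subringD pw_Z)
  have "y * z - a * b * pw x (m + n) = a * (pw x m * t) + b * (pw x n * s) + s * t"
  proof -
    have y: "y = a * pw x m + s" and z: "z = b * pw x n + t" by (simp_all add: s_def t_def)
    have 1: "pw x m * (b * pw x n) = b * pw x (m + n)"
      unfolding pw_add[OF D(2)] by (rule Z_left_comm[OF Z(5,2)])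
    have 2: "s * (b * pw x n) = b * (pw x n * s)"
      using Z Z_comm[of s "pw x n"] by (simp add: Z_left_comm)
    show ?thesis unfolding y z by (simp add: distrib_left distrib_right 1 2 mult.assoc)
  qed
  moreover have "a * (pw x m * t) \<in> below D x (m + n)" "b * (pw x n * s) \<in> below D x (m + n)"
    using below_pw[OF D st(2), of m] below_pw[OF D st(1), of n] st D
    by (simp_all add: below_mult_left add.commute)
  moreover have "s * t \<in> below D x (m + n)" using below_adjoin_mult[OF D] st by blast
  ultimately show ?thesis using st D by (simp add: lead_def subspace_add subringD)
qed

lemma lead_add: "lead D x n c y \<Longrightarrow> t \<in> below D x n \<Longrightarrow> lead D x n c (y + t)"
  using subspace_add[OF subspace_below, of "y - c * pw x n" D x n t] by (simp add: lead_def algebra_simps)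

lemma lead_scale: "subring D \<Longrightarrow> d \<in> D \<Longrightarrow> lead D x n c y \<Longrightarrow> lead D x n (d * c) (d * y)"
  using below_mult_left[of D d "y - c * pw x n" x n] by (simp add: lead_def subringD algebra_simps)

lemma lead_pw: "subring D \<Longrightarrow> x \<in> Z \<Longrightarrow> lead D x n e (pw x n)"
  using subspace_0[OF subspace_below] by (simp add: lead_def Z_unit pw_Z subringD)

lemma lead_x: "subring D \<Longrightarrow> x \<in> Z \<Longrightarrow> lead D x 1 e x"
  using lead_pw[of D x 1] Z_comm[of x e] Z_unit e_Z by (simp add: pw_Suc)

lemma lead_zero: "lead D x n c 0 \<Longrightarrow> c \<noteq> 0 \<Longrightarrow> algebraic_over D x n"
  using subspace_neg[OF subspace_below] by (fastforce simp: lead_def algebraic_over_def)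

lemma lead_below_algebraic:
  assumes "lead D x n c y" "c \<noteq> 0" "y \<in> below D x n"
  shows "algebraic_over D x n"
  using assms subspace_diff[OF subspace_below assms(3), of "y - c * pw x n"]
  by (auto simp: lead_def algebraic_over_def)

lemma lead_exists:
  assumes "subring D" "y \<in> below D x n" "y \<noteq> 0"
  shows "\<exists>s<n. \<exists>c. lead D x s c y \<and> c \<noteq> 0 \<and> y \<notin> below D x s"
proof -
  define m where "m = (LEAST m. y \<in> below D x m)"
  have m: "y \<in> below D x m" "m \<le> n" unfolding m_def using assms(2) by (auto intro: LeastI Least_le)
  have "m \<noteq> 0" using m(1) assms(3) by (cases m) auto
  then obtain s where s: "m = Suc s" using not0_implies_Suc by blast
  have ns: "y \<notin> below D x s" using s not_less_Least[of s] unfolding m_def by (metis lessI)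
  obtain c where c: "c \<in> D" "y - c * pw x s \<in> below D x s" using below_Suc[OF assms(1)] m(1) s by blast
  have "c \<noteq> 0" using c(2) ns by auto
  moreover have "s < n" using s m by simp
  ultimately show ?thesis using c ns unfolding lead_def by blast
qed

text \<open>If every nonzero element of \<open>D[x]\<close> divided a power of \<open>d\<close> with \<open>x\<close> transcendental, then \<open>1 + x d\<close> would
  divide a power of \<open>x d\<close> and hence \<open>1\<close>.\<close>

lemma algebraic_if_powers_absorb:
  assumes D: "subring D" "x \<in> Z" and d: "d \<in> adjoin D x" "d \<noteq> 0"
    and absorb: "\<And>c. c \<in> adjoin D x \<Longrightarrow> c \<noteq> 0 \<Longrightarrow> \<exists>q\<in>adjoin D x. \<exists>N. c * q = pw d N"
  shows "\<exists>n. algebraic_over D x n"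
proof -
  let ?A = "adjoin D x"
  note A = subring_adjoin[OF D]
  have xA: "x \<in> ?A" using subset_adjoin[OF D] by blast
  obtain s a where a: "lead D x s a d" "a \<noteq> 0"
    using adjoin_below[OF d(1)] lead_exists[OF D(1) _ d(2)] by blast
  define u where "u = x * d"
  define c where "c = e + u"
  have uA: "u \<in> ?A" and cA: "c \<in> ?A" using A xA d by (auto simp: u_def c_def subringD)
  have Z: "u \<in> Z" "c \<in> Z" "d \<in> Z" using uA cA d A by (auto simp: subringD)
  have e1: "e \<in> below D x (Suc n)" for n
    using below_base[of e D 0 "Suc n"] D e_Z Z_unit by (simp add: subringD)
  have lc: "lead D x (Suc s) a c"
  proof -
    have "lead D x (1 + s) (e * a) (x * d)" by (rule lead_mult[OF D lead_x[OF D] a(1)])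
    then have "lead D x (Suc s) a u" using a D Z_unit by (simp add: u_def lead_def subringD)
    from lead_add[OF this e1] show ?thesis by (simp add: c_def add.commute)
  qed
  show ?thesis
  proof (cases "c = 0")
    case True
    then show ?thesis using lead_zero lc a by blast
  next
    case False
    then obtain q N where q: "q \<in> ?A" "c * q = pw d N" using absorb cA by blast
    \<comment> \<open>Modulo \<open>c = e + u\<close> the element \<open>u\<close> is
      \<open>- e\<close>, so its powers are \<open>e\<close> or \<open>- e\<close>.\<close>
    have pw_u: "\<exists>r\<in>?A. pw u n = c * r + e \<or> pw u n = c * r - e" for n
    proof (induction n)
      case 0
      then show ?case using A by (intro bexI[of _ 0]) (auto simp: subringD)
    next
      case (Suc n)
      then obtain r where r: "r \<in> ?A" "pw u n = c * r + e \<or> pw u n = c * r - e" by blast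
      have uc: "u * (c * r) = c * (u * r)" using Z by (simp add: Z_left_comm)
      have ue: "u * e = u" "c * e = c" "u = c - e" using Z Z_comm[of _ e] Z_unit e_Z by (simp_all add: c_def)
      from r(2) show ?case
      proof
        assume "pw u n = c * r + e"
        then have "pw u (Suc n) = c * (u * r + e) - e"
          using uc ue by (simp add: pw_Suc distrib_left)
        then show ?thesis using A r uA by (intro bexI[of _ "u * r + e"]) (auto simp: subringD)
      next
        assume "pw u n = c * r - e"
        then have "pw u (Suc n) = c * (u * r - e) + e"
          using uc ue by (simp add: pw_Suc right_diff_distrib)
        then show ?thesis using A r uA by (intro bexI[of _ "u * r - e"]) (auto simp: subringD)
      qed
    qed
    \<comment> \<open>Since \<open>u = x * d\<close> and \<open>c\<close> divides the power of
      \<open>d\<close>, it also divides this power of \<open>u\<close>. With the congruence just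
      shown, \<open>c\<close> divides \<open>e\<close>.\<close>
    have "pw u N = c * (pw x N * q)"
      unfolding u_def using Z D by (simp add: pw_mult q(2)[symmetric] Z_left_comm pw_Z)
    moreover have "pw x N * q \<in> ?A" using A xA q by (simp add: subringD pw_closed)
    ultimately obtain q' where q': "q' \<in> ?A" "pw u N = c * q'" by blast
    obtain r where r: "r \<in> ?A" "pw u N = c * r + e \<or> pw u N = c * r - e" using pw_u by blast
    have "c * (q' - r) = e \<or> c * (r - q') = e"
      using q' r by (auto simp: right_diff_distrib)
    then obtain r' where r': "r' \<in> ?A" "c * r' = e" 
      using subringD(7)[OF A q'(1) r(1)] subringD(7)[OF A r(1) q'(1)] by blast
    have "r' \<noteq> 0" using r' e_nz by auto
    then obtain t b where b: "lead D x t b r'" "b \<noteq> 0"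
      using adjoin_below[OF r'(1)] lead_exists[OF D(1)] by blast
    \<comment> \<open>The product \<open>c * r' = e\<close> has formal degree at least 1 and nonzero
      top coefficient, while \<open>e\<close> is a constant. This is an algebraic relation for
      \<open>x\<close>.\<close>
    have "lead D x (Suc s + t) (a * b) e" using lead_mult[OF D lc b(1)] r' by simp
    moreover have "a * b \<noteq> 0" using a b Z_cancel[of a b] D by (auto simp: lead_def subringD)
    ultimately show ?thesis using lead_below_algebraic e1[of "s + t"] by (metis add_Suc)
  qed
qed

text \<open>After multiplication by \<open>c\<close> the relation rewrites a top term of degree at
  least \<open>m\<close> into lower ones. Each lowering of the degree costs one factor
  \<open>c\<close>.\<close>

lemma below_clear_denominators:
  assumes D: "subring D" "x \<in> Z" and c: "c \<in> D" "c * pw x m \<in> below D x m" and y: "y \<in> below D x n"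
  shows "\<exists>N. pw c N * y \<in> below D x m"
  using y
proof (induction n arbitrary: y)
  case 0
  then show ?case using subspace_0[OF subspace_below] by simp
next
  case (Suc n)
  note Z = D(2) subringD(5)[OF D(1) c(1)]
  show ?case
  proof (cases "n < m")
    case True
    then have "y \<in> below D x m" using below_mono[of "Suc n" m] Suc.prems by auto
    then have "pw c 0 * y \<in> below D x m" using D by (simp add: below_mult_left subringD)
    then show ?thesis by blast
  next
    case False
    obtain a where a: "a \<in> D" "y - a * pw x n \<in> below D x n" using below_Suc[OF D(1) Suc.prems] by blast
    have az: "a \<in> Z" using a D by (simp add: subringD)
    have "pw x (n - m) * (c * pw x m) \<in> below D x (n - m + m)" by (rule below_pw[OF D c(2)])
    moreover have "pw x (n - m) * (c * pw x m) = c * pw x n"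
      using False pw_add[of x "n - m" m] Z by (simp add: Z_left_comm pw_Z)
    ultimately have "a * (c * pw x n) \<in> below D x n" using False D a by (simp add: below_mult_left)
    moreover have "c * (y - a * pw x n) \<in> below D x n" using a D c by (simp add: below_mult_left)
    ultimately have "a * (c * pw x n) + c * (y - a * pw x n) \<in> below D x n"
      by (rule subspace_add[OF subspace_below])
    moreover have "a * (c * pw x n) + c * (y - a * pw x n) = c * y"
      using az Z by (simp add: algebra_simps Z_left_comm)
    ultimately obtain N where "pw c N * (c * y) \<in> below D x m" using Suc.IH by auto
    moreover have "pw c N * (c * y) = pw c (Suc N) * y"
      using Z Z_comm[of "pw c N" c] by (simp add: pw_Suc pw_Z mult.assoc[symmetric])
    ultimately show ?thesis by auto
  qed
qed

text \<open>Choose a nonzero multiple \<open>u * w\<close> of least degree \<open>s\<close>. If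
  \<open>s\<close> were positive, pseudo-division of the minimal relation of degree \<open>m\<close>
  by \<open>u * w\<close> would leave a remainder of degree below \<open>s\<close>, hence zero, and
  the quotient would give a relation of degree \<open>m - s\<close>.\<close>

lemma adjoin_mult_meets_base:
  assumes D: "subring D" "x \<in> Z" and alg: "algebraic_over D x m" and least: "\<And>n. n < m \<Longrightarrow> \<not> algebraic_over D x n"
    and u: "u \<in> adjoin D x" "u \<noteq> 0"
  shows "\<exists>w\<in>adjoin D x. u * w \<in> D \<and> u * w \<noteq> 0"
proof -
  let ?A = "adjoin D x"
  note A = subring_adjoin[OF D]
  have AZ: "a \<in> Z" if "a \<in> ?A" for a using that A by (simp add: subringD)
  obtain c where c: "c \<in> D" "c \<noteq> 0" "c * pw x m \<in> below D x m" using alg by (auto simp: algebraic_over_def)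
  have DA: "a \<in> ?A" if "a \<in> D" for a using that subset_adjoin[OF D] by blast
  have pwA: "pw x n \<in> ?A" for n using subset_adjoin[OF D] A by (simp add: pw_closed)
  define P where "P s \<longleftrightarrow> (\<exists>w\<in>?A. u * w \<noteq> 0 \<and> u * w \<in> below D x (Suc s))" for s
  obtain N where N: "pw c N * u \<in> below D x m"
    using below_clear_denominators[OF D c(1,3)] adjoin_below[OF u(1)] by blast
  have ucN: "u * pw c N = pw c N * u" "u * pw c N \<noteq> 0"
  proof -
    have Zs: "u \<in> Z" "c \<in> Z" "pw c N \<in> Z" using AZ[OF u(1)] c D by (simp_all add: subringD pw_Z)
    show "u * pw c N = pw c N * u" by (rule Z_comm[OF Zs(1,3)])
    show "u * pw c N \<noteq> 0" using Z_cancel[OF Zs(1) u(2) Zs(3)] pw_nz[OF Zs(2) c(2)] by blast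
  qed
  have cNA: "pw c N \<in> ?A" using pw_closed[OF A DA[OF c(1)]] .
  have m0: "0 < m"
  proof (rule ccontr)
    assume "\<not> 0 < m"
    then have "c * e = 0" using c by simp
    then show False using c Z_comm[of c e] Z_unit e_Z D by (auto simp: subringD)
  qed
  then have "P (m - 1)" unfolding P_def using N ucN cNA m0 by (intro bexI[of _ "pw c N"]) simp_all
  define s where "s = (LEAST s. P s)"
  have Ps: "P s" unfolding s_def by (rule LeastI[of P, OF \<open>P (m - 1)\<close>])
  have "s \<le> m - 1" unfolding s_def by (rule Least_le[of P, OF \<open>P (m - 1)\<close>])
  then have sm: "s < m" using m0 by linarith
  have minimal: "u * w = 0" if "w \<in> ?A" "u * w \<in> below D x s" for w
  proof (cases s)
    case 0
    then show ?thesis using that by simp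
  next
    case (Suc s')
    then have "\<not> P s'" using not_less_Least[of s' P] unfolding s_def[symmetric] by simp
    then show ?thesis using that Suc by (auto simp: P_def)
  qed
  obtain w where w: "w \<in> ?A" "u * w \<noteq> 0" "u * w \<in> below D x (Suc s)" using Ps by (auto simp: P_def)
  obtain b where b: "b \<in> D" "u * w - b * pw x s \<in> below D x s" using below_Suc[OF D(1) w(3)] by blast
  have bl: "lead D x s b (u * w)" using b by (simp add: lead_def)
  have b0: "b \<noteq> 0" using b minimal[OF w(1)] w by auto
  show ?thesis
  proof (cases "s = 0")
    case True
    then have "u * w = b" using b D Z_comm[of b e] Z_unit e_Z by (simp add: subringD)
    then show ?thesis using b w by auto
  next
    case False
    \<comment> \<open>Pseudo-division: \<open>g\<close> is a quotient of degree \<open>m - s\<close>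
      with nonzero top coefficient, and the remainder \<open>g * (u * w)\<close> has degree below
      \<open>j\<close>. The induction brings \<open>j\<close> from \<open>m\<close> down to
      \<open>s\<close>.\<close>
    define Q where "Q j \<longleftrightarrow> (\<exists>g a. lead D x (m - s) a g \<and> a \<noteq> 0 \<and> g * (u * w) \<in> below D x j)" for j
    have gA: "g \<in> ?A" if "lead D x k a g" for k a g
      using lead_below[OF that] below_subset_adjoin by blast
    have "Q (m - i)" if "i \<le> m - s" for i
      using that
    proof (induction i)
      case 0
      \<comment> \<open>The top term of \<open>?g * (u * w)\<close> is \<open>b\<close> times
        \<open>c * pw x m\<close>, which the relation already lowers.\<close>
      let ?g = "c * pw x (m - s)"
      have "lead D x (m - s) c ?g" using c subspace_0[OF subspace_below] by (simp add: lead_def)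
      moreover have "?g * (u * w) \<in> below D x m"
      proof -
        have "lead D x (m - s + s) (e * b) (pw x (m - s) * (u * w))"
          by (rule lead_mult[OF D lead_pw[OF D] bl])
        then have "lead D x m b (pw x (m - s) * (u * w))" using sm b D Z_unit by (simp add: lead_def subringD)
        then have "c * (pw x (m - s) * (u * w) - b * pw x m) \<in> below D x m"
          using c D by (simp add: lead_def below_mult_left)
        moreover have "b * (c * pw x m) \<in> below D x m" using c b D by (simp add: below_mult_left)
        moreover have "b * (c * pw x m) = c * (b * pw x m)" using b c D by (simp add: Z_left_comm subringD)
        ultimately have "c * (pw x (m - s) * (u * w) - b * pw x m) + c * (b * pw x m) \<in> below D x m"
          using subspace_add[OF subspace_below] by metis
        then show ?thesis by (simp add: algebra_simps)
      qed
      ultimately show ?case using c unfolding Q_def by auto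
    next
      case (Suc i)
      then obtain g a where g: "lead D x (m - s) a g" "a \<noteq> 0" "g * (u * w) \<in> below D x (m - i)"
        unfolding Q_def by auto
      define j where "j = m - Suc i"
      have j: "m - i = Suc j" "s \<le> j" "j < m" using Suc.prems sm by (auto simp: j_def)
      obtain a' where a': "a' \<in> D" "g * (u * w) - a' * pw x j \<in> below D x j"
        using below_Suc[OF D(1) g(3)[unfolded j(1)]] by blast
      \<comment> \<open>Multiplication by the leading coefficient \<open>b\<close> of
        \<open>u * w\<close> avoids dividing by it. The added term cancels degree \<open>j\<close>
        and has degree \<open>j - s < m - s\<close>, so the top coefficient becomes
        \<open>b * a\<close>.\<close>
      let ?g = "b * g + (- a') * pw x (j - s)"
      have "lead D x (m - s) (b * a) (b * g)" by (rule lead_scale[OF D(1) b(1) g(1)])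
      moreover have "(- a') * pw x (j - s) \<in> below D x (m - s)"
        using j a' D by (intro below_base) (auto simp: subringD)
      ultimately have lg: "lead D x (m - s) (b * a) ?g" by (rule lead_add)
      have ba: "b * a \<noteq> 0" using b0 g Z_cancel[of b a] b D by (auto simp: lead_def subringD)
      have "lead D x (j - s + s) (e * b) (pw x (j - s) * (u * w))"
        by (rule lead_mult[OF D lead_pw[OF D] bl])
      then have "pw x (j - s) * (u * w) - b * pw x j \<in> below D x j"
        using j b D Z_unit by (simp add: lead_def subringD)
      then have 1: "a' * (pw x (j - s) * (u * w) - b * pw x j) \<in> below D x j"
        using a' D by (simp add: below_mult_left)
      have 2: "b * (g * (u * w) - a' * pw x j) \<in> below D x j"
        using a' b D by (simp add: below_mult_left)
      have "?g * (u * w) = b * (g * (u * w) - a' * pw x j) - a' * (pw x (j - s) * (u * w) - b * pw x j)"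
        using Z_left_comm[of a' b "pw x j"] a' b D
        by (simp add: algebra_simps subringD)
      then have "?g * (u * w) \<in> below D x j" using subspace_diff[OF subspace_below 2 1] by simp
      then show ?case using lg ba unfolding Q_def j_def by blast
    qed
    from this[of "m - s"] have "Q s" using sm by simp
    then obtain g a where g: "lead D x (m - s) a g" "a \<noteq> 0" "g * (u * w) \<in> below D x s"
      unfolding Q_def by auto
    have Zs: "g \<in> Z" "u \<in> Z" "w \<in> Z" "w * g \<in> ?A" using gA[OF g(1)] u w A by (auto simp: subringD)
    have "g * (u * w) = u * (w * g)" using Z_left_comm[OF Zs(1,2), of w] Z_comm[OF Zs(1,3)] by simp
    \<comment> \<open>The minimality of \<open>s\<close> kills the remainder. In a domain this gives
      \<open>g = 0\<close>, although its formal top coefficient is nonzero, so \<open>x\<close>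
      satisfies a relation of degree \<open>m - s\<close>.\<close>
    then have "g * (u * w) = 0" using minimal[OF Zs(4)] g(3) by simp
    then have "(u * w) * g = 0" using Z_comm[of g "u * w"] Zs Z_closed by auto
    then have "g = 0" using Z_cancel[of "u * w" g] Zs w Z_closed by auto
    then have "algebraic_over D x (m - s)" using g lead_zero by blast
    then show ?thesis using least[of "m - s"] False sm by simp
  qed
qed

text \<open>\<open>V\<close> is a finitely generated module over the localization of \<open>D\<close> at a single element.\<close>

definition almost_finite :: "'a set \<Rightarrow> bool" where
  "almost_finite D \<longleftrightarrow>
    (\<exists>d\<in>D. d \<noteq> 0 \<and> (\<exists>B. finite B \<and> B \<subseteq> V \<and> (\<forall>v\<in>V. \<exists>N. pw d N * v \<in> mspan D B)))"

lemma mspan_pw_up: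
  assumes D: "subring D" and d: "d \<in> D" and "pw d N * v \<in> mspan D B" "N \<le> M"
  shows "pw d M * v \<in> mspan D B"
proof -
  have "pw d (M - N) * (pw d N * v) \<in> mspan D B"
    by (rule mspan_mult_left[OF subringD(2)[OF D] pw_closed[OF D d] assms(3)])
  moreover have "pw d (M - N) * (pw d N * v) = pw d M * v"
    using assms pw_add[of d "M - N" N] by (simp add: subringD mult.assoc)
  ultimately show ?thesis by simp
qed

text \<open>A smallest such generating set is linearly independent over \<open>D\<close>, and comparing coefficients in
  \<open>d\<^sup>N (c\<^sup>-\<^sup>1 b) = \<dots>\<close> shows that \<open>c\<close> divides \<open>d\<^sup>N\<close>.\<close>

lemma almost_finite_powers_absorb:
  assumes D: "subring D" and fin: "almost_finite D"
  shows "\<exists>d\<in>D. d \<noteq> 0 \<and> (\<forall>c\<in>D. c \<noteq> 0 \<longrightarrow> (\<exists>q\<in>D. \<exists>N. c * q = pw d N))"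
proof -
  define P where "P n \<longleftrightarrow> (\<exists>d\<in>D. d \<noteq> 0 \<and> (\<exists>B. finite B \<and> card B = n \<and> B \<subseteq> V \<and>
    (\<forall>v\<in>V. \<exists>N. pw d N * v \<in> mspan D B)))" for n
  have "\<exists>n. P n" using fin unfolding almost_finite_def P_def by blast
  define n where "n = (LEAST n. P n)"
  have Pn: "P n" unfolding n_def using \<open>\<exists>n. P n\<close> by (rule LeastI_ex)
  then obtain d B where d: "d \<in> D" "d \<noteq> 0" and B: "finite B" "card B = n" "B \<subseteq> V"
    and gen: "\<And>v. v \<in> V \<Longrightarrow> \<exists>N. pw d N * v \<in> mspan D B" unfolding P_def by blast
  have dz: "d \<in> Z" using d D by (simp add: subringD)
  have mV: "mspan D B' \<subseteq> V" if "B' \<subseteq> V" for B'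
    by (rule mspan_minimal) (use that D in \<open>auto intro: V_closed V_sub simp: subringD\<close>)
  have "B \<noteq> {}"
  proof
    assume "B = {}"
    obtain v where v: "v \<in> V" "v \<noteq> 0" using V_nz by blast
    then show False using gen[of v] \<open>B = {}\<close> V_cancel[of "pw d _" v] pw_nz[OF dz d(2)] pw_Z[OF dz] by auto
  qed
  then obtain b where b: "b \<in> B" by blast
  let ?B = "B - {b}"
  have bV: "b \<in> V" using b B by blast
  \<comment> \<open>If \<open>c * b\<close> depends on the other generators, inverting
    \<open>d * c\<close> instead of \<open>d\<close> makes \<open>b\<close> redundant, against the
    choice of \<open>n\<close>.\<close>
  have indep: "c = 0" if c: "c \<in> D" "c * b \<in> mspan D ?B" for c
  proof (rule ccontr)
    assume c0: "c \<noteq> 0"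
    have cz: "c \<in> Z" using c D by (simp add: subringD)
    have dc: "d * c \<in> D" "d * c \<noteq> 0" using d c D c0 Z_cancel[of d c] by (auto simp: subringD)
    have "\<exists>N. pw (d * c) N * v \<in> mspan D ?B" if v: "v \<in> V" for v
    proof -
      obtain N where "pw d N * v \<in> mspan D B" using gen[OF v] by blast
      \<comment> \<open>A positive exponent guarantees a factor \<open>c\<close> that turns
        \<open>a * b\<close> into a multiple of \<open>c * b\<close>.\<close>
      then have N: "pw d (Suc N) * v \<in> mspan D B" using mspan_pw_up[OF D d(1)] by (meson le_SucI order_refl)
      obtain a y where a: "a \<in> D" "y \<in> mspan D ?B" "pw d (Suc N) * v = a * b + y"
        using mspan_insert[OF subringD(1)[OF D], of "pw d (Suc N) * v" b ?B] N
        unfolding insert_Diff[OF b] by blast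
      have az: "a \<in> Z" using a D by (simp add: subringD)
      have "pw c (Suc N) * (a * b) = (pw c N * a) * (c * b)"
        using cz az by (simp add: pw_Suc mult.assoc Z_left_comm pw_Z)
      moreover have "(pw c N * a) * (c * b) \<in> mspan D ?B"
        by (rule mspan_mult_left[OF subringD(2)[OF D] _ c(2)]) (use c a D in \<open>simp add: subringD pw_closed\<close>)
      moreover have "pw c (Suc N) * y \<in> mspan D ?B"
        using c a D by (intro mspan_mult_left) (auto simp: subringD pw_closed)
      ultimately have "pw c (Suc N) * (pw d (Suc N) * v) \<in> mspan D ?B"
        unfolding a(3) by (simp add: distrib_left subspace_add)
      moreover have "pw c (Suc N) * (pw d (Suc N) * v) = pw (d * c) (Suc N) * v"
        using cz dz Z_comm[of "pw c (Suc N)" "pw d (Suc N)"] by (simp add: pw_mult pw_Z mult.assoc[symmetric])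
      ultimately show ?thesis by metis
    qed
    then have "P (card ?B)" unfolding P_def using dc B by blast
    moreover have "card ?B < n" using B b by (metis card_Diff1_less)
    ultimately show False unfolding n_def using not_less_Least by blast
  qed
  have b0: "b \<noteq> 0"
    using indep[of e] e_nz D subspace_0[OF subspace_mspan] by (auto simp: subringD)
  have "\<exists>q\<in>D. \<exists>N. c * q = pw d N" if c: "c \<in> D" "c \<noteq> 0" for c
  proof -
    have cz: "c \<in> Z" using c D by (simp add: subringD)
    obtain w where w: "w \<in> Z" "c * w = e" using Z_inv cz c by blast
    obtain N where "pw d N * (w * b) \<in> mspan D B" using gen V_closed w bV by blast
    then obtain q y where q: "q \<in> D" "y \<in> mspan D ?B" "pw d N * (w * b) = q * b + y"
      using mspan_insert[OF subringD(1)[OF D], of "pw d N * (w * b)" b ?B]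
      unfolding insert_Diff[OF b] by blast
    have "c * (pw d N * (w * b)) = pw d N * ((c * w) * b)"
      using cz pw_Z[OF dz] by (simp add: Z_left_comm mult.assoc)
    then have "pw d N * b = c * (q * b + y)" using q w V_unit[OF bV] by simp
    then have "(pw d N - c * q) * b = c * y" by (simp add: algebra_simps)
    moreover have "c * y \<in> mspan D ?B" using q c D by (intro mspan_mult_left) (auto simp: subringD)
    moreover have "pw d N - c * q \<in> D" using q c d D by (simp add: subringD pw_closed)
    ultimately have "pw d N - c * q = 0" by (intro indep) simp_all
    then have "c * q = pw d N" by simp
    then show ?thesis using q(1) by blast
  qed
  then show ?thesis using d by blast
qed

text \<open>Absorption of powers makes \<open>x\<close> algebraic, with leading coefficient
  \<open>c\<close> in degree \<open>m\<close>. Then the finitely many \<open>pw x i * b\<close> with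
  \<open>i < m\<close> generate once \<open>c\<close> is inverted, and \<open>d\<close> is replaced
  by a nonzero multiple \<open>d * w\<close> in \<open>D\<close>. The new denominator is the product
  of the two.\<close>

lemma almost_finite_descent:
  assumes D: "subring D" "x \<in> Z" and fin: "almost_finite (adjoin D x)"
  shows "almost_finite D"
proof -
  let ?A = "adjoin D x"
  note A = subring_adjoin[OF D]
  have "\<exists>n. algebraic_over D x n"
    using almost_finite_powers_absorb[OF A fin] algebraic_if_powers_absorb[OF D] by blast
  define m where "m = (LEAST n. algebraic_over D x n)"
  have m: "algebraic_over D x m" unfolding m_def using \<open>\<exists>n. algebraic_over D x n\<close> by (rule LeastI_ex)
  have least: "\<not> algebraic_over D x n" if "n < m" for n using that not_less_Least unfolding m_def by blast
  obtain c where c: "c \<in> D" "c \<noteq> 0" "c * pw x m \<in> below D x m" using m by (auto simp: algebraic_over_def)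
  obtain d B where d: "d \<in> ?A" "d \<noteq> 0" and B: "finite B" "B \<subseteq> V"
    and gen: "\<And>v. v \<in> V \<Longrightarrow> \<exists>N. pw d N * v \<in> mspan ?A B" using fin unfolding almost_finite_def by blast
  obtain w where w: "w \<in> ?A" "d * w \<in> D" "d * w \<noteq> 0"
    using adjoin_mult_meets_base[OF D m least d] by blast
  let ?B = "(\<lambda>(i, b). pw x i * b) ` ({..<m} \<times> B)"
  have Zs: "c \<in> Z" "d \<in> Z" "w \<in> Z" "d * w \<in> Z" using c d w D A by (auto simp: subringD)
  have below_b: "y * b \<in> mspan D ?B" if y: "y \<in> below D x m" and b: "b \<in> B" for y b
  proof -
    have "below D x m \<subseteq> {y. y * b \<in> mspan D ?B}"
      unfolding below_def
    proof (rule mspan_minimal)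
      fix a z assume *: "a \<in> D" "z \<in> pw x ` {..<m}"
      then have "z * b \<in> ?B" using b by auto
      from mspan_base[OF *(1) this] show "a * z \<in> {y. y * b \<in> mspan D ?B}" by (simp add: mult.assoc)
    qed (auto intro: subspace_mult_right_vimage)
    then show ?thesis using y by blast
  qed
  have clear: "\<exists>N. pw c N * v \<in> mspan D ?B" if "v \<in> mspan ?A B" for v
  proof -
    let ?U = "{v. \<exists>N. pw c N * v \<in> mspan D ?B}"
    have "mspan ?A B \<subseteq> ?U"
    proof (rule mspan_minimal)
      fix a b assume *: "a \<in> ?A" "b \<in> B"
      obtain N where "pw c N * a \<in> below D x m"
        using below_clear_denominators[OF D c(1,3)] adjoin_below[OF *(1)] by blast
      from below_b[OF this *(2)] show "a * b \<in> ?U" by (auto simp: mult.assoc)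
    next
      show "subspace ?U"
      proof (rule subspaceI)
        show "0 \<in> ?U" using subspace_0[OF subspace_mspan] by simp
      next
        fix y z assume "y \<in> ?U" "z \<in> ?U"
        then obtain N M where "pw c N * y \<in> mspan D ?B" "pw c M * z \<in> mspan D ?B" by blast
        then have "pw c (N + M) * y \<in> mspan D ?B" "pw c (N + M) * z \<in> mspan D ?B"
          using mspan_pw_up[OF D(1) c(1)] by auto
        then have "pw c (N + M) * (y + z) \<in> mspan D ?B"
          by (simp add: distrib_left subspace_add)
        then show "y + z \<in> ?U" by blast
      next
        fix k y assume "y \<in> ?U"
        then obtain N where "pw c N * y \<in> mspan D ?B" by blast
        then have "pw c N * scale k y \<in> mspan D ?B"
          by (simp add: scale_mult_right[symmetric] subspace_scale)
        then show "scale k y \<in> ?U" by blast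
      qed
    qed
    then show ?thesis using that by blast
  qed
  have "\<exists>N. pw (c * (d * w)) N * v \<in> mspan D ?B" if v: "v \<in> V" for v
  proof -
    obtain N where N: "pw d N * v \<in> mspan ?A B" using gen[OF v] by blast
    have "pw w N * (pw d N * v) \<in> mspan ?A B"
      by (rule mspan_mult_left[OF subringD(2)[OF A] pw_closed[OF A w(1)] N])
    moreover have "pw w N * (pw d N * v) = pw (d * w) N * v"
      using Zs by (simp add: pw_mult Z_left_comm pw_Z mult.assoc)
    ultimately obtain M where M: "pw c M * (pw (d * w) N * v) \<in> mspan D ?B" using clear by auto
    have "pw c N * (pw (d * w) M * (pw c M * (pw (d * w) N * v))) \<in> mspan D ?B"
      by (rule mspan_mult_left[OF subringD(2)[OF D(1)] pw_closed[OF D(1) c(1)]])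
        (rule mspan_mult_left[OF subringD(2)[OF D(1)] pw_closed[OF D(1) w(2)] M])
    moreover have "pw c N * (pw (d * w) M * (pw c M * (pw (d * w) N * v))) = pw (c * (d * w)) (N + M) * v"
      using Zs by (simp add: pw_mult[of c "d * w"] pw_add Z_left_comm pw_Z mult.assoc)
    ultimately show ?thesis by metis
  qed
  moreover have "c * (d * w) \<in> D" "c * (d * w) \<noteq> 0"
    using c w D Zs Z_cancel[of c "d * w"] by (auto simp: subringD)
  moreover have "finite ?B" "?B \<subseteq> V" using B D by (auto intro: V_closed simp: pw_Z)
  ultimately show ?thesis unfolding almost_finite_def by blast
qed

section \<open>Descent to the ground field\<close>

lemma subring_scalars: "subring (span {e})"
proof -
  have "x * y \<in> span {e}" if xy: "x \<in> span {e}" "y \<in> span {e}" for x y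
  proof -
    obtain a b where "x = scale a e" "y = scale b e" using xy by (auto simp: span_singleton)
    then have "x * y = scale (a * b) e"
      by (simp add: scale_mult_left[symmetric] scale_mult_right[symmetric] Z_unit e_Z mult.commute)
    then show ?thesis by (simp add: span_scale span_base)
  qed
  moreover have "span {e} \<subseteq> Z" using subringD(1)[OF subring_Z] e_Z by (intro span_minimal) simp_all
  ultimately show ?thesis by (simp add: subring_def subalgebra_def span_base)
qed

lemma subring_hull:
  assumes "X \<subseteq> Z"
  shows "subring (subalgebra hull (insert e X))"
  unfolding subring_def
proof (intro conjI)
  show "subalgebra hull (insert e X) \<subseteq> Z"
    by (rule subalgebra_hull_minimal[OF Z_sub]) (use assms e_Z in simp)
qed (rule hull_inc, simp, rule subalgebra_hull)

lemma almost_finite_scalars: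
  assumes "finite X" "X \<subseteq> Z" "almost_finite (subalgebra hull (insert e X))"
  shows "almost_finite (span {e})"
  using assms
proof (induction X)
  case empty
  have "subalgebra hull {e} = span {e}"
  proof
    show "subalgebra hull {e} \<subseteq> span {e}"
      by (rule hull_minimal) (use subring_scalars in \<open>auto simp: subringD span_base\<close>)
    show "span {e} \<subseteq> subalgebra hull {e}"
      by (rule span_minimal) (use subring_hull[of "{}"] in \<open>auto simp: subringD\<close>)
  qed
  then show ?case using empty by simp
next
  case (insert x X)
  let ?D = "subalgebra hull (insert e X)"
  have D: "subring ?D" using subring_hull insert.prems by simp
  have x: "x \<in> Z" using insert.prems by simp
  have "subalgebra hull (insert e (insert x X)) = adjoin ?D x"
  proof
    have "insert e X \<subseteq> ?D" by (rule hull_subset)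
    then have "insert e (insert x X) \<subseteq> adjoin ?D x"
      using subset_adjoin[OF D x] by auto
    then show "subalgebra hull (insert e (insert x X)) \<subseteq> adjoin ?D x"
      by (rule hull_minimal) (use subring_adjoin[OF D x] in \<open>simp add: subringD\<close>)
    let ?H = "subalgebra hull (insert e (insert x X))"
    have H: "subring ?H" using subring_hull[of "insert x X"] insert.prems by simp
    have "?D \<subseteq> ?H" by (rule hull_mono) auto
    moreover have "x \<in> ?H" by (simp add: hull_inc)
    ultimately show "adjoin ?D x \<subseteq> ?H"
      unfolding adjoin_def using H by (intro mspan_minimal) (auto simp: subringD pw_closed subset_eq)
  qed
  then show ?case using insert almost_finite_descent[OF D x] by simp
qed

text \<open>A finite module is \<open>almost_finite\<close> with denominator \<open>e\<close>. After
  the descent to the scalars the denominator is a nonzero multiple of \<open>e\<close>, hence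
  invertible, and the localized statement says that \<open>B\<close> spans \<open>V\<close>.\<close>

lemma finite_dimensional_if_finite_module:
  assumes "finite X" "X \<subseteq> Z" "finite B" "B \<subseteq> V" "V \<subseteq> mspan (subalgebra hull (insert e X)) B"
  shows "\<exists>B. finite B \<and> V \<subseteq> span B"
proof -
  let ?D = "subalgebra hull (insert e X)"
  have D: "subring ?D" using subring_hull assms by simp
  have "almost_finite ?D"
    unfolding almost_finite_def
    using assms D e_nz by (intro bexI[of _ e] conjI exI[of _ B] ballI exI[of _ 0]) (auto simp: subringD V_unit)
  then have "almost_finite (span {e})" using almost_finite_scalars assms by blast
  then obtain d B where d: "d \<in> span {e}" "d \<noteq> 0" and B: "finite B" "B \<subseteq> V"
    and gen: "\<And>v. v \<in> V \<Longrightarrow> \<exists>N. pw d N * v \<in> mspan (span {e}) B" unfolding almost_finite_def by blast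
  obtain k where k: "d = scale k e" using d by (auto simp: span_singleton)
  have k0: "k \<noteq> 0" using d k by auto
  have mB: "mspan (span {e}) B \<subseteq> span B"
  proof (rule mspan_minimal)
    fix a b assume "a \<in> span {e}" "b \<in> B"
    moreover from this obtain k where "a = scale k e" by (auto simp: span_singleton)
    moreover have "e * b = b" using V_unit B \<open>b \<in> B\<close> by blast
    ultimately have "a * b = scale k b" by (simp add: scale_mult_left[symmetric])
    then show "a * b \<in> span B" using \<open>b \<in> B\<close> by (simp add: span_scale span_base)
  qed simp
  have pwd: "pw d N * v = scale (k ^ N) v" if "v \<in> V" for v N
    using that
  proof (induction N)
    case (Suc N)
    have "pw d (Suc N) * v = d * (pw d N * v)" by (simp add: pw_Suc mult.assoc)
    also have "\<dots> = scale (k ^ N) (d * v)" using Suc by (simp add: scale_mult_right)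
    also have "d * v = scale k v" using Suc.prems V_unit by (simp add: k scale_mult_left[symmetric])
    finally show ?case by (simp add: mult.commute)
  qed (simp add: V_unit)
  have "v \<in> span B" if v: "v \<in> V" for v
  proof -
    obtain N where "scale (k ^ N) v \<in> span B" using gen[OF v] mB pwd[OF v] by auto
    from span_scale[OF this, of "inverse (k ^ N)"] show ?thesis using k0 by simp
  qed
  then show ?thesis using B by blast
qed

end

section \<open>Corners of simple algebras\<close>

text \<open>For idempotents this is the Peirce component \<open>pRq\<close>; the defining equations
  make it a subspace for arbitrary \<open>p\<close> and \<open>q\<close>.\<close>

definition corner :: "'a::ring \<Rightarrow> 'a \<Rightarrow> 'a set" where
  "corner p q = {x. p * x = x \<and> x * q = x}"

lemma cornerD: "x \<in> corner p q \<Longrightarrow> p * x = x" "x \<in> corner p q \<Longrightarrow> x * q = x"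
  by (auto simp: corner_def)

lemma corner_compress: "p * p = p \<Longrightarrow> q * q = q \<Longrightarrow> p * x * q \<in> corner p (q::'a::ring)"
  unfolding corner_def by (simp add: mult.assoc) (metis mult.assoc)

lemma corner_mult: "x \<in> corner p q \<Longrightarrow> y \<in> corner q' r \<Longrightarrow> x * y \<in> corner p (r::'a::ring)"
  unfolding corner_def by (simp add: mult.assoc) (metis mult.assoc)

text \<open>The expression is (1 - v) k (1 - v), expanded because the ring may lack a unit.\<close>

lemma idempotent_outer:
  fixes v k :: "'b::ring"
  assumes v: "v * v = v"
  shows "v * (k - v * k - k * v + v * k * v) = 0" "(k - v * k - k * v + v * k * v) * v = 0"
proof -
  have "v * (v * x) = v * x" for x using v by (simp add: mult.assoc[symmetric])
  then show "v * (k - v * k - k * v + v * k * v) = 0" "(k - v * k - k * v + v * k * v) * v = 0"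
    using v by (simp_all add: algebra_simps)
qed

context assoc_algebra
begin

lemma subspace_corner [simp]: "subspace (corner p q)"
  unfolding corner_def subspace_def
  by (auto simp: distrib_left distrib_right scale_mult_left[symmetric] scale_mult_right[symmetric])

lemma subalgebra_corner: "subalgebra (corner p p)"
  unfolding subalgebra_def using corner_mult[of _ p p _ p p] by simp

end

locale simple_with_idempotent = assoc_algebra scale
  for scale :: "'f::field \<Rightarrow> 'a::ring \<Rightarrow> 'a" +
  fixes e :: 'a
  assumes simple: simple and e_nz: "e \<noteq> 0" and ee: "e * e = e"
begin

text \<open>Without a unit it is not clear that RyR is nonzero. The elements with RyR = 0 form an
  ideal that misses \<open>e\<close>, because eee is nonzero; hence that ideal is zero, and RyR
  spans R.\<close>

lemma span_two_sided:
  assumes "y \<noteq> 0"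
  shows "x \<in> span {r * y * s | r s. True}"
proof -
  have ideal: "two_sided_ideal (span {r * y * s | r s. True})" for y
  proof -
    let ?I = "span {r * y * s | r s. True}"
    have "?I \<subseteq> {x. t * x \<in> ?I}" for t
    proof (rule span_minimal)
      have "t * (r * y * s) \<in> ?I" for r s
        by (rule span_base) (auto simp: mult.assoc[symmetric])
      then show "{r * y * s | r s. True} \<subseteq> {x. t * x \<in> ?I}" by auto
    qed (simp add: subspace_mult_left_vimage)
    moreover have "?I \<subseteq> {x. x * t \<in> ?I}" for t
    proof (rule span_minimal)
      have "(r * y * s) * t \<in> ?I" for r s
        by (rule span_base) (auto simp: mult.assoc)
      then show "{r * y * s | r s. True} \<subseteq> {x. x * t \<in> ?I}" by auto
    qed (simp add: subspace_mult_right_vimage)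
    ultimately show ?thesis unfolding two_sided_ideal_def by blast
  qed
  define J where "J = {y :: 'a. \<forall>r s. r * y * s = 0}"
  have "two_sided_ideal J"
    unfolding two_sided_ideal_def
  proof (intro conjI allI ballI)
    show "subspace J"
      unfolding subspace_def J_def
      by (auto simp: distrib_left distrib_right scale_mult_left[symmetric] scale_mult_right[symmetric])
    fix t x :: 'a assume x: "x \<in> J"
    have "r * (t * x) * s = (r * t) * x * s" "r * (x * t) * s = r * x * (t * s)" for r s
      by (simp_all add: mult.assoc)
    then show "t * x \<in> J" "x * t \<in> J" using x by (simp_all add: J_def)
  qed
  then have "J = {0} \<or> J = UNIV" using simple unfolding simple_def by blast
  moreover have "e \<notin> J"
  proof -
    have "e * e * e \<noteq> 0" using ee e_nz by simp
    then show ?thesis unfolding J_def by blast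
  qed
  ultimately have "J = {0}" by auto
  then have "y \<notin> J" using assms by simp
  then obtain r s where rs: "r * y * s \<noteq> 0" unfolding J_def by blast
  have "span {r * y * s | r s. True} = {0} \<or> span {r * y * s | r s. True} = UNIV"
    using ideal[of y] simple unfolding simple_def by blast
  moreover have "r * y * s \<in> span {r * y * s | r s. True}" by (rule span_base) blast
  ultimately have "span {r * y * s | r s. True} = UNIV" using rs by auto
  then show ?thesis by simp
qed

lemma prime:
  fixes a b :: 'a
  assumes "\<And>r. a * r * b = 0"
  shows "a = 0 \<or> b = 0"
proof (rule ccontr)
  assume *: "\<not> (a = 0 \<or> b = 0)"
  have a0: "a * x = 0" for x
  proof -
    have "span {r * b * s | r s. True} \<subseteq> {x. a * x \<in> {0}}"
    proof (rule span_minimal)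
      show "{r * b * s | r s. True} \<subseteq> {x. a * x \<in> {0}}" using assms by (auto simp: mult.assoc[symmetric])
    qed (rule subspace_mult_left_vimage, simp)
    then show ?thesis using span_two_sided[of b x] * by auto
  qed
  have "span {r * a * s | r s. True} \<subseteq> {0}"
    by (rule span_minimal) (use a0 in \<open>auto simp: mult.assoc\<close>)
  then show False using span_two_sided[of a e] * e_nz by auto
qed

text \<open>Cut R = RyR down by \<open>p\<close> and \<open>p'\<close> on the outside; y = q y q'
  supplies the inner idempotents.\<close>

lemma corner_span:
  assumes y: "y \<noteq> 0" "y \<in> corner q q'" and "p * p = p" "q * q = q" "q' * q' = q'" "p' * p' = p'"
    and x: "x \<in> corner p p'"
  shows "x \<in> span {a * y * b | a b. a \<in> corner p q \<and> b \<in> corner q' p'}"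
proof -
  let ?S = "span {a * y * b | a b. a \<in> corner p q \<and> b \<in> corner q' p'}"
  have "span {r * y * s | r s. True} \<subseteq> {x. x * p' \<in> {x. p * x \<in> ?S}}"
  proof (rule span_minimal)
    have "r * y * s * p' \<in> {x. p * x \<in> ?S}" for r s
    proof -
      have "p * (r * y * s * p') = (p * r * q) * y * (q' * s * p')"
        using cornerD[OF y(2)] by (metis mult.assoc)
      moreover have "(p * r * q) * y * (q' * s * p') \<in> ?S"
        using assms by (intro span_base) (auto intro: corner_compress)
      ultimately show ?thesis by simp
    qed
    then show "{r * y * s | r s. True} \<subseteq> {x. x * p' \<in> {x. p * x \<in> ?S}}" by auto
  qed (intro subspace_mult_right_vimage subspace_mult_left_vimage subspace_span)
  then have "x \<in> {x. x * p' \<in> {x. p * x \<in> ?S}}" using span_two_sided[OF y(1), of x] by blast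
  then show ?thesis using cornerD[OF x] by simp
qed

lemma corner_semiprime:
  fixes p c :: 'a
  assumes "p * p = p" "c \<in> corner p p" "\<And>a. a \<in> corner p p \<Longrightarrow> c * a * c = 0"
  shows "c = 0"
proof -
  have "c * r * c = 0" for r
  proof -
    have "c * r * c = c * (p * r * p) * c" using cornerD[OF assms(2)] by (metis mult.assoc)
    then show ?thesis using assms corner_compress[of p p r] by simp
  qed
  then show ?thesis using prime[of c c] by blast
qed

text \<open>Writing each generator as a sum of products \<open>r p s\<close>, a word in the generators becomes
  \<open>r\<^sub>1 p (s\<^sub>1 r\<^sub>2) p (s\<^sub>2 r\<^sub>3) \<dots> p s\<^sub>n\<close>.\<close>

lemma corner_generation:
  assumes fg: "finitely_generated" and p: "p \<noteq> 0" "p * p = p"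
  obtains G Rs Ss where "finite G" "finite Rs" "finite Ss" "G \<subseteq> corner p p"
    "corner p p \<subseteq> subalgebra hull G"
    "\<And>x. x \<in> span {r * h * s | r h s. r \<in> Rs \<and> h \<in> subalgebra hull G \<and> s \<in> Ss}"
    "\<And>x. p * x \<in> span {h * s | h s. h \<in> corner p p \<and> s \<in> Ss}"
proof -
  obtain X where X: "finite X" "subalgebra hull X = UNIV" using fg by (auto simp: finitely_generated_def)
  have "\<exists>T. finite T \<and> T \<subseteq> {r * p * s | r s. True} \<and> x \<in> span T" for x
    by (rule span_support_finite[OF span_two_sided[OF p(1)]])
  then obtain T where T: "\<And>x. finite (T x)" "\<And>x. T x \<subseteq> {r * p * s | r s. True}" "\<And>x. x \<in> span (T x)"
    by metis
  have "\<forall>t\<in>(\<Union>x\<in>X. T x). \<exists>r s. t = r * p * s" using T(2) by blast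
  then obtain rf sf where rs: "\<And>t. t \<in> (\<Union>x\<in>X. T x) \<Longrightarrow> t = rf t * p * sf t" by metis
  define Rs where "Rs = rf ` (\<Union>x\<in>X. T x)"
  define Ss where "Ss = sf ` (\<Union>x\<in>X. T x)"
  have fin: "finite Rs" "finite Ss" using X(1) T(1) by (auto simp: Rs_def Ss_def)
  \<comment> \<open>The elements \<open>p * (s * r) * p\<close> are the inner links of a word,
    \<open>p\<close> is the middle of a single generator \<open>r * p * s\<close>, and
    \<open>p * r * p\<close> and \<open>p * s * p\<close> arise at the two ends when a word is cut
    down to the corner.\<close>
  define G where "G = insert p ((\<lambda>r. p * r * p) ` Rs \<union> (\<lambda>s. p * s * p) ` Ss \<union>
    (\<lambda>(s, r). p * (s * r) * p) ` (Ss \<times> Rs))"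
  have Gfin: "finite G" using fin by (simp add: G_def)
  have Gp: "G \<subseteq> corner p p" using p by (auto simp: G_def intro: corner_compress) (simp_all add: corner_def)
  define H where "H = subalgebra hull G"
  have H: "subalgebra H" unfolding H_def by (rule subalgebra_hull)
  have Hp: "H \<subseteq> corner p p" unfolding H_def by (rule subalgebra_hull_minimal[OF subalgebra_corner Gp])
  have GH: "g \<in> H" if "g \<in> G" for g using that unfolding H_def by (rule hull_inc)
  have Hm: "a * b \<in> H" if "a \<in> H" "b \<in> H" for a b using that H by (simp add: subalgebra_def)
  let ?M = "{r * h * s | r h s. r \<in> Rs \<and> h \<in> H \<and> s \<in> Ss}"
  let ?N = "span ?M"
  have mult: "x * y \<in> ?N" if x: "x \<in> ?N" and y: "y \<in> ?N" for x y
  proof -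
    have base: "x * y \<in> ?N" if xy: "x \<in> ?M" "y \<in> ?M" for x y
    proof -
      obtain r h s r' h' s' where *: "x = r * h * s" "y = r' * h' * s'"
        "r \<in> Rs" "h \<in> H" "s \<in> Ss" "r' \<in> Rs" "h' \<in> H" "s' \<in> Ss" using xy by blast
      have "h * p = h" "p * h' = h'" using * Hp cornerD by blast+
      then have "x * y = r * (h * (p * (s * r') * p) * h') * s'"
        unfolding * by (metis mult.assoc)
      moreover have "h * (p * (s * r') * p) * h' \<in> H"
      proof -
        have "p * (s * r') * p \<in> G" 
          unfolding G_def by (intro insertI2 UnI2 image_eqI[where x="(s, r')"]) (use * in auto)
        then show ?thesis using * by (simp add: Hm GH)
      qed
      ultimately show ?thesis using * by (intro span_base) blast
    qed
    have "x * y \<in> ?N" if y: "y \<in> ?M" for y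
    proof -
      have "?M \<subseteq> {x. x * y \<in> ?N}" using base[OF _ y] by blast
      then have "?N \<subseteq> {x. x * y \<in> ?N}" by (rule span_minimal) (simp add: subspace_mult_right_vimage)
      then show ?thesis using x by blast
    qed
    then have "?M \<subseteq> {y. x * y \<in> ?N}" by blast
    then have "?N \<subseteq> {y. x * y \<in> ?N}" by (rule span_minimal) (simp add: subspace_mult_left_vimage)
    then show ?thesis using y by blast
  qed
  have "X \<subseteq> ?N"
  proof
    fix x assume x: "x \<in> X"
    have "T x \<subseteq> ?N"
    proof
      fix t assume "t \<in> T x"
      then have t: "t \<in> (\<Union>x\<in>X. T x)" using x by blast
      then have "rf t \<in> Rs" "sf t \<in> Ss" "t = rf t * p * sf t" using rs by (auto simp: Rs_def Ss_def)
      moreover have "p \<in> H" by (rule GH) (simp add: G_def)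
      ultimately show "t \<in> ?N" by (intro span_base) blast
    qed
    then have "span (T x) \<subseteq> ?N" by (rule span_minimal) simp
    then show "x \<in> ?N" using T(3) by blast
  qed
  moreover have "subalgebra ?N" using mult by (simp add: subalgebra_def)
  ultimately have "subalgebra hull X \<subseteq> ?N" by (intro subalgebra_hull_minimal)
  then have all: "x \<in> ?N" for x using X(2) by blast
  have pleft: "p * x \<in> span {h * s | h s. h \<in> H \<and> s \<in> Ss}" for x
  proof -
    let ?S = "span {h * s | h s. h \<in> H \<and> s \<in> Ss}"
    have "?N \<subseteq> {x. p * x \<in> ?S}"
    proof (rule span_minimal)
      have "p * (r * h * s) \<in> ?S" if "r \<in> Rs" "h \<in> H" "s \<in> Ss" for r h s
      proof -
        have "p * h = h" using that Hp cornerD by blast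
        then have "p * (r * h * s) = ((p * r * p) * h) * s" by (metis mult.assoc)
        moreover have "p * r * p \<in> G" using that by (simp add: G_def)
        then have "(p * r * p) * h \<in> H" using that by (simp add: Hm GH)
        ultimately show ?thesis using that by (intro span_base) blast
      qed
      then show "?M \<subseteq> {x. p * x \<in> ?S}" by auto
    qed (simp add: subspace_mult_left_vimage)
    then show ?thesis using all by blast
  qed
  have "corner p p \<subseteq> H"
  proof
    fix x assume x: "x \<in> corner p p"
    have sH: "subspace H" using H by (simp add: subalgebra_def)
    have "span {h * s | h s. h \<in> H \<and> s \<in> Ss} \<subseteq> {x. x * p \<in> H}"
    proof (rule span_minimal)
      have "h * s * p \<in> H" if "h \<in> H" "s \<in> Ss" for h s
      proof -
        have "h * p = h" using that Hp cornerD by blast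
        then have "h * s * p = h * (p * s * p)" by (metis mult.assoc)
        then show ?thesis using that by (simp add: Hm GH G_def)
      qed
      then show "{h * s | h s. h \<in> H \<and> s \<in> Ss} \<subseteq> {x. x * p \<in> H}" by auto
    qed (rule subspace_mult_right_vimage[OF sH])
    then have "p * x * p \<in> H" using pleft by blast
    then show "x \<in> H" using cornerD[OF x] by simp
  qed
  moreover from this have "H = corner p p" using Hp by blast
  ultimately show ?thesis using that[OF Gfin fin Gp] all pleft unfolding H_def by simp
qed

text \<open>If some c = [s, t] with s, t in T is nonzero, then ca = [s, ta] - t[s, a] and bca =
  [b, ca] + c(ab) lie in T, and AcA = A. If T is commutative, the square of ad t vanishes on A; the
  Leibniz rule gives 2[t, a][t, b] = 0, replacing b by ba gives [t, a] b [t, a] = 0, and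
  semiprimeness makes t central.\<close>

lemma subalgebra_lie_ideal_corner:
  assumes two: "(2::'f) \<noteq> 0"
    and T: "subalgebra T" "T \<subseteq> corner e e" "\<And>a t. a \<in> corner e e \<Longrightarrow> t \<in> T \<Longrightarrow> commutator a t \<in> T"
  shows "corner e e \<subseteq> T \<or> (\<forall>t\<in>T. \<forall>a\<in>corner e e. t * a = a * t)"
proof (cases "\<forall>s\<in>T. \<forall>t\<in>T. commutator s t = 0")
  case False
  let ?A = "corner e e"
  have Am: "a * b \<in> ?A" if "a \<in> ?A" "b \<in> ?A" for a b using that corner_mult by blast
  have sT: "subspace T" and Tm: "\<And>a b. a \<in> T \<Longrightarrow> b \<in> T \<Longrightarrow> a * b \<in> T" using T(1) by (auto simp: subalgebra_def)
  have T_right: "commutator t a \<in> T" if "a \<in> ?A" "t \<in> T" for a t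
    using T(3)[OF that] commutator_minus_swap[of t a] subspace_neg[OF sT] by simp
  obtain s t where st: "s \<in> T" "t \<in> T" "commutator s t \<noteq> 0" using False by blast
  let ?c = "commutator s t"
  have cA: "?c \<in> ?A" using st T by blast
  have ca: "?c * a \<in> T" if a: "a \<in> ?A" for a
  proof -
    have "commutator s (t * a) - t * commutator s a \<in> T"
      using st a T(2) by (intro subspace_diff[OF sT] T_right Tm Am) auto
    then show ?thesis by (simp add: commutator_mult_right)
  qed
  have bca: "b * ?c * a \<in> T" if ab: "a \<in> ?A" "b \<in> ?A" for a b
  proof -
    have "commutator b (?c * a) + ?c * (a * b) \<in> T"
      using ab ca Am T by (intro subspace_add[OF sT]) auto
    then show ?thesis by (simp add: commutator_def[of b] mult.assoc)
  qed
  have "?A \<subseteq> T"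
  proof
    fix x assume "x \<in> ?A"
    from corner_span[OF st(3) cA ee ee ee ee this]
    show "x \<in> T" using span_minimal[OF _ sT, of "{a * ?c * b | a b. a \<in> ?A \<and> b \<in> ?A}"] bca by blast
  qed
  then show ?thesis ..
next
  case comm: True
  let ?A = "corner e e"
  have Am: "a * b \<in> ?A" if "a \<in> ?A" "b \<in> ?A" for a b using that corner_mult by blast
  have sT: "subspace T" using T(1) by (auto simp: subalgebra_def)
  have T_right: "commutator t a \<in> T" if "a \<in> ?A" "t \<in> T" for a t
    using T(3)[OF that] commutator_minus_swap[of t a] subspace_neg[OF sT] by simp
  have "commutator t a = 0" if t: "t \<in> T" and a: "a \<in> ?A" for t a
  proof -
    have dd: "commutator t (commutator t b) = 0" if "b \<in> ?A" for b
      using comm t T_right[OF that t] by blast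
    have prod: "commutator t a * commutator t b = 0" if b: "b \<in> ?A" for b
    proof -
      let ?x = "commutator t a * commutator t b"
      have "commutator t (commutator t (a * b)) = ?x + ?x"
        using dd[OF a] dd[OF b] by (simp add: commutator_mult_right commutator_add_right)
      then have "scale 2 ?x = 0" using dd[OF Am[OF a b]] scale_left_distrib[of 1 1 ?x] by simp
      then show ?thesis using two by simp
    qed
    have "commutator t a * b * commutator t a = 0" if b: "b \<in> ?A" for b
    proof -
      have "commutator t a * commutator t (b * a) = 0" using prod Am b a by blast
      then show ?thesis using prod[OF b]
        by (simp add: commutator_mult_right distrib_left mult.assoc[symmetric])
    qed
    moreover have "commutator t a \<in> ?A" using T_right[OF a t] T by blast
    ultimately show ?thesis using corner_semiprime[OF ee] by blast
  qed
  then show ?thesis by (auto simp: commutator_def)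
qed

end

section \<open>Alternating words\<close>

fun alternating :: "'a set \<Rightarrow> 'a set \<Rightarrow> 'a list \<Rightarrow> bool" where
  "alternating A B [] \<longleftrightarrow> True"
| "alternating A B (x # w) \<longleftrightarrow> x \<in> A \<and> alternating B A w"

lemma alternating_append:
  "alternating A B (v @ w) \<longleftrightarrow>
    alternating A B v \<and> (if even (length v) then alternating A B w else alternating B A w)"
  by (induction v arbitrary: A B) auto

lemma alternating_rev:
  "alternating A B w \<Longrightarrow> if odd (length w) then alternating A B (rev w) else alternating B A (rev w)"
proof (induction w arbitrary: A B)
  case (Cons x w)
  then show ?case using Cons.IH[of B A] by (auto simp: alternating_append split: if_splits)
qed simp

lemma alternating_rev_odd: "alternating A B w \<Longrightarrow> odd (length w) \<Longrightarrow> alternating A B (rev w)"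
  using alternating_rev[of A B w] by simp

lemma alternating_nth: "alternating A B w \<Longrightarrow> i < length w \<Longrightarrow> even i \<Longrightarrow> w ! i \<in> A"
proof (induction w arbitrary: i rule: induct_list012)
  case (2 x)
  then show ?case by simp
next
  case (3 x y w)
  then show ?case
  proof (cases i)
    case (Suc j)
    then obtain k where "i = Suc (Suc k)" using 3 by (cases j) auto
    then show ?thesis using 3 by auto
  qed auto
qed simp

text \<open>An odd word has (length + 1)/2 letters in even positions, all from \<open>A\<close>.
  Beyond length \<open>2 * card A\<close> these outnumber \<open>A\<close>, and the pigeonhole
  principle applies.\<close>

lemma alternating_repetition:
  assumes "finite A" "alternating A B w" "odd (length w)" "2 * card A < length w"
  obtains p x s q where "w = p @ [x] @ s @ [x] @ q" "even (length p)" "odd (length s)"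
proof -
  define m where "m = (length w + 1) div 2"
  have m: "i < m \<longleftrightarrow> 2 * i < length w" for i using assms(3) unfolding m_def by presburger
  have "(\<lambda>i. w ! (2 * i)) ` {..<m} \<subseteq> A" using alternating_nth[OF assms(2)] m by auto
  then have "card ((\<lambda>i. w ! (2 * i)) ` {..<m}) \<le> card A" using assms(1) card_mono by blast
  moreover have "card A < card {..<m}" using assms(3,4) by (simp add: m_def)
  ultimately have "\<not> inj_on (\<lambda>i. w ! (2 * i)) {..<m}" using card_image by fastforce
  then obtain i j where "i < m" "j < m" "i \<noteq> j" "w ! (2 * i) = w ! (2 * j)" by (auto simp: inj_on_def)
  then obtain i j where ij: "i < j" "j < m" "w ! (2 * i) = w ! (2 * j)" by (metis linorder_neqE_nat)
  have jl: "2 * j < length w" using ij m by simp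
  define v where "v = take (2 * j) w"
  have v: "length v = 2 * j" "v ! (2 * i) = w ! (2 * i)" using jl ij by (simp_all add: v_def)
  have "w = v @ [w ! (2 * j)] @ drop (Suc (2 * j)) w" unfolding v_def using id_take_nth_drop[OF jl] by simp
  moreover have "v = take (2 * i) v @ [w ! (2 * i)] @ drop (Suc (2 * i)) v"
    using id_take_nth_drop[of "2 * i" v] v ij by simp
  ultimately have "w = take (2 * i) v @ [w ! (2 * j)] @ drop (Suc (2 * i)) v @ [w ! (2 * j)] @ drop (Suc (2 * j)) w"
    using ij by (metis append.assoc)
  moreover have "even (length (take (2 * i) v))" "odd (length (drop (Suc (2 * i)) v))"
    using v ij by simp_all
  ultimately show ?thesis using that by blast
qed

text \<open>Here \<open>A\<close> and \<open>B\<close> are finite alphabets, later taken from K+ and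
  K-; \<open>A\<close> is not the corner eRe. Products within one alphabet vanish because ef = fe =
  0, and \<open>u\<close> is e + f.\<close>

locale alternating_words = assoc_algebra scale
  for scale :: "'f::field \<Rightarrow> 'a::ring \<Rightarrow> 'a" +
  fixes A B :: "'a set" and u :: 'a
  assumes finite: "finite A" "finite B"
    and A_zero: "x \<in> A \<Longrightarrow> y \<in> A \<Longrightarrow> x * y = 0" and B_zero: "x \<in> B \<Longrightarrow> y \<in> B \<Longrightarrow> x * y = 0"
    and unit: "x \<in> A \<union> B \<Longrightarrow> u * x = x" "x \<in> A \<union> B \<Longrightarrow> x * u = x" "u * u = u"
    and two: "(2::'f) \<noteq> 0"
begin

lemma swap: "alternating_words scale B A u"
  using finite A_zero B_zero unit two by unfold_locales auto

definition word :: "'a list \<Rightarrow> 'a" where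
  "word w = foldr (*) w u"

lemma word_simps [simp]: "word [] = u" "word (x # w) = x * word w"
  by (simp_all add: word_def)

lemma u_word: "set w \<subseteq> A \<union> B \<Longrightarrow> u * word w = word w"
  by (cases w) (use unit in \<open>auto simp: mult.assoc[symmetric]\<close>)

lemma word_append: "set w \<subseteq> A \<union> B \<Longrightarrow> word (v @ w) = word v * word w"
  by (induction v) (auto simp: u_word mult.assoc)

lemma alternating_set: "alternating A B w \<or> alternating B A w \<Longrightarrow> set w \<subseteq> A \<union> B"
  by (induction w) auto

text \<open>For skew letters and odd length the involution sends \<open>word w\<close> to minus the
  reversed word, so \<open>pal w\<close> is \<open>word w\<close> minus its image, a skew
  element.\<close>

definition pal :: "'a list \<Rightarrow> 'a" where
  "pal w = word w + word (rev w)"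

lemma A_word: "alternating A B w \<Longrightarrow> odd (length w) \<Longrightarrow> x \<in> A \<Longrightarrow> x * word w = 0"
  by (cases w) (auto simp: mult.assoc[symmetric] A_zero)

lemma word_A:
  assumes "alternating A B w" "odd (length w)" "x \<in> A"
  shows "word w * x = 0"
proof (cases w rule: rev_cases)
  case Nil
  then show ?thesis using assms by simp
next
  case (snoc v y)
  then have y: "y \<in> A" using assms by (simp add: alternating_append)
  then have "word w = word v * (y * u)" using snoc word_append[of "[y]" v] by simp
  then show ?thesis using y assms unit A_zero by (simp add: mult.assoc)
qed

text \<open>Modulo \<open>L\<close>, exchanging the first and the last letter, or moving the first two letters to the end in
  reverse order, changes the sign of \<open>pal\<close>.  These moves generate the transpositions of neighbours among the
  letters in even positions (counted from 0), so \<open>pal\<close> vanishes modulo \<open>L\<close> when such a letter is repeated.\<close>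

lemma pal_swap_ends:
  assumes L: "lie_closed L" "x \<in> L" "y \<in> L" "pal v \<in> L"
    and v: "x \<in> A" "y \<in> A" "alternating B A v"
  shows "pal (x # v @ [y]) + pal (y # v @ [x]) \<in> L"
proof -
  let ?m = "pal v"
  have s: "set v \<subseteq> A \<union> B" using alternating_set v by blast
  have W: "word (v @ [z]) = word v * z" "word (rev v @ [z]) = word (rev v) * z" if "z \<in> A" for z
    using word_append[of "[z]"] that unit by simp_all
  have "commutator (commutator x ?m) y \<in> L" using L by (simp add: lie_closed_def)
  \<comment> \<open>Of the four terms of the double bracket, the two containing \<open>x * y\<close>
    or \<open>y * x\<close> vanish.\<close>
  moreover have "commutator (commutator x ?m) y = x * ?m * y + y * ?m * x"
  proof -
    have "?m * x * y = 0" "y * (x * ?m) = 0"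
      using A_zero v by (simp_all add: mult.assoc) (simp add: mult.assoc[symmetric] A_zero)
    then show ?thesis by (simp add: commutator_def algebra_simps)
  qed
  moreover have "\<dots> = pal (x # v @ [y]) + pal (y # v @ [x])"
    using v by (simp add: pal_def W algebra_simps)
  ultimately show ?thesis by simp
qed

lemma pal_rotate:
  assumes L: "lie_closed L" "x \<in> L" "y \<in> L" "pal v \<in> L"
    and v: "x \<in> A" "y \<in> B" "alternating A B v" "odd (length v)"
  shows "pal (x # y # v) + pal (v @ [y, x]) \<in> L"
proof -
  let ?m = "pal v"
  have v': "alternating A B (rev v)" "odd (length (rev v))" using alternating_rev_odd v by auto
  have W: "word (v @ [y, x]) = word v * (y * x)" "word (rev v @ [y, x]) = word (rev v) * (y * x)"
    using word_append[of "[y, x]"] v unit by simp_all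
  have "commutator (commutator x y) ?m \<in> L" using L by (simp add: lie_closed_def)
  \<comment> \<open>Both words in \<open>?m\<close> begin and end with letters of \<open>A\<close>,
    so the terms containing \<open>x * ?m\<close> or \<open>?m * x\<close> vanish.\<close>
  moreover have "commutator (commutator x y) ?m = x * y * ?m + ?m * y * x"
  proof -
    have "x * ?m = 0" "?m * x = 0"
      using A_word[OF v(3,4,1)] A_word[OF v' v(1)] word_A[OF v(3,4,1)] word_A[OF v' v(1)]
      by (simp_all add: pal_def distrib_left distrib_right)
    then have "y * (x * ?m) = 0" "?m * x * y = 0" by simp_all
    then show ?thesis by (simp add: commutator_def algebra_simps)
  qed
  moreover have "\<dots> = pal (x # y # v) + pal (v @ [y, x])"
    by (simp add: pal_def W algebra_simps)
  ultimately show ?thesis by simp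
qed

lemma pal_in_lie_closed_step:
  assumes L: "lie_closed L" and IH: "\<And>v. odd (length v) \<Longrightarrow> length v < length w \<Longrightarrow>
      alternating A B v \<or> alternating B A v \<Longrightarrow> pal v \<in> L"
    and w: "alternating A B w" "odd (length w)" "1 < length w" "2 * card A < length w"
  shows "pal w \<in> L"
proof -
  have sL: "subspace L" using L by (simp add: lie_closed_def)
  note diff = subspace_diff[OF sL]
  have comb: "a - b + c \<in> L" if "a \<in> L" "b \<in> L" "c \<in> L" for a b c
    using that by (simp add: subspace_add[OF sL] diff)
  have letter: "x \<in> L" if "x \<in> A \<union> B" for x
  proof -
    have "pal [x] \<in> L" using that w(3) by (intro IH) auto
    then show ?thesis using halve[OF two sL, of x] unit(2)[OF that] by (simp add: pal_def)
  qed
  have rot: "pal (x # y # v) + pal (v @ [y, x]) \<in> L"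
    if "alternating A B (x # y # v)" "length (x # y # v) = length w" for x y v
  proof -
    have "length w = Suc (Suc (length v))" using that by simp
    then have v: "odd (length v)" "length v < length w" using w(2) by simp_all
    have x: "x \<in> A" "y \<in> B" "alternating A B v" using that by simp_all
    then have "pal v \<in> L" using v IH by blast
    then show ?thesis using x v letter by (intro pal_rotate[OF L]) simp_all
  qed
  have ends: "pal (x # v @ [y]) + pal (y # v @ [x]) \<in> L"
    if "x \<in> A" "y \<in> A" "alternating B A v" "length (x # v @ [y]) = length w" for x y v
  proof -
    have "length w = Suc (Suc (length v))" using that by simp
    then have "odd (length v)" "length v < length w" using w(2) by simp_all
    then have "pal v \<in> L" using that IH by blast
    then show ?thesis using that letter by (intro pal_swap_ends[OF L]) simp_all
  qed
  \<comment> \<open>For empty \<open>p\<close>: rotate x and y to the end, exchange the end letters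
    z and x, rotate back; three sign changes amount to one. For longer \<open>p\<close> the first
    two letters are rotated away and brought back afterwards.\<close>
  have swap3: "pal (p @ [x, y, z] @ q) + pal (p @ [z, y, x] @ q) \<in> L"
    if "even (length p)" "alternating A B (p @ [x, y, z] @ q)" "length (p @ [x, y, z] @ q) = length w"
    for p x y z q
    using that
  proof (induction p arbitrary: q rule: induct_list012)
    case 1
    have "length w = length q + 3" using 1 by simp
    then have "even (length q)" using w(2) by simp
    have "pal (x # y # z # q) + pal ((z # q) @ [y, x]) \<in> L" using 1 by (intro rot) auto
    moreover have "pal (z # (q @ [y]) @ [x]) + pal (x # (q @ [y]) @ [z]) \<in> L"
      using 1 \<open>even (length q)\<close> by (intro ends) (simp_all add: alternating_append)
    moreover have "pal (z # y # x # q) + pal ((x # q) @ [y, z]) \<in> L" using 1 by (intro rot) auto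
    ultimately have "pal (x # y # z # q) + pal ((z # q) @ [y, x])
      - (pal (z # (q @ [y]) @ [x]) + pal (x # (q @ [y]) @ [z]))
      + (pal (z # y # x # q) + pal ((x # q) @ [y, z])) \<in> L" by (rule comb)
    then show ?case by simp
  next
    case (2 a)
    then show ?case by simp
  next
    case (3 a b p)
    have "length w = length p + length q + 5" using 3 by simp
    then have "even (length q)" using w(2) 3(3) by simp
    let ?v = "p @ [x, y, z] @ q" and ?v' = "p @ [z, y, x] @ q"
    have "pal (a # b # ?v) + pal (?v @ [b, a]) \<in> L" using 3(3-) by (intro rot) simp_all
    moreover have "pal (p @ [x, y, z] @ (q @ [b, a])) + pal (p @ [z, y, x] @ (q @ [b, a])) \<in> L"
      using 3(3-) \<open>even (length q)\<close> by (intro 3(1)) (simp_all add: alternating_append)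
    moreover have "pal (a # b # ?v') + pal (?v' @ [b, a]) \<in> L"
      using 3(3-) by (intro rot) (simp_all add: alternating_append)
    ultimately have "pal (a # b # ?v) + pal (?v @ [b, a])
      - (pal (p @ [x, y, z] @ (q @ [b, a])) + pal (p @ [z, y, x] @ (q @ [b, a])))
      + (pal (a # b # ?v') + pal (?v' @ [b, a])) \<in> L" by (rule comb)
    then show ?case by simp
  qed
  \<comment> \<open>The first \<open>x\<close> moves two places at a time towards the second until
    only one letter \<open>y\<close> separates them. Then \<open>swap3\<close> relates the word to
    itself, and 2 is invertible.\<close>
  have repeat: "pal (p @ [x] @ s @ [x] @ q) \<in> L"
    if "even (length p)" "odd (length s)" "alternating A B (p @ [x] @ s @ [x] @ q)"
      "length (p @ [x] @ s @ [x] @ q) = length w" for p x s q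
    using that
  proof (induction s arbitrary: p rule: induct_list012)
    case 1
    then show ?case by simp
  next
    case (2 y)
    then have "pal (p @ [x, y, x] @ q) + pal (p @ [x, y, x] @ q) \<in> L" by (intro swap3) auto
    then have "pal (p @ [x, y, x] @ q) \<in> L" by (rule halve[OF two sL])
    then show ?case by simp
  next
    case (3 y z s)
    have "pal (p @ [x, y, z] @ (s @ [x] @ q)) + pal (p @ [z, y, x] @ (s @ [x] @ q)) \<in> L"
      using 3(3-) by (intro swap3) simp_all
    moreover have "pal ((p @ [z, y]) @ [x] @ s @ [x] @ q) \<in> L"
      using 3(3-) by (intro 3(1)) (simp_all add: alternating_append)
    ultimately have "pal (p @ [x, y, z] @ (s @ [x] @ q)) + pal (p @ [z, y, x] @ (s @ [x] @ q))
      - pal ((p @ [z, y]) @ [x] @ s @ [x] @ q) \<in> L" by (rule diff)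
    then show ?case by simp
  qed
  obtain p x s q where "w = p @ [x] @ s @ [x] @ q" "even (length p)" "odd (length s)"
    using alternating_repetition[OF finite(1) w(1,2,4)] by blast
  then show ?thesis using repeat w by simp
qed

text \<open>A longer word exceeds both \<open>2 * card A\<close> and \<open>2 * card B\<close>, so a
  letter in even position repeats whichever alphabet comes first. The bound is symmetric so that one
  finite set serves both corners.\<close>

definition short_pals :: "'a set" where
  "short_pals = pal ` {w. set w \<subseteq> A \<union> B \<and> length w \<le> Suc (2 * (card A + card B)) \<and> odd (length w) \<and>
     (alternating A B w \<or> alternating B A w)}"

lemma finite_short_pals: "finite short_pals"
  unfolding short_pals_def
  by (rule finite_imageI, rule finite_subset[OF _ finite_lists_length_le[of "A \<union> B" "Suc (2 * (card A + card B))"]])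
    (use finite in auto)

text \<open>Words of both kinds go through one induction, since the inner word of
  \<open>pal_swap_ends\<close> starts in the other alphabet.\<close>

lemma pal_in_lie_hull:
  assumes "alternating A B w \<or> alternating B A w" "odd (length w)"
  shows "pal w \<in> lie_closed hull short_pals"
  using assms
proof (induction w rule: length_induct)
  case (1 w)
  interpret swapped: alternating_words scale B A u by (rule swap)
  show ?case
  proof (cases "length w \<le> Suc (2 * (card A + card B))")
    case True
    then have "pal w \<in> short_pals" unfolding short_pals_def using 1 alternating_set by blast
    then show ?thesis by (rule hull_inc)
  next
    case False
    have IH: "pal v \<in> lie_closed hull short_pals"
      if "odd (length v)" "length v < length w" "alternating A B v \<or> alternating B A v" for v
      using 1(1) that by blast
    from 1(2) show ?thesis
    proof
      assume "alternating A B w"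
      then show ?thesis using 1(3) False by (intro pal_in_lie_closed_step[OF lie_closed_hull IH]) simp_all
    next
      assume BA: "alternating B A w"
      show ?thesis
      proof (rule swapped.pal_in_lie_closed_step[OF lie_closed_hull])
        fix v assume "odd (length v)" "length v < length w" "alternating B A v \<or> alternating A B v"
        then show "pal v \<in> lie_closed hull short_pals" by (intro IH) auto
      qed (use BA 1(3) False in simp_all)
    qed
  qed
qed

section \<open>From words to the skew elements of a corner\<close>

lemma word_alternating_or_zero:
  assumes "set w \<subseteq> A \<union> B"
  shows "alternating A B w \<or> alternating B A w \<or> word w = 0"
  using assms
proof (induction w)
  case (Cons x w)
  show ?case
  proof (cases w)
    case Nil
    then show ?thesis using Cons.prems by auto
  next
    case (Cons y v)
    have "x * (y * word v) = 0" if "x \<in> A \<and> y \<in> A \<or> x \<in> B \<and> y \<in> B"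
      using that A_zero B_zero by (auto simp: mult.assoc[symmetric])
    then show ?thesis using Cons Cons.IH Cons.prems by auto
  qed
qed simp

lemma subalgebra_hull_words: "subalgebra hull (A \<union> B) \<subseteq> span (word ` {w. set w \<subseteq> A \<union> B})"
proof (rule subalgebra_hull_minimal)
  let ?W = "word ` {w. set w \<subseteq> A \<union> B}"
  have "x * y \<in> span ?W" if x: "x \<in> span ?W" and y: "y \<in> span ?W" for x y
  proof -
    have base: "v * w \<in> span ?W" if "v \<in> ?W" "w \<in> ?W" for v w
    proof -
      obtain v' where "v = word v'" "set v' \<subseteq> A \<union> B" using \<open>v \<in> ?W\<close> by blast
      moreover obtain w' where "w = word w'" "set w' \<subseteq> A \<union> B" using \<open>w \<in> ?W\<close> by blast
      moreover note vw = calculation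
      then have "v * w = word (v' @ w')" by (simp add: word_append)
      then show ?thesis using vw by (auto intro!: span_base)
    qed
    have "x * w \<in> span ?W" if w: "w \<in> ?W" for w
    proof -
      have "?W \<subseteq> {x. x * w \<in> span ?W}" using base[OF _ w] by blast
      then have "span ?W \<subseteq> {x. x * w \<in> span ?W}" by (rule span_minimal) (simp add: subspace_mult_right_vimage)
      then show ?thesis using x by blast
    qed
    then have "?W \<subseteq> {y. x * y \<in> span ?W}" by blast
    then have "span ?W \<subseteq> {y. x * y \<in> span ?W}" by (rule span_minimal) (simp add: subspace_mult_left_vimage)
    then show ?thesis using y by blast
  qed
  then show "subalgebra (span ?W)" by (simp add: subalgebra_def)
  show "A \<union> B \<subseteq> span ?W"
  proof
    fix x assume x: "x \<in> A \<union> B"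
    then have "x = word [x]" using unit by simp
    then have "x \<in> ?W" using x by (intro image_eqI[of _ _ "[x]"]) auto
    then show "x \<in> span ?W" by (rule span_base)
  qed
qed

lemma short_pals_swap: "alternating_words.short_pals B A u = short_pals"
proof -
  interpret swapped: alternating_words scale B A u by (rule swap)
  show ?thesis
    unfolding swapped.short_pals_def short_pals_def
    by (simp add: Un_commute add.commute disj_commute)
qed

lemma star_word:
  assumes star: "involution star" "star u = u" "\<And>x. x \<in> A \<union> B \<Longrightarrow> star x = - x" and w: "set w \<subseteq> A \<union> B"
  shows "star (word w) = (if even (length w) then word (rev w) else - word (rev w))"
  using w
proof (induction w)
  case (Cons x w)
  interpret star: Vector_Spaces.linear scale scale star using star(1) by (simp add: involution_def)
  have star_mult: "star (x * y) = star y * star x" for x y using star(1) by (simp add: involution_def)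
  have "word (rev w @ [x]) = word (rev w) * x" using Cons.prems word_append[of "[x]" "rev w"] unit by simp
  then show ?case using Cons star(3)[of x] by (simp add: star_mult)
qed (simp add: star)

lemma word_corner:
  assumes A: "A \<subseteq> corner p q" and w: "alternating A B w" "odd (length w)"
  shows "word w \<in> corner p q"
proof -
  have Apq: "p * x = x" "x * q = x" if "x \<in> A" for x using that A cornerD[of x p q] by auto
  obtain v b where vb: "w = v @ [b]" using w by (cases w rule: rev_cases) auto
  then have b: "b \<in> A" using w by (simp add: alternating_append)
  then have "word w * q = word w"
    using Apq[of b] vb word_append[of "[b]" v] unit by (simp add: mult.assoc)
  moreover obtain c v' where "w = c # v'" "c \<in> A" using w by (cases w) auto
  then have "p * word w = word w" using Apq[of c] by (simp add: mult.assoc[symmetric])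
  ultimately show ?thesis by (simp add: corner_def)
qed

lemma pal_skew_corner:
  assumes star: "involution star" "star u = u" "\<And>x. x \<in> A \<union> B \<Longrightarrow> star x = - x"
    and A: "A \<subseteq> corner p q" and w: "alternating A B w" "odd (length w)"
  shows "pal w \<in> corner p q" "star (pal w) = - pal w"
proof -
  interpret star: Vector_Spaces.linear scale scale star using star(1) by (simp add: involution_def)
  have r: "alternating A B (rev w)" "odd (length (rev w))" using alternating_rev_odd w by auto
  show "pal w \<in> corner p q"
    unfolding pal_def by (rule subspace_add[OF subspace_corner word_corner[OF A w] word_corner[OF A r]])
  have "set w \<subseteq> A \<union> B" using alternating_set w by blast
  then have "star (word w) = - word (rev w)" "star (word (rev w)) = - word w"
    using star_word[OF star, of w] star_word[OF star, of "rev w"] w by simp_all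
  then show "star (pal w) = - pal w" by (simp add: pal_def star.add)
qed

lemma skew_corner_in_lie_hull:
  assumes star: "involution star" "star u = u" "\<And>x. x \<in> A \<union> B \<Longrightarrow> star x = - x"
    and pq: "A \<subseteq> corner p q" "B \<subseteq> corner q p" "p * q = 0" "q * p = 0" "p * u = p"
    and k: "k \<in> corner p q" "star k = - k" "k \<in> subalgebra hull (A \<union> B)"
  shows "k \<in> lie_closed hull short_pals"
proof -
  interpret star: Vector_Spaces.linear scale scale star using star(1) by (simp add: involution_def)
  let ?L = "lie_closed hull short_pals"
  \<comment> \<open>\<psi> projects to the corner and then skew-symmetrizes. It is linear and sends
    \<open>k\<close> to \<open>k + k\<close>, so it suffices to evaluate it on words.\<close>
  define \<psi> where "\<psi> m = p * m * q - star (p * m * q)" for m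
  have "\<psi> (word w) \<in> ?L" if w: "set w \<subseteq> A \<union> B" for w
  proof -
    have zero: "\<psi> (word w) = 0" if "p * word w * q = 0" using that by (simp add: \<psi>_def star.zero)
    have B: "p * x = 0" "x * q = 0" if "x \<in> B" for x
    proof -
      have "q * x = x" "x * p = x" using that pq cornerD[of x q p] by auto
      then show "p * x = 0" "x * q = 0" using pq(3) mult.assoc[of p q x] mult.assoc[of x p q] by simp_all
    qed
    \<comment> \<open>A word starting in \<open>B\<close> is killed by \<open>p\<close> from the
      left and one ending in \<open>B\<close> by \<open>q\<close> from the right. Only odd words
      starting in \<open>A\<close> survive, and they give \<open>pal w\<close>.\<close>
    consider "w = []" | "alternating B A w" "w \<noteq> []" | "alternating A B w" "even (length w)" "w \<noteq> []"
      | "alternating A B w" "odd (length w)" | "word w = 0"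
      using word_alternating_or_zero[OF w] by blast
    then show ?thesis
    proof cases
      case 1
      then show ?thesis using zero pq subspace_0[OF subspace_lie_hull] by simp
    next
      case 2
      then obtain b v where "w = b # v" "b \<in> B" by (cases w) auto
      then have "p * word w * q = 0" using B[of b] by (simp add: mult.assoc[symmetric])
      then show ?thesis using zero subspace_0[OF subspace_lie_hull] by simp
    next
      case 3
      then obtain v b where vb: "w = v @ [b]" by (cases w rule: rev_cases) auto
      then have "b \<in> B" using 3 by (simp add: alternating_append)
      then have "p * word w * q = 0"
        using B[of b] vb word_append[of "[b]" v] unit by (simp add: mult.assoc)
      then show ?thesis using zero subspace_0[OF subspace_lie_hull] by simp
    next
      case 4
      then have "word w \<in> corner p q" by (rule word_corner[OF pq(1)])
      then have "\<psi> (word w) = pal w"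
        using cornerD[of "word w" p q] 4 star_word[OF star w] by (simp add: \<psi>_def pal_def)
      then show ?thesis using pal_in_lie_hull[of w] 4 by simp
    next
      case 5
      then show ?thesis using zero subspace_0[OF subspace_lie_hull] by simp
    qed
  qed
  then have "word ` {w. set w \<subseteq> A \<union> B} \<subseteq> {m. \<psi> m \<in> ?L}" by auto
  moreover have "subspace {m. \<psi> m \<in> ?L}"
  proof (rule subspaceI)
    show "0 \<in> {m. \<psi> m \<in> ?L}" using subspace_0[OF subspace_lie_hull] by (simp add: \<psi>_def star.zero)
    have "\<psi> (x + y) = \<psi> x + \<psi> y" for x y by (simp add: \<psi>_def star.add algebra_simps)
    then show "x + y \<in> {m. \<psi> m \<in> ?L}" if "x \<in> {m. \<psi> m \<in> ?L}" "y \<in> {m. \<psi> m \<in> ?L}" for x y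
      using that subspace_add[OF subspace_lie_hull] by simp
    have "\<psi> (scale c x) = scale c (\<psi> x)" for c x
      by (simp add: \<psi>_def star.scale scale_mult_left[symmetric] scale_mult_right[symmetric] scale_right_diff_distrib)
    then show "scale c x \<in> {m. \<psi> m \<in> ?L}" if "x \<in> {m. \<psi> m \<in> ?L}" for c x
      using that subspace_scale[OF subspace_lie_hull] by simp
  qed
  ultimately have "span (word ` {w. set w \<subseteq> A \<union> B}) \<subseteq> {m. \<psi> m \<in> ?L}" by (rule span_minimal)
  then have "\<psi> k \<in> ?L" using subsetD[OF subalgebra_hull_words k(3)] by blast
  then have "k + k \<in> ?L" using k cornerD[OF k(1)] by (simp add: \<psi>_def)
  then show ?thesis by (rule halve[OF two subspace_lie_hull])
qed

end

section \<open>Skew elements and the Peirce decomposition\<close>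

locale involution_idempotent = simple_with_idempotent scale e
  for scale :: "'f::field \<Rightarrow> 'a::ring \<Rightarrow> 'a" and e :: 'a +
  fixes star :: "'a \<Rightarrow> 'a"
  assumes fg: finitely_generated and inv: "involution star"
    and ef: "e * star e = 0" and fe: "star e * e = 0" and two: "(2::'f) \<noteq> 0"
begin

abbreviation "f \<equiv> star e"
abbreviation "u \<equiv> e + star e"

lemma linear_star: "Vector_Spaces.linear scale scale star"
  using inv by (simp add: involution_def)

lemma star_simps [simp]: "star (star x) = x" "star (x + y) = star x + star y" "star (x - y) = star x - star y"
  "star (- x) = - star x" "star 0 = 0" "star (scale c x) = scale c (star x)" "star (x * y) = star y * star x"
proof -
  interpret star: Vector_Spaces.linear scale scale star by (rule linear_star)
  show "star (star x) = x" "star (x + y) = star x + star y" "star (x - y) = star x - star y"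
    "star (- x) = - star x" "star 0 = 0" "star (scale c x) = scale c (star x)" "star (x * y) = star y * star x"
    using inv by (simp_all add: star.add star.diff star.neg star.zero star.scale involution_def)
qed

lemma ff: "f * f = f"
  using arg_cong[OF ee, of star] by simp

lemma uu: "u * u = u" "e * u = e" "u * e = e" "f * u = f" "u * f = f" "star u = u"
  by (simp_all add: distrib_left distrib_right ee ff ef fe add.commute)

lemma u_nz: "u \<noteq> 0"
  using uu(2) e_nz by (metis mult_zero_right)

lemma star_corner: "x \<in> corner p q \<Longrightarrow> star x \<in> corner (star q) (star p)"
  unfolding corner_def by (auto simp flip: star_simps(7))

lemma corner_mult_zero:
  assumes "x \<in> corner p q" "y \<in> corner q' r" "q * q' = (0::'a)"
  shows "x * y = 0"
proof -
  have "x * y = (x * q) * (q' * y)" using assms by (simp add: corner_def)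
  also have "\<dots> = x * (q * q') * y" by (simp add: mult.assoc)
  finally show ?thesis using assms(3) by simp
qed

section \<open>Peirce components and the Lie ideal generated by the products\<close>

definition "K = skew_elements star"
definition "D = commutator_span K K"
definition "Kp = corner e f \<inter> K"
definition "Km = corner f e \<inter> K"
definition "A = corner e e"
text \<open>This is uR(1 - u), expressed by equations.\<close>

definition "P = {p. u * p = p \<and> p * u = 0}"
definition "products = {k * l | k l. k \<in> Kp \<and> l \<in> Km}"

lemma K_iff: "x \<in> K \<longleftrightarrow> star x = - x"
  by (simp add: K_def skew_elements_def)

lemma subspace_D: "subspace D"
  by (simp add: D_def commutator_span_def)

lemma commutator_D: "x \<in> K \<Longrightarrow> y \<in> K \<Longrightarrow> commutator x y \<in> D"
  unfolding D_def commutator_span_def by (rule span_base) blast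

lemma KpD: "k \<in> Kp \<Longrightarrow> e * k = k" "k \<in> Kp \<Longrightarrow> k * f = k" "k \<in> Kp \<Longrightarrow> star k = - k"
  and KmD: "l \<in> Km \<Longrightarrow> f * l = l" "l \<in> Km \<Longrightarrow> l * e = l" "l \<in> Km \<Longrightarrow> star l = - l"
  and AD: "a \<in> A \<Longrightarrow> e * a = a" "a \<in> A \<Longrightarrow> a * e = a"
  by (auto simp: Kp_def Km_def A_def corner_def K_iff)

lemma A_mult: "a \<in> A \<Longrightarrow> b \<in> A \<Longrightarrow> a * b \<in> A"
  unfolding A_def by (rule corner_mult)

lemma subspace_A: "subspace A" and subalgebra_A: "subalgebra A" and e_A: "e \<in> A"
  using ee by (simp_all add: A_def subalgebra_corner) (simp add: corner_def)

lemma Kp_corner: "k \<in> Kp \<Longrightarrow> k \<in> corner e f" and Km_corner: "l \<in> Km \<Longrightarrow> l \<in> corner f e"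
  by (simp_all add: Kp_def Km_def)

lemma star_A: "a \<in> A \<Longrightarrow> star a \<in> corner f f"
  unfolding A_def by (rule star_corner)

lemma products_A: "products \<subseteq> A"
  unfolding products_def A_def using corner_mult Kp_corner Km_corner by blast

text \<open>The element is [a - a*, k]: the other two terms vanish because fe = 0. In
  \<open>act_Km\<close> the bracket with l appears up to sign.\<close>

lemma act_Kp: "a \<in> A \<Longrightarrow> k \<in> Kp \<Longrightarrow> a * k + k * star a \<in> Kp"
  using corner_mult[of a e e k e f] corner_mult[of k e f "star a" f f] star_A[of a] Kp_corner[of k]
  by (auto simp: Kp_def A_def K_iff intro: subspace_add[OF subspace_corner])

lemma act_Km: "a \<in> A \<Longrightarrow> l \<in> Km \<Longrightarrow> star a * l + l * a \<in> Km"
  using corner_mult[of l f e a e e] corner_mult[of "star a" f f l f e] star_A[of a] Km_corner[of l]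
  by (auto simp: Km_def A_def K_iff intro: subspace_add[OF subspace_corner])

lemma commutator_products:
  assumes "a \<in> A" "x \<in> products"
  shows "commutator a x \<in> subalgebra hull products"
proof -
  obtain k l where kl: "x = k * l" "k \<in> Kp" "l \<in> Km" using assms by (auto simp: products_def)
  have "commutator a x = (a * k + k * star a) * l - k * (star a * l + l * a)"
    unfolding kl commutator_def by (simp add: algebra_simps)
  moreover have "(a * k + k * star a) * l \<in> products" "k * (star a * l + l * a) \<in> products"
    using act_Kp act_Km assms kl unfolding products_def by blast+
  then have "(a * k + k * star a) * l \<in> subalgebra hull products" "k * (star a * l + l * a) \<in> subalgebra hull products"
    by (simp_all add: hull_inc)
  ultimately show ?thesis
    using subalgebra_hull[of products] by (simp add: subalgebra_def subspace_diff)
qed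

lemma dichotomy:
  "A \<subseteq> subalgebra hull products \<or> (\<forall>x\<in>products. \<forall>a\<in>A. x * a = a * x)"
proof -
  have "A \<subseteq> subalgebra hull products \<or> (\<forall>x\<in>subalgebra hull products. \<forall>a\<in>A. x * a = a * x)"
    unfolding A_def
  proof (rule subalgebra_lie_ideal_corner[OF two subalgebra_hull])
    show "subalgebra hull products \<subseteq> corner e e"
      by (rule subalgebra_hull_minimal[OF subalgebra_corner]) (use products_A in \<open>simp add: A_def\<close>)
    show "commutator a t \<in> subalgebra hull products" if "a \<in> corner e e" "t \<in> subalgebra hull products" for a t
      by (rule commutator_subalgebra_hull[OF commutator_products that(2)]) (use that in \<open>simp_all add: A_def\<close>)
  qed
  moreover have "x \<in> subalgebra hull products" if "x \<in> products" for x using that by (rule hull_inc)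
  ultimately show ?thesis by meson
qed

text \<open>R is spanned by products r h s with h in A and finitely many r and s, so it is
  finite-dimensional along with A, and a basis of \<open>D\<close> generates.\<close>

lemma finite_dimensional_case:
  assumes "finite B" "A \<subseteq> span B"
  shows "\<exists>X. finite X \<and> X \<subseteq> D \<and> D \<subseteq> lie_closed hull X"
proof -
  obtain G Rs Ss where G: "finite G" "finite Rs" "finite Ss" "G \<subseteq> corner e e"
    and "corner e e \<subseteq> subalgebra hull G"
    and gen: "\<And>x. x \<in> span {r * h * s | r h s. r \<in> Rs \<and> h \<in> subalgebra hull G \<and> s \<in> Ss}"
    and "\<And>x. e * x \<in> span {h * s | h s. h \<in> corner e e \<and> s \<in> Ss}"
    by (rule corner_generation[OF fg e_nz ee]) (rule that)
  define H where "H = subalgebra hull G"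
  have HA: "H \<subseteq> A" unfolding H_def A_def by (rule subalgebra_hull_minimal[OF subalgebra_corner G(4)])
  let ?T = "(\<lambda>(r, b, s). r * b * s) ` (Rs \<times> B \<times> Ss)"
  have "r * h * s \<in> span ?T" if "r \<in> Rs" "h \<in> H" "s \<in> Ss" for r h s
  proof -
    have "B \<subseteq> {h. h * s \<in> {x. r * x \<in> span ?T}}"
    proof
      fix b assume "b \<in> B"
      then have "r * b * s \<in> ?T" using that by force
      then show "b \<in> {h. h * s \<in> {x. r * x \<in> span ?T}}" by (simp add: span_base mult.assoc)
    qed
    then have "span B \<subseteq> {h. h * s \<in> {x. r * x \<in> span ?T}}"
      by (rule span_minimal) (intro subspace_mult_right_vimage subspace_mult_left_vimage subspace_span)
    then have "h \<in> {h. h * s \<in> {x. r * x \<in> span ?T}}" using that HA assms(2) by blast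
    then show ?thesis by (simp add: mult.assoc)
  qed
  then have "{r * h * s | r h s. r \<in> Rs \<and> h \<in> H \<and> s \<in> Ss} \<subseteq> span ?T" by blast
  then have "span {r * h * s | r h s. r \<in> Rs \<and> h \<in> H \<and> s \<in> Ss} \<subseteq> span ?T" by (rule span_minimal) simp
  then have all: "x \<in> span ?T" for x using gen[of x] unfolding H_def by blast
  obtain X where X: "X \<subseteq> D" "independent X" "D \<subseteq> span X" "card X = dim D"
    by (rule basis_exists)
  have "finite ?T" using G assms(1) by simp
  then have "finite X" using independent_span_bound[of ?T X] X(2) all by auto
  moreover have "span X \<subseteq> lie_closed hull X" by (rule span_minimal) (simp_all add: hull_subset)
  ultimately show ?thesis using X by (intro exI[of _ X]) (simp add: order_trans)
qed

text \<open>The skew element e - f acts on K+ as 2 and on K- as -2, so all their elements are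
  brackets up to the factor 2.\<close>

lemma Kp_subset_D: "Kp \<subseteq> D" and Km_subset_D: "Km \<subseteq> D"
proof -
  have h: "e - f \<in> K" by (simp add: K_iff)
  show "Kp \<subseteq> D"
  proof
    fix k assume k: "k \<in> Kp"
    then have kz: "f * k = 0" "k * e = 0"
      using KpD[OF k] ef fe mult.assoc[of f e k] mult.assoc[of k f e] by simp_all
    have "commutator (e - f) k \<in> D" using commutator_D[OF h, of k] k by (simp add: Kp_def)
    then have "k + k \<in> D" using KpD[OF k] kz by (simp add: commutator_def algebra_simps)
    then show "k \<in> D" by (rule halve[OF two subspace_D])
  qed
  show "Km \<subseteq> D"
  proof
    fix k assume k: "k \<in> Km"
    then have kz: "e * k = 0" "k * f = 0"
      using KmD[OF k] ef fe mult.assoc[of e f k] mult.assoc[of k e f] by simp_all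
    have "commutator (f - e) k \<in> D" using commutator_D[of "f - e" k] k by (simp add: Km_def K_iff)
    then have "k + k \<in> D" using KmD[OF k] kz by (simp add: commutator_def algebra_simps)
    then show "k \<in> D" by (rule halve[OF two subspace_D])
  qed
qed

lemma PD: "p \<in> P \<Longrightarrow> u * p = p" "p \<in> P \<Longrightarrow> p * u = 0" "p \<in> P \<Longrightarrow> star p * u = star p" "p \<in> P \<Longrightarrow> u * star p = 0"
proof -
  assume p: "p \<in> P"
  show 1: "u * p = p" "p * u = 0" using p by (simp_all add: P_def)
  show "star p * u = star p" "u * star p = 0"
    using arg_cong[OF 1(1), of star] arg_cong[OF 1(2), of star] uu(6) by (simp_all del: star_simps(2))
qed

lemma commutator_P:
  assumes m: "m \<in> corner u u" "star m = - m" and p: "p \<in> P"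
  shows "commutator m (p - star p) = m * p - star (m * p)"
proof -
  have "m * star p = 0" "p * m = 0"
    using cornerD[OF m(1)] PD[OF p] mult.assoc[of m u "star p"] mult.assoc[of p u m] by simp_all
  then show ?thesis using m(2) by (simp add: commutator_def algebra_simps)
qed

lemma mult_P: "m \<in> corner u u \<Longrightarrow> p \<in> P \<Longrightarrow> m * p \<in> P"
  using cornerD(1)[of m u u] mult.assoc[of u m p] mult.assoc[of m p u] by (simp add: P_def)

text \<open>With h = e - f one has h h = u, so bracketing h with the skew part of hp gives back p -
  p*.\<close>

lemma P_subset_D: "p \<in> P \<Longrightarrow> p - star p \<in> D"
proof -
  assume p: "p \<in> P"
  let ?h = "e - f"
  have h: "?h \<in> corner u u" "star ?h = - ?h" "?h * ?h = u"
    by (simp_all add: corner_def uu(2-5) right_diff_distrib left_diff_distrib ee ff ef fe)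
  have q: "?h * p \<in> P" using mult_P[OF h(1) p] .
  have "?h * (?h * p) = p" using h(3) PD(1)[OF p] by (simp add: mult.assoc[symmetric])
  then have "commutator ?h (?h * p - star (?h * p)) = p - star p" using commutator_P[OF h(1,2) q] by simp
  moreover have "?h * p - star (?h * p) \<in> K" by (simp add: K_iff)
  then have "commutator ?h (?h * p - star (?h * p)) \<in> D" using h by (intro commutator_D) (simp_all add: K_iff)
  ultimately show ?thesis by simp
qed

text \<open>This generating set is usually infinite; \<open>generated_case\<close> cuts it down to a
  finite one.\<close>

definition "skew_gens = Kp \<union> Km \<union> (\<lambda>p. p - star p) ` P"
definition "skew_lie = lie_closed hull skew_gens"

lemma subspace_skew_lie: "subspace skew_lie"
  by (simp add: skew_lie_def)

lemma commutator_skew_lie: "x \<in> skew_lie \<Longrightarrow> y \<in> skew_lie \<Longrightarrow> commutator x y \<in> skew_lie"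
  unfolding skew_lie_def by (rule commutator_lie_hull)

lemma skew_gens_lie: "Kp \<subseteq> skew_lie" "Km \<subseteq> skew_lie" "p \<in> P \<Longrightarrow> p - star p \<in> skew_lie"
  unfolding skew_lie_def using hull_subset[of skew_gens lie_closed] by (auto simp: skew_gens_def)

lemma A_corner_u: "a \<in> A \<Longrightarrow> a \<in> corner u u" "a \<in> A \<Longrightarrow> star a \<in> corner u u"
proof -
  assume a: "a \<in> A"
  have "u * (e * a) = e * a" "a * e * u = a * e" using uu(2,3) by (simp_all add: mult.assoc) (simp_all add: mult.assoc[symmetric] uu)
  then show 1: "a \<in> corner u u" using AD[OF a] by (simp add: corner_def)
  show "star a \<in> corner u u" using star_corner[OF 1] uu(6) by metis
qed

text \<open>\<open>a - star a\<close> preserves each of the three kinds of generators and acts as a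
  derivation. It is not claimed to lie in \<open>skew_lie\<close>.\<close>

lemma normalizer:
  assumes a: "a \<in> A" and x: "x \<in> skew_lie"
  shows "commutator (a - star a) x \<in> skew_lie"
proof -
  have "commutator (a - star a) y \<in> lie_closed hull skew_gens" if "y \<in> skew_gens" for y
  proof -
    consider "y \<in> Kp" | "y \<in> Km" | p where "p \<in> P" "y = p - star p" using \<open>y \<in> skew_gens\<close> by (auto simp: skew_gens_def)
    then have "commutator (a - star a) y \<in> skew_lie"
    proof cases
      case 1
      have "star a * y = 0" "y * a = 0"
        using corner_mult_zero[OF star_A[OF a] Kp_corner[OF 1] fe]
          corner_mult_zero[OF Kp_corner[OF 1] a[unfolded A_def] fe] by simp_all
      then have "commutator (a - star a) y = a * y + y * star a" by (simp add: commutator_def algebra_simps)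
      then show ?thesis using act_Kp[OF a 1] skew_gens_lie by auto
    next
      case 2
      have "a * y = 0" "y * star a = 0"
        using corner_mult_zero[OF a[unfolded A_def] Km_corner[OF 2] ef]
          corner_mult_zero[OF Km_corner[OF 2] star_A[OF a] ef] by simp_all
      then have "commutator (a - star a) y = - (star a * y + y * a)" by (simp add: commutator_def algebra_simps)
      moreover have "star a * y + y * a \<in> skew_lie" using act_Km[OF a 2] skew_gens_lie by auto
      ultimately show ?thesis by (simp only: subspace_neg[OF subspace_skew_lie])
    next
      case 3
      have m: "a - star a \<in> corner u u" using A_corner_u[OF a] by (intro subspace_diff[OF subspace_corner])
      have "star (a - star a) = - (a - star a)" by simp
      then have "commutator (a - star a) y = (a - star a) * p - star ((a - star a) * p)"
        unfolding 3(2) by (rule commutator_P[OF m _ 3(1)])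
      then show ?thesis using skew_gens_lie(3)[OF mult_P[OF m 3(1)]] by simp
    qed
    then show ?thesis by (simp add: skew_lie_def)
  qed
  then show ?thesis using commutator_lie_hull_derivation[of skew_gens "a - star a" x] x unfolding skew_lie_def by simp
qed

text \<open>By [xy, a] = [x, ya] + [y, ax] the good x form a subalgebra \<open>T\<close>, so
  products suffice. For them [kl, a] is a difference of products, and the skew part of a product kl
  is the bracket [k, l].\<close>

lemma commutator_A_skew_lie:
  assumes gen: "A \<subseteq> subalgebra hull products" and ab: "a \<in> A" "b \<in> A"
  shows "commutator a b - star (commutator a b) \<in> skew_lie"
proof -
  define T where "T = {x \<in> A. \<forall>a\<in>A. commutator x a - star (commutator x a) \<in> skew_lie}"
  have diff_star: "(p - q) - star (p - q) = (p - star p) - (q - star q)" for p q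
    by (simp add: algebra_simps)
  have "x * y \<in> T" if xy: "x \<in> T" "y \<in> T" for x y
  proof -
    have A: "x \<in> A" "y \<in> A" using xy by (simp_all add: T_def)
    have "commutator (x * y) a - star (commutator (x * y) a) \<in> skew_lie" if a: "a \<in> A" for a
    proof -
      have "commutator x (y * a) - star (commutator x (y * a)) \<in> skew_lie"
        "commutator y (a * x) - star (commutator y (a * x)) \<in> skew_lie"
        using xy A_mult[OF A(2) a] A_mult[OF a A(1)] by (simp_all add: T_def)
      from subspace_add[OF subspace_skew_lie this]
      show ?thesis by (simp add: commutator_def algebra_simps)
    qed
    then show ?thesis using A_mult[OF A] by (simp add: T_def)
  qed
  moreover have "subspace T"
  proof (rule subspaceI)
    show "0 \<in> T" using subspace_0[OF subspace_A] subspace_0[OF subspace_skew_lie] by (simp add: T_def)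
    fix x assume x: "x \<in> T"
    show "scale c x \<in> T" for c
    proof -
      have "commutator (scale c x) a - star (commutator (scale c x) a) =
          scale c (commutator x a - star (commutator x a))" for a
        by (simp only: commutator_scale_left star_simps scale_right_diff_distrib)
      then show ?thesis using x subspace_scale[OF subspace_skew_lie] subspace_scale[OF subspace_A] by (simp add: T_def)
    qed
    fix y assume y: "y \<in> T"
    have "commutator (x + y) a - star (commutator (x + y) a) =
        (commutator x a - star (commutator x a)) + (commutator y a - star (commutator y a))" for a
      by (simp add: commutator_add_left)
    then show "x + y \<in> T" using x y subspace_add[OF subspace_skew_lie] subspace_add[OF subspace_A] by (simp add: T_def)
  qed
  ultimately have "subalgebra T" by (simp add: subalgebra_def)
  moreover have "products \<subseteq> T"
  proof
    fix x assume x: "x \<in> products"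
    have kl: "k * l - star (k * l) \<in> skew_lie" if "k \<in> Kp" "l \<in> Km" for k l
    proof -
      have "commutator k l \<in> skew_lie" using that skew_gens_lie by (intro commutator_skew_lie) auto
      then show ?thesis using KpD(3)[OF that(1)] KmD(3)[OF that(2)] by (simp add: commutator_def)
    qed
    obtain k l where x': "x = k * l" "k \<in> Kp" "l \<in> Km" using x by (auto simp: products_def)
    have "commutator x a - star (commutator x a) \<in> skew_lie" if a: "a \<in> A" for a
    proof -
      let ?l = "star a * l + l * a" and ?k = "a * k + k * star a"
      have "commutator x a = k * ?l - ?k * l"
        unfolding x' commutator_def by (simp add: algebra_simps)
      then have "commutator x a - star (commutator x a) = (k * ?l - star (k * ?l)) - (?k * l - star (?k * l))"
        using diff_star by (simp only:)
      then show ?thesis using kl[OF x'(2) act_Km[OF a x'(3)]] kl[OF act_Kp[OF a x'(2)] x'(3)]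
        by (simp only: subspace_diff[OF subspace_skew_lie])
    qed
    then show "x \<in> T" using x products_A by (auto simp: T_def)
  qed
  ultimately have "subalgebra hull products \<subseteq> T" by (rule subalgebra_hull_minimal)
  then have "a \<in> T" using gen ab by (meson subsetD)
  then show ?thesis using ab by (simp add: T_def)
qed

text \<open>A and its image under the involution annihilate each other, so a \<mapsto> a - a* is a
  Lie homomorphism on A.\<close>

lemma commutator_A_skew:
  assumes a: "a \<in> A" and b: "b \<in> A"
  shows "commutator (a - star a) (b - star b) = commutator a b - star (commutator a b)"
proof -
  have "a * star b = 0" "b * star a = 0" "star a * b = 0" "star b * a = 0"
    using corner_mult_zero[OF a[unfolded A_def] star_A[OF b] ef] corner_mult_zero[OF b[unfolded A_def] star_A[OF a] ef]
      corner_mult_zero[OF star_A[OF a] b[unfolded A_def] fe] corner_mult_zero[OF star_A[OF b] a[unfolded A_def] fe]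
    by simp_all
  then show ?thesis by (simp add: commutator_def algebra_simps)
qed

text \<open>Elements \<open>a - star a\<close> may lie outside \<open>skew_lie\<close>, so K is only
  shown to be contained in this sum.\<close>

definition "skew_sum = {a - star a + y | a y. a \<in> A \<and> y \<in> skew_lie}"

lemma subspace_skew_sum: "subspace skew_sum"
proof (rule subspaceI)
  have "0 - star 0 + 0 \<in> skew_sum"
    unfolding skew_sum_def using subspace_0[OF subspace_A] subspace_0[OF subspace_skew_lie] by blast
  then show "0 \<in> skew_sum" by simp
next
  fix x y assume "x \<in> skew_sum" "y \<in> skew_sum"
  then obtain a y1 b y2 where *: "x = a - star a + y1" "y = b - star b + y2"
    "a \<in> A" "b \<in> A" "y1 \<in> skew_lie" "y2 \<in> skew_lie" unfolding skew_sum_def by blast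
  have "x + y = (a + b) - star (a + b) + (y1 + y2)" by (simp add: *)
  moreover have "a + b \<in> A" "y1 + y2 \<in> skew_lie" using * by (simp_all add: subspace_add[OF subspace_A] subspace_add[OF subspace_skew_lie])
  ultimately show "x + y \<in> skew_sum" unfolding skew_sum_def by blast
next
  fix c x assume "x \<in> skew_sum"
  then obtain a y1 where *: "x = a - star a + y1" "a \<in> A" "y1 \<in> skew_lie" unfolding skew_sum_def by blast
  have "scale c x = scale c a - star (scale c a) + scale c y1" by (simp add: * scale_right_distrib scale_right_diff_distrib)
  moreover have "scale c a \<in> A" "scale c y1 \<in> skew_lie" using * by (simp_all add: subspace_scale[OF subspace_A] subspace_scale[OF subspace_skew_lie])
  ultimately show "scale c x \<in> skew_sum" unfolding skew_sum_def by blast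
qed

lemma skew_lie_sum: "y \<in> skew_lie \<Longrightarrow> y \<in> skew_sum" and A_skew_sum: "a \<in> A \<Longrightarrow> a - star a \<in> skew_sum"
proof -
  assume y: "y \<in> skew_lie"
  have "0 - star 0 + y \<in> skew_sum" unfolding skew_sum_def using subspace_0[OF subspace_A] y by blast
  then show "y \<in> skew_sum" by simp
next
  assume "a \<in> A"
  then have "a - star a + 0 \<in> skew_sum" unfolding skew_sum_def using subspace_0[OF subspace_skew_lie] by blast
  then show "a - star a \<in> skew_sum" by simp
qed

text \<open>The skew elements in the Peirce component of \<open>1 - u\<close>, which need not belong to \<open>R\<close>, are spanned by
  the elements \<open>ba - (ba)\<^sup>*\<close> that arise from brackets of the other components.\<close>

lemma outer_skew_sum:
  assumes "u * k = 0" "k * u = 0" "star k = - k"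
  shows "k \<in> skew_sum"
proof -
  \<comment> \<open>\<open>g x\<close> is (1 - u) x (1 - u).\<close>
  define g where "g x = x - u * x - x * u + u * x * u" for x
  have lin: "g (x + y) = g x + g y" "g (scale c x) = scale c (g x)" "g 0 = 0" for x y c
    unfolding g_def by (simp_all only: scale_right_distrib scale_right_diff_distrib scale_mult_left[symmetric] scale_mult_right[symmetric])
      (simp_all add: algebra_simps)
  have "g (r * e * s) - star (g (r * e * s)) \<in> skew_sum" for r s
  proof -
    \<comment> \<open>With b = (1 - u) r e and a = e s (1 - u), the product ba is g(res), while ab
      lies in A and both a and b* lie in P. The bracket of a - a* with b* - b is the skew part of ba
      minus that of ab.\<close>
    define b where "b = r * e - u * (r * e)"
    define a where "a = e * s - e * s * u"
    have ue: "u * (e * x) = e * x" for x using uu(3) mult.assoc[of u e x] by simp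
    have eu: "e * (u * x) = e * x" for x using uu(2) mult.assoc[of e u x] by simp
    have aP: "a \<in> P" unfolding P_def a_def
      using ue uu(1) by (simp add: right_diff_distrib left_diff_distrib mult.assoc)
    have ub: "u * b = 0" unfolding b_def using uu(1) mult.assoc[of u u "r * e"] by (simp add: right_diff_distrib)
    have be: "b * e = b" unfolding b_def using ee by (simp add: left_diff_distrib mult.assoc)
    have bu: "b * u = b" using be uu(2) mult.assoc[of b e u] by simp
    have ea: "e * a = a" unfolding a_def using ee by (simp add: right_diff_distrib mult.assoc[symmetric])
    have cP: "star b \<in> P"
      using arg_cong[OF bu, of star] arg_cong[OF ub, of star] uu(6) unfolding P_def by (simp del: star_simps(2))
    have ba: "b * a = g (r * e * s)"
      unfolding b_def a_def g_def using ee
      by (simp add: algebra_simps) (simp add: mult.assoc[symmetric] ee)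
    have abA: "a * b \<in> A" using ea be mult.assoc[of e a b] mult.assoc[of a b e] by (simp add: A_def corner_def)
    have zero: "a * star b = 0" "star a * b = 0" "star b * a = 0" "b * star a = 0"
      using PD[OF aP] PD[OF cP] bu ub
        mult.assoc[of a u "star b"] mult.assoc[of "star a" u b] mult.assoc[of "star b" u a] mult.assoc[of b u "star a"]
      by simp_all
    have "commutator (a - star a) (star b - star (star b)) \<in> skew_lie"
      by (rule commutator_skew_lie[OF skew_gens_lie(3)[OF aP] skew_gens_lie(3)[OF cP]])
    moreover have "commutator (a - star a) (star b - star (star b)) =
        (b * a - star (b * a)) - (a * b - star (a * b))"
      using zero by (simp add: commutator_def algebra_simps)
    ultimately have "(b * a - star (b * a)) - (a * b - star (a * b)) \<in> skew_sum" using skew_lie_sum by simp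
    from subspace_add[OF subspace_skew_sum this A_skew_sum[OF abA]]
    show ?thesis by (simp add: ba)
  qed
  then have "{r * e * s | r s. True} \<subseteq> {x. g x - star (g x) \<in> skew_sum}" by blast
  moreover have "subspace {x. g x - star (g x) \<in> skew_sum}"
  proof (rule subspaceI)
    show "0 \<in> {x. g x - star (g x) \<in> skew_sum}" using subspace_0[OF subspace_skew_sum] by (simp add: lin)
    fix x assume x: "x \<in> {x. g x - star (g x) \<in> skew_sum}"
    have "g (scale c x) - star (g (scale c x)) = scale c (g x - star (g x))" for c
      by (simp add: lin scale_right_diff_distrib)
    then show "scale c x \<in> {x. g x - star (g x) \<in> skew_sum}" for c using x subspace_scale[OF subspace_skew_sum] by simp
    fix y assume y: "y \<in> {x. g x - star (g x) \<in> skew_sum}"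
    have "g (x + y) - star (g (x + y)) = (g x - star (g x)) + (g y - star (g y))" by (simp add: lin)
    then show "x + y \<in> {x. g x - star (g x) \<in> skew_sum}" using x y subspace_add[OF subspace_skew_sum] by simp
  qed
  ultimately have "span {r * e * s | r s. True} \<subseteq> {x. g x - star (g x) \<in> skew_sum}" by (rule span_minimal)
  then have "g k - star (g k) \<in> skew_sum" using span_two_sided[OF e_nz, of k] by blast
  then have "k + k \<in> skew_sum" using assms by (simp add: g_def mult.assoc)
  then show ?thesis by (rule halve[OF two subspace_skew_sum])
qed

lemma K_subset_skew_sum: "K \<subseteq> skew_sum"
proof
  fix k assume "k \<in> K"
  then have sk: "star k = - k" by (simp add: K_iff)
  \<comment> \<open>The pieces are p = uk(1 - u) and k0 = (1 - u)k(1 - u). As k is skew, (1 - u)ku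
    is - p*, and fkf is minus the image of eke.\<close>
  define p where "p = u * k - u * k * u"
  define k0 where "k0 = k - u * k - k * u + u * k * u"
  have 1: "e * k * e - star (e * k * e) \<in> skew_sum"
    by (rule A_skew_sum) (simp add: A_def corner_compress ee)
  have "e * k * f \<in> corner e f" by (rule corner_compress[OF ee ff])
  then have "e * k * f \<in> Kp" using sk by (simp add: Kp_def K_iff mult.assoc)
  then have 2: "e * k * f \<in> skew_sum" using skew_gens_lie skew_lie_sum by blast
  have "f * k * e \<in> corner f e" by (rule corner_compress[OF ff ee])
  then have "f * k * e \<in> Km" using sk by (simp add: Km_def K_iff mult.assoc)
  then have 3: "f * k * e \<in> skew_sum" using skew_gens_lie skew_lie_sum by blast
  have uuk: "u * (u * x) = u * x" for x using uu(1) mult.assoc[of u u x] by simp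
  have "p \<in> P" unfolding P_def p_def using uuk uu(1)
    by (simp add: right_diff_distrib left_diff_distrib mult.assoc)
  then have 4: "p - star p \<in> skew_sum" using skew_gens_lie skew_lie_sum by blast
  have su: "star (u * x) = star x * u" "star (x * u) = u * star x" for x by (simp_all only: star_simps(7) uu(6))
  have 5: "k0 \<in> skew_sum"
  proof (rule outer_skew_sum)
    show "u * k0 = 0" "k0 * u = 0" unfolding k0_def by (rule idempotent_outer[OF uu(1)])+
    have "star k0 = - k - (- k) * u - u * (- k) + u * (- k * u)"
      unfolding k0_def by (simp only: star_simps(2,3) su sk mult.assoc) 
    then show "star k0 = - k0" unfolding k0_def by (simp add: mult.assoc)
  qed
  have "k = ((e * k * e - star (e * k * e)) + e * k * f + f * k * e) + (p - star p) + k0"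
  proof -
    have "star p = - (k * u) + u * k * u" unfolding p_def by (simp only: star_simps(3) su sk mult.assoc) (simp add: mult.assoc)
    moreover have "u * k * u = (e * k * e - star (e * k * e)) + e * k * f + f * k * e"
      using sk by (simp add: algebra_simps)
    ultimately show ?thesis unfolding p_def k0_def by (simp only: algebra_simps) simp
  qed
  moreover have "((e * k * e - star (e * k * e)) + e * k * f + f * k * e) + (p - star p) + k0 \<in> skew_sum"
    by (intro subspace_add[OF subspace_skew_sum] 1 2 3 4 5)
  ultimately show "k \<in> skew_sum" by simp
qed

text \<open>Split both arguments along \<open>skew_sum\<close>. The bracket of the two A-parts needs
  \<open>gen\<close>; the mixed brackets only need that the A-parts normalize
  \<open>skew_lie\<close>.\<close>

lemma D_subset_skew_lie:
  assumes gen: "A \<subseteq> subalgebra hull products"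
  shows "D \<subseteq> skew_lie"
  unfolding D_def commutator_span_def
proof (rule span_minimal[OF _ subspace_skew_lie])
  have "commutator x y \<in> skew_lie" if xy: "x \<in> K" "y \<in> K" for x y
  proof -
    have "x \<in> skew_sum" "y \<in> skew_sum" using xy K_subset_skew_sum by blast+
    then obtain a x' b y' where *: "x = a - star a + x'" "y = b - star b + y'"
      "a \<in> A" "b \<in> A" "x' \<in> skew_lie" "y' \<in> skew_lie" unfolding skew_sum_def by blast
    have "commutator (a - star a) (b - star b) \<in> skew_lie"
      using commutator_A_skew_lie[OF gen *(3,4)] commutator_A_skew[OF *(3,4)] by simp
    moreover have "commutator (a - star a) y' \<in> skew_lie" by (rule normalizer[OF *(3,6)])
    moreover have "commutator x' (b - star b) \<in> skew_lie"
      using subspace_neg[OF subspace_skew_lie normalizer[OF *(4,5)]] commutator_minus_swap[of x' "b - star b"] by simp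
    moreover have "commutator x' y' \<in> skew_lie" by (rule commutator_skew_lie[OF *(5,6)])
    moreover have "commutator x y = (commutator (a - star a) (b - star b) + commutator (a - star a) y') +
        (commutator x' (b - star b) + commutator x' y')"
      unfolding *(1,2) commutator_add_left commutator_add_right by (simp add: algebra_simps)
    ultimately show ?thesis by (simp only: subspace_add[OF subspace_skew_lie])
  qed
  then show "{commutator a b | a b. a \<in> K \<and> b \<in> K} \<subseteq> skew_lie" by blast
qed

text \<open>The hull contains A by assumption, and it is stable under the involution, so it contains
  fRf. One nonzero element of K+ and one of K- then yield all of eRf and fRe, including the elements
  that are not skew.\<close>

lemma corner_u_generated:
  assumes gen: "A \<subseteq> subalgebra hull products"
  shows "corner u u \<subseteq> subalgebra hull (Kp \<union> Km)"
proof -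
  define S where "S = subalgebra hull (Kp \<union> Km)"
  have S: "subalgebra S" unfolding S_def by (rule subalgebra_hull)
  have sS: "subspace S" and mS: "\<And>x y. x \<in> S \<Longrightarrow> y \<in> S \<Longrightarrow> x * y \<in> S" using S by (auto simp: subalgebra_def)
  have KS: "Kp \<subseteq> S" "Km \<subseteq> S" unfolding S_def using hull_subset[of "Kp \<union> Km" subalgebra] by simp_all
  have "products \<subseteq> S" unfolding products_def using KS mS by blast
  then have "subalgebra hull products \<subseteq> S" by (rule subalgebra_hull_minimal[OF S])
  with gen have AS: "A \<subseteq> S" by (rule order_trans)
  have starS: "star x \<in> S" if "x \<in> S" for x
  proof -
    have "subalgebra {x. star x \<in> S}"
      unfolding subalgebra_def subspace_def
      using subspace_0[OF sS] subspace_add[OF sS] subspace_scale[OF sS] mS by simp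
    moreover have "Kp \<union> Km \<subseteq> {x. star x \<in> S}"
    proof
      fix x assume "x \<in> Kp \<union> Km"
      then have "x \<in> S" "star x = - x" using KS KpD(3) KmD(3) by auto
      then show "x \<in> {x. star x \<in> S}" using subspace_neg[OF sS] by simp
    qed
    ultimately have "subalgebra hull (Kp \<union> Km) \<subseteq> {x. star x \<in> S}" by (rule subalgebra_hull_minimal)
    then show ?thesis using that unfolding S_def[symmetric] by blast
  qed
  have fS: "x \<in> S" if "x \<in> corner f f" for x
  proof -
    have "star x \<in> A" using star_corner[OF that] by (simp add: A_def)
    then have "star x \<in> S" using AS by blast
    from starS[OF this] show ?thesis by simp
  qed
  \<comment> \<open>Otherwise the products would generate only 0, which does not contain e.\<close>
  have "\<exists>x\<in>products. x \<noteq> 0"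
  proof (rule ccontr)
    assume "\<not> ?thesis"
    then have "products \<subseteq> {0}" by blast
    then have "subalgebra hull products \<subseteq> {0}" by (rule subalgebra_hull_minimal[rotated]) (simp add: subalgebra_def)
    then show False using gen e_A e_nz by (meson singletonD subsetD)
  qed
  then obtain k l where kl: "k \<in> Kp" "l \<in> Km" "k * l \<noteq> 0" unfolding products_def by blast
  have k: "k \<in> corner e f" "k \<noteq> 0" and l: "l \<in> corner f e" "l \<noteq> 0" using kl Kp_corner Km_corner by auto
  have efS: "x \<in> S" if "x \<in> corner e f" for x
  proof -
    have "{a * k * b | a b. a \<in> corner e e \<and> b \<in> corner f f} \<subseteq> S" using AS fS KS kl mS unfolding A_def by blast
    then have "span {a * k * b | a b. a \<in> corner e e \<and> b \<in> corner f f} \<subseteq> S" by (rule span_minimal[OF _ sS])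
    then show ?thesis using corner_span[OF k(2,1) ee ee ff ff that] by blast
  qed
  have feS: "x \<in> S" if "x \<in> corner f e" for x
  proof -
    have "{a * l * b | a b. a \<in> corner f f \<and> b \<in> corner e e} \<subseteq> S" using AS fS KS kl mS unfolding A_def by blast
    then have "span {a * l * b | a b. a \<in> corner f f \<and> b \<in> corner e e} \<subseteq> S" by (rule span_minimal[OF _ sS])
    then show ?thesis using corner_span[OF l(2,1) ff ff ee ee that] by blast
  qed
  show ?thesis
  proof
    fix x assume "x \<in> corner u u"
    then have "x = u * x * u" using cornerD[of x u u] by simp
    then have x: "x = (e * x * e + e * x * f) + (f * x * e + f * x * f)" by (simp add: algebra_simps)
    have "e * x * e \<in> S" using corner_compress[OF ee ee, of x] AS unfolding A_def by blast
    moreover have "e * x * f \<in> S" "f * x * e \<in> S" "f * x * f \<in> S"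
      by (rule efS[OF corner_compress[OF ee ff]] feS[OF corner_compress[OF ff ee]] fS[OF corner_compress[OF ff ff]])+
    ultimately have "(e * x * e + e * x * f) + (f * x * e + f * x * f) \<in> S" by (simp only: subspace_add[OF sS])
    then show "x \<in> subalgebra hull (Kp \<union> Km)" using x unfolding S_def by simp
  qed
qed

lemma generated_case:
  assumes gen: "A \<subseteq> subalgebra hull products"
  shows "\<exists>X. finite X \<and> X \<subseteq> D \<and> D \<subseteq> lie_closed hull X"
proof -
  obtain G Rs Ss where G: "finite G" "finite Rs" "finite Ss" "G \<subseteq> corner u u"
    "corner u u \<subseteq> subalgebra hull G"
    and "\<And>x. x \<in> span {r * h * s | r h s. r \<in> Rs \<and> h \<in> subalgebra hull G \<and> s \<in> Ss}"
    and left: "\<And>x. u * x \<in> span {h * s | h s. h \<in> corner u u \<and> s \<in> Ss}"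
    by (rule corner_generation[OF fg u_nz uu(1)]) (rule that)
  have "G \<subseteq> subalgebra hull (Kp \<union> Km)" using G(4) corner_u_generated[OF gen] by (rule order_trans)
  then obtain T where T: "finite T" "T \<subseteq> Kp \<union> Km" "G \<subseteq> subalgebra hull T"
    using subalgebra_hull_finite_supports[OF G(1)] by meson
  define TA where "TA = T \<inter> Kp"
  define TB where "TB = T \<inter> Km"
  have TAB: "TA \<union> TB = T" using T by (auto simp: TA_def TB_def)
  have "subalgebra hull G \<subseteq> subalgebra hull T" by (rule subalgebra_hull_minimal[OF subalgebra_hull T(3)])
  then have uT: "corner u u \<subseteq> subalgebra hull (TA \<union> TB)" using G(5) unfolding TAB by (rule order_trans[rotated])
  have Kpu: "k \<in> corner u u" if "k \<in> Kp" for k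
    using KpD[OF that] uu(3,5) mult.assoc[of u e k] mult.assoc[of k f u] uu(2,4)
    by (metis (mono_tags, lifting) corner_def mem_Collect_eq)
  have Kmu: "k \<in> corner u u" if "k \<in> Km" for k
    using KmD[OF that] uu(3,5) mult.assoc[of u f k] mult.assoc[of k e u] uu(2,4)
    by (metis (mono_tags, lifting) corner_def mem_Collect_eq)
  have words: "alternating_words scale TA TB u"
  proof unfold_locales
    show "finite TA" "finite TB" using T by (simp_all add: TA_def TB_def)
    show "x * y = 0" if "x \<in> TA" "y \<in> TA" for x y
      using that corner_mult_zero[OF Kp_corner Kp_corner fe] by (simp add: TA_def)
    show "x * y = 0" if "x \<in> TB" "y \<in> TB" for x y
      using that corner_mult_zero[OF Km_corner Km_corner ef] by (simp add: TB_def)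
    show "u * x = x" "x * u = x" if "x \<in> TA \<union> TB" for x
      using that Kpu[of x] Kmu[of x] cornerD[of x u u] by (auto simp: TA_def TB_def)
    show "u * u = u" by (rule uu(1))
    show "(2::'f) \<noteq> 0" by (rule two)
  qed
  interpret words: alternating_words scale TA TB u by (rule words)
  interpret swapped: alternating_words scale TB TA u by (rule words.swap)
  have skew: "star x = - x" if "x \<in> TA \<union> TB" for x using that KpD(3) KmD(3) by (auto simp: TA_def TB_def)
  have TAc: "TA \<subseteq> corner e f" "TB \<subseteq> corner f e" by (auto simp: TA_def TB_def Kp_def Km_def)
  \<comment> \<open>These are the u s (1 - u) for the finitely many s that generate uR as a left
    module over uRu.\<close>
  define Pf where "Pf = (\<lambda>s. u * s - u * s * u) ` Ss"
  have PfP: "Pf \<subseteq> P"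
  proof -
    have "u * (u * x) = u * x" for x using uu(1) mult.assoc[of u u x] by simp
    then show ?thesis using uu(1) unfolding Pf_def P_def
      by (auto simp: right_diff_distrib left_diff_distrib mult.assoc simp del: distrib_left distrib_right)
  qed
  define X where "X = words.short_pals \<union> (\<lambda>p. p - star p) ` Pf"
  define L where "L = lie_closed hull X"
  have sL: "subspace L" by (simp add: L_def)
  have hull_L: "lie_closed hull words.short_pals \<subseteq> L" unfolding L_def by (rule hull_mono) (simp add: X_def)
  have KpL: "Kp \<subseteq> L"
  proof
    fix k assume k: "k \<in> Kp"
    have "k \<in> lie_closed hull words.short_pals"
      using skew by (rule words.skew_corner_in_lie_hull[OF inv uu(6) _ TAc ef fe uu(2) Kp_corner[OF k] KpD(3)[OF k]
          subsetD[OF uT Kpu[OF k]]])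
    then show "k \<in> L" using hull_L by (rule subsetD[rotated])
  qed
  have KmL: "Km \<subseteq> L"
  proof
    fix k assume k: "k \<in> Km"
    have "k \<in> lie_closed hull swapped.short_pals"
    proof (rule swapped.skew_corner_in_lie_hull[OF inv uu(6) _ TAc(2,1) fe ef uu(4) Km_corner[OF k] KmD(3)[OF k]])
      show "star x = - x" if "x \<in> TB \<union> TA" for x using that skew by blast
      show "k \<in> subalgebra hull (TB \<union> TA)" using subsetD[OF uT Kmu[OF k]] by (simp add: Un_commute)
    qed
    then show "k \<in> L" using hull_L unfolding words.short_pals_swap by (rule subsetD[rotated])
  qed
  have PL: "p - star p \<in> L" if p: "p \<in> P" for p
  proof -
    \<comment> \<open>Elements of uRu are not skew in general, so brackets do not act like them
      directly. But for k in K+ or K- the bracket with p - p* is the skew part of kp. Hence the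
      subalgebra \<open>Q\<close> of admissible multipliers contains these k and with them all of
      uRu.\<close>
    define Q where "Q = {m \<in> corner u u. \<forall>p\<in>P. p - star p \<in> L \<longrightarrow> m * p - star (m * p) \<in> L}"
    have Q: "subalgebra Q"
    proof -
      have "0 \<in> Q" using subspace_0[OF sL] subspace_0[OF subspace_corner] by (simp add: Q_def)
      moreover have "scale c x \<in> Q" if x: "x \<in> Q" for c x
      proof -
        have "scale c x * p - star (scale c x * p) = scale c (x * p - star (x * p))" for p
          by (simp only: scale_mult_left[symmetric] star_simps(6) scale_right_diff_distrib)
        then show ?thesis using x by (simp add: Q_def subspace_scale[OF sL] subspace_scale[OF subspace_corner])
      qed
      moreover have "x + y \<in> Q" if xy: "x \<in> Q" "y \<in> Q" for x y
      proof -
        have "(x + y) * p - star ((x + y) * p) = (x * p - star (x * p)) + (y * p - star (y * p))" for p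
          by (simp add: algebra_simps)
        then have "(x + y) * p - star ((x + y) * p) \<in> L" if "p \<in> P" "p - star p \<in> L" for p
          using xy that unfolding Q_def by (simp only: mem_Collect_eq subspace_add[OF sL])
        moreover have "x + y \<in> corner u u" using xy by (simp add: Q_def subspace_add[OF subspace_corner])
        ultimately show ?thesis unfolding Q_def by blast
      qed
      moreover have "x * y \<in> Q" if xy: "x \<in> Q" "y \<in> Q" for x y
      proof -
        have c: "x \<in> corner u u" "y \<in> corner u u" using xy by (simp_all add: Q_def)
        have "x * (y * p) - star (x * (y * p)) \<in> L" if p: "p \<in> P" "p - star p \<in> L" for p
          using xy p mult_P[OF c(2) p(1)] unfolding Q_def by blast
        then show ?thesis using corner_mult[OF c] unfolding Q_def by (simp only: mult.assoc mem_Collect_eq simp_thms) blast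
      qed
      ultimately show ?thesis by (simp add: subalgebra_def subspace_def)
    qed
    have "Kp \<union> Km \<subseteq> Q"
    proof
      fix k assume k: "k \<in> Kp \<union> Km"
      then have ku: "k \<in> corner u u" "star k = - k" "k \<in> L" using Kpu Kmu KpD(3) KmD(3) KpL KmL by auto
      have "k * p - star (k * p) \<in> L" if "p \<in> P" "p - star p \<in> L" for p
      proof -
        have "commutator k (p - star p) \<in> L" using ku that unfolding L_def by (intro commutator_lie_hull)
        then show ?thesis using commutator_P[OF ku(1,2) that(1)] by simp
      qed
      then show "k \<in> Q" using ku unfolding Q_def by blast
    qed
    then have "subalgebra hull (Kp \<union> Km) \<subseteq> Q" by (rule subalgebra_hull_minimal[OF Q])
    then have uQ: "corner u u \<subseteq> Q" using corner_u_generated[OF gen] by (rule order_trans[rotated])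
    \<comment> \<open>\<open>?V\<close> tests x(1 - u). Applying multipliers from uRu to
      \<open>Pf\<close> reaches all of P.\<close>
    let ?V = "{x. (x - x * u) - star (x - x * u) \<in> L}"
    have "{h * s | h s. h \<in> corner u u \<and> s \<in> Ss} \<subseteq> ?V"
    proof -
      have "h * s \<in> ?V" if h: "h \<in> corner u u" and s: "s \<in> Ss" for h s
      proof -
        let ?p = "u * s - u * s * u"
        have "?p \<in> Pf" using s by (simp add: Pf_def)
        then have "?p - star ?p \<in> X" unfolding X_def by blast
        then have "?p - star ?p \<in> L" unfolding L_def by (rule hull_inc)
        moreover have "?p \<in> P" using \<open>?p \<in> Pf\<close> PfP by blast
        moreover have "h \<in> Q" using h uQ by blast
        ultimately have "h * ?p - star (h * ?p) \<in> L" unfolding Q_def by blast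
        moreover have "h * ?p = h * s - h * s * u"
          using cornerD(2)[OF h] by (simp only: right_diff_distrib mult.assoc[symmetric])
        ultimately show ?thesis by (simp only: mem_Collect_eq)
      qed
      then show ?thesis by blast
    qed
    moreover have "subspace ?V"
    proof -
      define g where "g x = (x - x * u) - star (x - x * u)" for x
      have "g 0 = 0" "g (x + y) = g x + g y" "g (scale c x) = scale c (g x)" for x y c
      proof -
        show "g 0 = 0" "g (x + y) = g x + g y" unfolding g_def by (simp_all add: algebra_simps)
        show "g (scale c x) = scale c (g x)"
          unfolding g_def by (simp only: scale_mult_left[symmetric] star_simps(3,6) scale_right_diff_distrib[symmetric])
      qed
      then have "subspace {x. g x \<in> L}"
        unfolding subspace_def using subspace_0[OF sL] subspace_add[OF sL] subspace_scale[OF sL] by simp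
      then show ?thesis unfolding g_def .
    qed
    ultimately have "span {h * s | h s. h \<in> corner u u \<and> s \<in> Ss} \<subseteq> ?V" by (rule span_minimal)
    then have "u * p \<in> ?V" using left by blast
    moreover have "u * p - u * p * u = p" using PD(1,2)[OF p] by simp
    ultimately show ?thesis by (simp only: mem_Collect_eq)
  qed
  have "skew_gens \<subseteq> L" unfolding skew_gens_def using KpL KmL PL by blast
  then have "skew_lie \<subseteq> L" unfolding skew_lie_def L_def by (rule hull_minimal) (rule lie_closed_hull)
  then have "D \<subseteq> lie_closed hull X" using D_subset_skew_lie[OF gen] unfolding L_def by (rule order_trans[rotated])
  moreover have "finite X" using words.finite_short_pals G(3) by (simp add: X_def Pf_def)
  moreover have "X \<subseteq> D"
  proof -
    have "words.short_pals \<subseteq> D"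
    proof -
      have *: "words.pal w \<in> Kp \<union> Km" if w: "alternating TA TB w \<or> alternating TB TA w" "odd (length w)" for w
        using w(1)
      proof
        assume "alternating TA TB w"
        then show ?thesis
          using words.pal_skew_corner[OF inv uu(6) skew TAc(1) _ w(2)] by (simp add: Kp_def K_iff)
      next
        assume "alternating TB TA w"
        moreover have "star x = - x" if "x \<in> TB \<union> TA" for x using that skew by blast
        ultimately show ?thesis
          using swapped.pal_skew_corner[OF inv uu(6) _ TAc(2) _ w(2)] by (simp add: Km_def K_iff)
      qed
      then have "words.short_pals \<subseteq> Kp \<union> Km" unfolding words.short_pals_def by blast
      then show ?thesis using Kp_subset_D Km_subset_D by blast
    qed
    moreover have "(\<lambda>p. p - star p) ` Pf \<subseteq> D" using PfP P_subset_D by blast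
    ultimately show ?thesis by (simp add: X_def)
  qed
  ultimately show ?thesis by blast
qed

end

section \<open>The case of central products\<close>

context involution_idempotent
begin

definition "Z = {z \<in> A. \<forall>a\<in>A. z * a = a * z}"

text \<open>zA is a two-sided ideal of A and AzA = A, so zA contains e. The inverse commutes with A
  because z does.\<close>

lemma center_inverse:
  assumes z: "z \<in> Z" "z \<noteq> 0"
  shows "\<exists>w\<in>Z. z * w = e"
proof -
  have zA: "z \<in> A" and zc: "\<And>a. a \<in> A \<Longrightarrow> z * a = a * z" using z by (auto simp: Z_def)
  let ?I = "{x. \<exists>w\<in>A. x = z * w}"
  have "{a * z * b | a b. a \<in> corner e e \<and> b \<in> corner e e} \<subseteq> ?I"
  proof -
    have "a * z * b \<in> ?I" if "a \<in> A" "b \<in> A" for a b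
      using zc[OF that(1)] A_mult[OF that] by (intro CollectI bexI[of _ "a * b"]) (simp_all add: mult.assoc[symmetric])
    then show ?thesis unfolding A_def by blast
  qed
  moreover have "subspace ?I"
  proof (rule subspaceI)
    show "0 \<in> ?I" using subspace_0[OF subspace_A] by (intro CollectI bexI[of _ 0]) simp_all
    fix x assume "x \<in> ?I"
    then obtain w where w: "w \<in> A" "x = z * w" by blast
    show "scale c x \<in> ?I" for c
      using w subspace_scale[OF subspace_A w(1)] by (intro CollectI bexI[of _ "scale c w"]) (simp_all add: scale_mult_right)
    fix y assume "y \<in> ?I"
    then obtain v where v: "v \<in> A" "y = z * v" by blast
    show "x + y \<in> ?I"
      using w v subspace_add[OF subspace_A w(1) v(1)] by (intro CollectI bexI[of _ "w + v"]) (simp_all add: distrib_left)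
  qed
  ultimately have "span {a * z * b | a b. a \<in> corner e e \<and> b \<in> corner e e} \<subseteq> ?I" by (rule span_minimal)
  then have "e \<in> ?I"
    using corner_span[OF z(2) zA[unfolded A_def] ee ee ee ee e_A[unfolded A_def]] by (rule subsetD)
  then obtain w where w: "w \<in> A" "e = z * w" by blast
  have "w * a = a * w" if a: "a \<in> A" for a
  proof -
    have "w * a = w * (a * (z * w))" using AD[OF a] w by simp
    also have "\<dots> = w * (z * a) * w" using zc[OF a] by (simp add: mult.assoc)
    also have "\<dots> = (z * w) * (a * w)" using zc[OF w(1)] by (simp add: mult.assoc)
    also have "\<dots> = a * w" using AD[OF A_mult[OF a w(1)]] w(2) by simp
    finally show ?thesis .
  qed
  then have "w \<in> Z" using w(1) by (simp add: Z_def)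
  then show ?thesis using w(2)[symmetric] by (rule bexI[rotated])
qed

lemma field_module: "field_module scale Z A e"
proof unfold_locales
  have mult: "x * y \<in> Z" if xy: "x \<in> Z" "y \<in> Z" for x y
  proof -
    have A: "x \<in> A" "y \<in> A" using xy by (simp_all add: Z_def)
    have "x * y * a = a * (x * y)" if a: "a \<in> A" for a
    proof -
      have ya: "y * a = a * y" and xa: "x * a = a * x" using xy a unfolding Z_def by blast+
      have "x * y * a = x * (a * y)" by (simp only: mult.assoc ya)
      also have "\<dots> = a * x * y" by (simp only: mult.assoc[symmetric] xa)
      finally show ?thesis by (simp only: mult.assoc)
    qed
    then show ?thesis using A_mult[OF A] by (simp add: Z_def)
  qed
  have "subspace Z"
  proof (rule subspaceI)
    show "0 \<in> Z" by (simp add: Z_def subspace_0[OF subspace_A])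
    show "x + y \<in> Z" if "x \<in> Z" "y \<in> Z" for x y
      using that unfolding Z_def by (auto simp: subspace_add[OF subspace_A] distrib_left distrib_right)
    show "scale c x \<in> Z" if "x \<in> Z" for c x
      using that unfolding Z_def
      by (auto simp: subspace_scale[OF subspace_A] scale_mult_left[symmetric] scale_mult_right[symmetric])
  qed
  then show "subalgebra Z" using mult by (simp add: subalgebra_def)
  show "e \<in> Z" using e_A AD by (simp add: Z_def)
  show "e \<noteq> 0" by (rule e_nz)
  show "z * w = w * z" if "z \<in> Z" "w \<in> Z" for z w using that unfolding Z_def by blast
  show "e * z = z" if "z \<in> Z" for z using that AD unfolding Z_def by blast
  show "\<exists>w\<in>Z. z * w = e" if "z \<in> Z" "z \<noteq> 0" for z by (rule center_inverse[OF that])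
  show "subspace A" by (rule subspace_A)
  show "z * v \<in> A" if "z \<in> Z" "v \<in> A" for z v using that A_mult unfolding Z_def by blast
  show "e * v = v" if "v \<in> A" for v by (rule AD(1)[OF that])
  show "\<exists>v\<in>A. v \<noteq> 0" using e_A e_nz by blast
qed

lemma A_finitely_generated:
  obtains G where "finite G" "G \<subseteq> A" "A \<subseteq> subalgebra hull G"
proof -
  obtain G Rs Ss where G: "finite G" "finite Rs" "finite Ss" "G \<subseteq> corner e e"
    and "corner e e \<subseteq> subalgebra hull G"
    and "\<And>x. x \<in> span {r * h * s | r h s. r \<in> Rs \<and> h \<in> subalgebra hull G \<and> s \<in> Ss}"
    and "\<And>x. e * x \<in> span {h * s | h s. h \<in> corner e e \<and> s \<in> Ss}"
    by (rule corner_generation[OF fg e_nz ee]) (rule that)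
  then show ?thesis using that unfolding A_def by simp
qed

text \<open>If every product \<open>k l\<close> vanishes then \<open>k y k y\<^sup>* = 0\<close> and \<open>k y = k y\<^sup>*\<close> for \<open>y \<in> f R e\<close>, so
  \<open>k f R e\<close> is a right ideal in which all squares are zero, whence \<open>k = 0\<close>; and then \<open>a x = x a\<^sup>*\<close> on \<open>e R f\<close>.\<close>

lemma commutative_if_products_zero:
  assumes zero: "\<And>k l. k \<in> Kp \<Longrightarrow> l \<in> Km \<Longrightarrow> k * l = 0" and ab: "a \<in> A" "b \<in> A"
  shows "a * b = b * a"
proof -
  have Kp0: "k = 0" if k: "k \<in> Kp" for k
  proof -
    have kyA: "k * y \<in> A" if "y \<in> corner f e" for y
      unfolding A_def by (rule corner_mult[OF Kp_corner[OF k] that])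
    have sq: "k * y * (k * y) = 0" if y: "y \<in> corner f e" for y
    proof -
      have sy: "star y \<in> corner f e" using star_corner[OF y] by simp
      have "y - star y \<in> Km" using y sy by (simp add: Km_def K_iff subspace_diff[OF subspace_corner])
      then have "k * (y - star y) = 0" by (rule zero[OF k])
      then have 1: "k * y = k * star y" by (simp add: right_diff_distrib)
      have "y * k * star y \<in> corner f e"
        by (rule corner_mult[OF corner_mult[OF y Kp_corner[OF k]] sy])
      then have "y * k * star y \<in> Km" using KpD(3)[OF k] by (simp add: Km_def K_iff mult.assoc)
      then have "k * (y * k * star y) = 0" by (rule zero[OF k])
      then have "k * y * (k * star y) = 0" by (simp add: mult.assoc)
      then show ?thesis by (simp only: 1)
    qed
    have ky: "k * y = 0" if y: "y \<in> corner f e" for y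
    proof (rule corner_semiprime[OF ee kyA[OF y, unfolded A_def]])
      fix a assume a: "a \<in> corner e e"
      have ya: "y * a \<in> corner f e" by (rule corner_mult[OF y a])
      \<comment> \<open>Linearize the square: both squares and the term
        \<open>k * y * (k * (y * a))\<close> vanish, which leaves the term needed for
        semiprimeness.\<close>
      have "k * (y + y * a) * (k * (y + y * a)) = 0"
        by (rule sq[OF subspace_add[OF subspace_corner y ya]])
      moreover have "k * y * (k * (y * a)) = 0" using sq[OF y] by (simp add: mult.assoc[symmetric])
      ultimately have "k * (y * a) * (k * y) = 0"
        using sq[OF y] sq[OF ya] by (simp only: distrib_left distrib_right) simp
      then show "k * y * a * (k * y) = 0" by (simp add: mult.assoc)
    qed
    have "k * r * e = 0" for r
      using ky[OF corner_compress[OF ff ee, of r]] KpD(2)[OF k] by (simp add: mult.assoc[symmetric])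
    then show ?thesis using prime[of k e] e_nz by blast
  qed
  have swap: "c * x = x * star c" if c: "c \<in> A" and x: "x \<in> corner e f" for c x
  proof -
    have symmetric: "star y = y" if y: "y \<in> corner e f" for y
    proof -
      have "star y \<in> corner e f" using star_corner[OF y] by simp
      then have "y - star y \<in> Kp" using y by (simp add: Kp_def K_iff subspace_diff[OF subspace_corner])
      then show ?thesis using Kp0[of "y - star y"] by simp
    qed
    have "c * x \<in> corner e f" using c x unfolding A_def by (rule corner_mult)
    then show ?thesis using symmetric[of "c * x"] symmetric[OF x] by simp
  qed
  \<comment> \<open>Moving a and b past x in the two possible orders gives x a* b* = x b* a*, so eRf
    annihilates c; primeness then gives c = 0.\<close>
  define c where "c = star a * star b - star b * star a"
  have xc: "x * c = 0" if x: "x \<in> corner e f" for x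
  proof -
    have ax: "b * x \<in> corner e f" "a * x \<in> corner e f" using ab x unfolding A_def by (auto intro: corner_mult)
    have "a * (b * x) = a * (x * star b)" using swap[OF ab(2) x] by simp
    also have "\<dots> = x * star a * star b" using swap[OF ab(1) x] by (simp add: mult.assoc[symmetric])
    finally have "a * (b * x) = x * star a * star b" .
    moreover have "a * (b * x) = x * star b * star a" using swap[OF ab(2) x] swap[OF ab(1) ax(1)] by simp
    ultimately show ?thesis by (simp add: c_def right_diff_distrib mult.assoc)
  qed
  have "star a * f = star a" "f * star a = star a" "f * star b = star b"
    using star_A[OF ab(1)] star_A[OF ab(2)] cornerD[of _ f f] by blast+
  then have fc: "f * c = c" by (simp add: c_def right_diff_distrib mult.assoc[symmetric])
  have "e * r * c = 0" for r using xc[OF corner_compress[OF ee ff, of r]] fc by (simp add: mult.assoc)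
  then have "c = 0" using prime[of e c] e_nz by blast
  then have "star c = 0" by simp
  then show ?thesis by (simp add: c_def)
qed

text \<open>kl is central in A and nonzero, so it has an inverse w in \<open>Z\<close>, and l' = lw.
  It is skew because lw = w* l, which follows from w*(lk) = f, the image of (kl)w = e under the
  involution.\<close>

lemma normalized_pair:
  assumes central: "\<forall>x\<in>products. \<forall>a\<in>A. x * a = a * x"
    and nz: "k \<in> Kp" "l \<in> Km" "k * l \<noteq> 0"
  obtains l' where "l' \<in> Km" "k * l' = e" "l' * k = f"
proof -
  have klA: "k * l \<in> A" using products_A nz unfolding products_def by blast
  have "k * l \<in> Z" using central klA nz unfolding products_def Z_def by blast
  then obtain w where w: "w \<in> Z" "k * l * w = e" using center_inverse[OF _ nz(3)] by blast
  have wA: "w \<in> A" and wc: "w * (k * l) = e" using w klA by (auto simp: Z_def)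
  have sw: "star w * f = star w" using star_A[OF wA] cornerD(2) by blast
  have lc: "l * w \<in> corner f e" using corner_mult[OF Km_corner[OF nz(2)] wA[unfolded A_def]] .
  have skl: "star (k * l) = l * k" using KpD(3)[OF nz(1)] KmD(3)[OF nz(2)] by simp
  have "star w * (l * k) = f" using arg_cong[OF w(2), of star] skl by (simp add: mult.assoc)
  then have "l * w = star w * (l * k) * (l * w)" using cornerD(1)[OF lc] by simp
  also have "\<dots> = star w * l * (k * l * w)" by (simp add: mult.assoc)
  also have "\<dots> = star w * l" using w(2) KmD(2)[OF nz(2)] by (simp add: mult.assoc)
  finally have lw: "l * w = star w * l" .
  then have "star (l * w) = - (l * w)" using KmD(3)[OF nz(2)] by simp
  then have Km: "l * w \<in> Km" using lc by (simp add: Km_def K_iff)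
  have kl: "k * (l * w) = e" using w(2) by (simp add: mult.assoc)
  moreover have "l * w * k = f"
    using arg_cong[OF kl, of star] KpD(3)[OF nz(1)] KmD(3)[OF Km] by (simp del: star_simps(7) add: star_simps(7)[of k])
  ultimately show ?thesis using that Km by blast
qed

text \<open>The map y \<mapsto> k y l identifies fRf with A, so the involution of R becomes an
  involution \<tau> of A. If \<tau> s = s, then sk lies in K+, and s = (sk)l is a product, hence
  central. The skew parts b of the generators therefore satisfy bb' + b'b in the center, as in a
  Clifford algebra, and monomials in distinct b span over finitely many central elements.\<close>

lemma finite_over_center:
  assumes central: "\<forall>x\<in>products. \<forall>a\<in>A. x * a = a * x"
    and kl: "k \<in> Kp" "l \<in> Km" "k * l = e" "l * k = f"
  shows "\<exists>X B. finite X \<and> X \<subseteq> Z \<and> finite B \<and> B \<subseteq> A \<and> A \<subseteq> mspan (subalgebra hull (insert e X)) B"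
proof -
  define \<tau> where "\<tau> x = k * star x * l" for x
  have \<tau>A: "\<tau> x \<in> A" if "x \<in> A" for x
    unfolding \<tau>_def A_def
    by (rule corner_mult[OF corner_mult[OF Kp_corner[OF kl(1)] star_A[OF that]] Km_corner[OF kl(2)]])
  have \<tau>_add: "\<tau> (x + y) = \<tau> x + \<tau> y" "\<tau> (x - y) = \<tau> x - \<tau> y" "\<tau> (- x) = - \<tau> x" for x y
    by (simp_all add: \<tau>_def algebra_simps)
  have \<tau>\<tau>: "\<tau> (\<tau> x) = x" if x: "x \<in> A" for x
  proof -
    have "\<tau> (\<tau> x) = k * (l * x * k) * l"
      using KpD(3)[OF kl(1)] KmD(3)[OF kl(2)] by (simp add: \<tau>_def mult.assoc)
    also have "\<dots> = (k * l) * x * (k * l)" by (simp add: mult.assoc)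
    finally show ?thesis using kl(3) AD[OF x] by simp
  qed
  have \<tau>_mult: "\<tau> (x * y) = \<tau> y * \<tau> x" if x: "x \<in> A" "y \<in> A" for x y
  proof -
    have "star y * f = star y" using star_A[OF x(2)] cornerD(2) by blast
    then have "\<tau> (x * y) = k * (star y * f) * star x * l" by (simp add: \<tau>_def mult.assoc)
    also have "\<dots> = \<tau> y * \<tau> x" unfolding kl(4)[symmetric] by (simp add: \<tau>_def mult.assoc)
    finally show ?thesis .
  qed
  have symmetric_central: "s \<in> Z" if s: "s \<in> A" "\<tau> s = s" for s
  proof -
    have ss: "star s * f = star s" using star_A[OF s(1)] cornerD(2) by blast
    have "s * k = k * star s * l * k" using s(2) by (simp add: \<tau>_def)
    also have "\<dots> = k * star s" using kl(4) ss by (simp add: mult.assoc)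
    finally have "star (s * k) = - (s * k)" using KpD(3)[OF kl(1)] by simp
    moreover have "s * k \<in> corner e f" using s(1) Kp_corner[OF kl(1)] unfolding A_def by (rule corner_mult)
    ultimately have "s * k \<in> Kp" by (simp add: Kp_def K_iff)
    then have "s * k * l \<in> products" using kl(2) unfolding products_def by blast
    moreover have "s * k * l = s" using kl(3) AD[OF s(1)] by (simp add: mult.assoc)
    ultimately show ?thesis using central s(1) by (simp add: Z_def)
  qed
  obtain G where G: "finite G" "G \<subseteq> A" "A \<subseteq> subalgebra hull G" by (rule A_finitely_generated)
  define b where "b x = x - \<tau> x" for x
  define c where "c x = x + \<tau> x" for x
  have bA: "b x \<in> A" if "x \<in> G" for x
    using that G(2) \<tau>A unfolding b_def by (intro subspace_diff[OF subspace_A]) auto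
  have cZ: "c x \<in> Z" if "x \<in> G" for x
  proof (rule symmetric_central)
    have x: "x \<in> A" using that G(2) by blast
    show "c x \<in> A" unfolding c_def by (rule subspace_add[OF subspace_A x \<tau>A[OF x]])
    show "\<tau> (c x) = c x" using \<tau>\<tau>[OF x] by (simp add: c_def \<tau>_add add.commute)
  qed
  have bbZ: "b x * b y + b y * b x \<in> Z" if "x \<in> G" "y \<in> G" for x y
  proof (rule symmetric_central)
    have A: "b x \<in> A" "b y \<in> A" using bA that by simp_all
    show "b x * b y + b y * b x \<in> A" by (intro subspace_add[OF subspace_A] A_mult A)
    have \<tau>b: "\<tau> (b z) = - b z" if "z \<in> G" for z
      using \<tau>\<tau>[of z] that G(2) by (auto simp: b_def \<tau>_add)
    show "\<tau> (b x * b y + b y * b x) = b x * b y + b y * b x"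
      using \<tau>b that by (simp add: \<tau>_add \<tau>_mult[OF A] \<tau>_mult[OF A(2,1)] add.commute)
  qed
  define X where "X = c ` G \<union> (\<lambda>(x, y). b x * b y + b y * b x) ` (G \<times> G)"
  have X: "finite X" "X \<subseteq> Z" using G(1) cZ bbZ by (auto simp: X_def)
  interpret fm: field_module scale Z A e by (rule field_module)
  define C where "C = subalgebra hull (insert e X)"
  have subC: "fm.subring C" unfolding C_def by (rule fm.subring_hull[OF X(2)])
  note C = fm.subringD[OF subC]
  have XC: "insert e X \<subseteq> C" unfolding C_def by (rule hull_subset)
  have cC: "c x \<in> C" if "x \<in> G" for x using XC that by (auto simp: X_def)
  have bbC: "b x * b y + b y * b x \<in> C" if "x \<in> G" "y \<in> G" for x y
  proof -
    have "b x * b y + b y * b x \<in> X"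
      unfolding X_def by (rule UnI2, rule image_eqI[of _ _ "(x, y)"]) (use that in simp_all)
    then show ?thesis using XC by blast
  qed
  have Ccomm: "z * v = v * z" if "z \<in> C" "v \<in> A" for z v using C(5)[OF that(1)] that(2) by (simp add: Z_def)
  have mA: "mspan C B \<subseteq> A" if "B \<subseteq> A" for B
    by (rule mspan_minimal) (use that C(5) fm.V_closed subspace_A in auto)
  have mC: "v * z \<in> mspan C B" if "z \<in> C" "v \<in> mspan C B" "B \<subseteq> A" for z v B
    using mspan_mult_left[OF C(2) that(1,2)] Ccomm[OF that(1)] mA[OF that(3)] that(2) by auto
  have "\<exists>B. finite B \<and> B \<subseteq> A \<and> e \<in> B \<and> (\<forall>y\<in>H. \<forall>v\<in>mspan C B. v * b y \<in> mspan C B)"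
    if "finite H" "H \<subseteq> G" for H
    using that
  proof (induction H)
    case empty
    then show ?case using e_A by (intro exI[of _ "{e}"]) simp
  next
    case (insert x H)
    then obtain B where B: "finite B" "B \<subseteq> A" "e \<in> B"
      and closed: "\<And>y v. y \<in> H \<Longrightarrow> v \<in> mspan C B \<Longrightarrow> v * b y \<in> mspan C B" by auto
    have x: "x \<in> G" and H: "H \<subseteq> G" using insert.prems by simp_all
    \<comment> \<open>One new generator at most doubles the set: \<open>b x\<close> can be moved
      past the earlier \<open>b y\<close> up to coefficients in \<open>C\<close>, and its square
      lies in \<open>C\<close> because 2 is invertible.\<close>
    let ?B = "B \<union> (\<lambda>v. v * b x) ` B"
    let ?W = "mspan C ?B"
    have BA: "?B \<subseteq> A" using B(2) A_mult bA[OF x] by auto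
    have BW: "mspan C B \<subseteq> ?W" by (rule mspan_mono) simp_all
    have right: "v * b x \<in> ?W" if v: "v \<in> mspan C B" for v
    proof -
      have "mspan C B \<subseteq> {v. v * b x \<in> ?W}"
      proof (rule mspan_minimal)
        fix d v assume "d \<in> C" "v \<in> B"
        then have "d * (v * b x) \<in> ?W" by (intro mspan_base) simp_all
        then show "d * v \<in> {v. v * b x \<in> ?W}" by (simp add: mult.assoc)
      qed (rule subspace_mult_right_vimage[OF subspace_mspan])
      then show ?thesis using v by blast
    qed
    have bx2: "v * b x * b x \<in> mspan C B" if v: "v \<in> mspan C B" for v
    proof -
      have "v * (b x * b x + b x * b x) \<in> mspan C B" by (rule mC[OF bbC[OF x x] v B(2)])
      then have "v * b x * b x + v * b x * b x \<in> mspan C B" by (simp add: distrib_left mult.assoc)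
      then show ?thesis by (rule halve[OF two subspace_mspan])
    qed
    have old: "v * b y \<in> ?W" if "y \<in> insert x H" "v \<in> mspan C B" for y v
      using that closed right BW by auto
    have new: "v * b x * b y \<in> ?W" if y: "y \<in> insert x H" and v: "v \<in> mspan C B" for y v
    proof (cases "y = x")
      case True
      then show ?thesis using bx2[OF v] BW by auto
    next
      case False
      then have yH: "y \<in> H" using y by simp
      have "v * (b x * b y + b y * b x) \<in> mspan C B" using H yH by (intro mC[OF bbC v B(2)] x) auto
      then have "v * (b x * b y + b y * b x) \<in> ?W" using BW by blast
      moreover have "v * b y * b x \<in> ?W" by (rule right[OF closed[OF yH v]])
      ultimately have "v * (b x * b y + b y * b x) - v * b y * b x \<in> ?W" by (rule subspace_diff[OF subspace_mspan])
      then show ?thesis by (simp add: distrib_left mult.assoc)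
    qed
    have "?W \<subseteq> {w. w * b y \<in> ?W}" if y: "y \<in> insert x H" for y
    proof (rule mspan_minimal)
      fix d w assume d: "d \<in> C" and w: "w \<in> ?B"
      have "v \<in> mspan C B" if "v \<in> B" for v using mspan_base[OF C(4) that] AD B(2) that by auto
      then have "w * b y \<in> ?W" using w old[OF y] new[OF y] by auto
      then have "d * (w * b y) \<in> ?W" by (rule mspan_mult_left[OF C(2) d])
      then show "d * w \<in> {w. w * b y \<in> ?W}" by (simp add: mult.assoc)
    qed (rule subspace_mult_right_vimage[OF subspace_mspan])
    moreover have "finite ?B" "e \<in> ?B" using B by simp_all
    ultimately show ?case using BA by (intro exI[of _ ?B]) blast
  qed
  from this[OF G(1) order_refl] obtain B where B: "finite B" "B \<subseteq> A" "e \<in> B"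
    and closed: "\<And>y v. y \<in> G \<Longrightarrow> v \<in> mspan C B \<Longrightarrow> v * b y \<in> mspan C B" by blast
  let ?W = "mspan C B"
  \<comment> \<open>The right multipliers of \<open>?W\<close> form a subalgebra. It contains each
    generator x since 2x is the sum of \<open>c x\<close> and \<open>b x\<close>; applied to
    \<open>e\<close> it shows that \<open>?W\<close> is all of A.\<close>
  let ?S = "{a. \<forall>v\<in>?W. v * a \<in> ?W}"
  have "subspace ?S"
    unfolding subspace_def
    by (auto simp: distrib_left scale_mult_right[symmetric] subspace_0 subspace_add subspace_scale)
  then have "subalgebra ?S" by (simp add: subalgebra_def mult.assoc[symmetric])
  moreover have "G \<subseteq> ?S"
  proof
    fix x assume x: "x \<in> G"
    have "v * x \<in> ?W" if v: "v \<in> ?W" for v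
    proof -
      have "v * c x + v * b x \<in> ?W"
        by (rule subspace_add[OF subspace_mspan mC[OF cC[OF x] v B(2)] closed[OF x v]])
      then have "v * x + v * x \<in> ?W" by (simp add: b_def c_def algebra_simps)
      then show ?thesis by (rule halve[OF two subspace_mspan])
    qed
    then show "x \<in> ?S" by blast
  qed
  ultimately have "subalgebra hull G \<subseteq> ?S" by (rule subalgebra_hull_minimal)
  with G(3) have AS: "A \<subseteq> ?S" by (rule order_trans)
  have "e \<in> ?W" using mspan_base[OF C(4) B(3)] ee by simp
  then have "A \<subseteq> ?W" using AS AD(1) by fastforce
  then show ?thesis unfolding C_def using X B by blast
qed

lemma central_case:
  assumes central: "\<forall>x\<in>products. \<forall>a\<in>A. x * a = a * x"
  shows "\<exists>B. finite B \<and> A \<subseteq> span B"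
proof -
  interpret fm: field_module scale Z A e by (rule field_module)
  show ?thesis
  proof (cases "\<forall>k\<in>Kp. \<forall>l\<in>Km. k * l = 0")
    case True
    obtain G where G: "finite G" "G \<subseteq> A" "A \<subseteq> subalgebra hull G" by (rule A_finitely_generated)
    have "a * b = b * a" if "a \<in> A" "b \<in> A" for a b
      using True that by (intro commutative_if_products_zero) auto
    then have ZA: "Z = A" unfolding Z_def by blast
    have "subalgebra hull G \<subseteq> subalgebra hull (insert e G)" by (rule hull_mono) blast
    with G(3) have AG: "A \<subseteq> subalgebra hull (insert e G)" by (rule order_trans)
    \<comment> \<open>A commutative A is its own center, and it is generated by e as a module over
      itself.\<close>
    have "A \<subseteq> mspan (subalgebra hull (insert e G)) {e}"
    proof
      fix a assume a: "a \<in> A"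
      have "a * e \<in> mspan (subalgebra hull (insert e G)) {e}"
        using subsetD[OF AG a] by (rule mspan_base) simp
      then show "a \<in> mspan (subalgebra hull (insert e G)) {e}" using AD(2)[OF a] by simp
    qed
    then show ?thesis
      using fm.finite_dimensional_if_finite_module[of G "{e}"] G(1,2) ZA e_A by simp
  next
    case False
    then obtain k l where kl: "k \<in> Kp" "l \<in> Km" "k * l \<noteq> 0" by blast
    then obtain l' where "l' \<in> Km" "k * l' = e" "l' * k = f"
      by (rule normalized_pair[OF central])
    from finite_over_center[OF central kl(1) this] show ?thesis
      by (elim exE conjE) (rule fm.finite_dimensional_if_finite_module)
  qed
qed

lemma derived_skew_finitely_generated: "\<exists>X. finite X \<and> X \<subseteq> D \<and> D \<subseteq> lie_closed hull X"
  using dichotomy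
proof
  assume "\<forall>x\<in>products. \<forall>a\<in>A. x * a = a * x"
  then obtain B where "finite B" "A \<subseteq> span B" using central_case by blast
  then show ?thesis by (rule finite_dimensional_case)
qed (rule generated_case)

end

theorem theorem3:
  fixes scale :: "'f::field \<Rightarrow> 'a::ring \<Rightarrow> 'a"
    and star :: "'a \<Rightarrow> 'a"
    and e :: 'a
  defines "K \<equiv> skew_elements star"
  defines "KK \<equiv> assoc_algebra.commutator_span scale K K"
  assumes "CHAR('f) \<noteq> 2"
    and "assoc_algebra scale"
    and "assoc_algebra.simple scale"
    and "assoc_algebra.finitely_generated scale"
    and "assoc_algebra.involution scale star"
    and "e \<noteq> 0" and "e * e = e"
    and "e * star e = 0" and "star e * e = 0"
  shows "lie_finitely_generated
           (lie_quotient (assoc_algebra.commutator_lie_algebra scale KK) (KK \<inter> ring_center))"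
proof -
  interpret assoc_algebra scale by fact
  have "(2::'f) \<noteq> 0"
  proof
    assume "(2::'f) = 0"
    then have "of_nat 2 = (0::'f)" by simp
    \<comment> \<open>The characteristic divides 2 and is neither 0 nor 2, so it would have to be
      1.\<close>
    then have "CHAR('f) dvd 2" by (simp only: of_nat_eq_0_iff_char_dvd)
    then have "CHAR('f) \<le> 2" "CHAR('f) \<noteq> 0" by (rule dvd_imp_le, simp) (use \<open>CHAR('f) dvd 2\<close> in \<open>intro notI, simp\<close>)
    then have "CHAR('f) = 1" using assms(3) by linarith
    then have "of_nat 1 = (0::'f)" by (simp only: of_nat_eq_0_iff_char_dvd dvd_refl)
    then show False by simp
  qed
  then interpret involution_idempotent scale e star
    by unfold_locales (use assms in simp_all)
  have D: "D = KK" unfolding D_def KK_def K_def assms(1) ..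
  obtain X where X: "finite X" "X \<subseteq> D" "D \<subseteq> lie_closed hull X"
    using derived_skew_finitely_generated by blast
  have "lie_algebra (commutator_lie_algebra D)"
    using lie_algebra_derived_skew[OF inv] unfolding D_def K_def .
  then show ?thesis
    unfolding D[symmetric] using X
    by (rule lie_finitely_generated_quotient[OF _ lie_ideal_center[OF subspace_D]])
qed

end
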